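(* Consider the multivariate approximation problem $\mathrm{APP}=(\mathrm{APP}_d)_{d\in\mathbb{N}}$, $\mathrm{APP}_d\colon H_d\to G_d=L_2(D_d,\varrho_d)$, $\mathrm{APP}_d f:=f$, with respect to the worst case setting for the absolute ($\mathrm{crit}=\mathrm{abs}$) or normalized ($\mathrm{crit}=\mathrm{norm}$) error criterion. Let $s,t>0$ and assume that the trace of $W_d:=\mathrm{APP}_d^*\circ\mathrm{APP}_d$ is finite and non-trivial (i.e. $0<\mathrm{trace}(W_d)<\infty$) for all $d\in\mathbb{N}$. If, additionally, $$\lim_{d\to\infty}\frac{\ln\lceil \mathrm{trace}(W_d)/\mathrm{CRI}_d\rceil}{d^{t}}=0,$$ then $(s,t)$-weak tractability of $\mathrm{APP}$ for the class $\Lambda^{\mathrm{all}}$ and $(s,t)$-weak tractability of $\mathrm{APP}$ for the class $\Lambda^{\mathrm{std}}$ are equivalent.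
   Context: Setting. For every $d\in\mathbb{N}=\{1,2,\dots\}$, $H_d$ is a non-trivial separable reproducing kernel Hilbert space of $d$-variate functions defined (almost everywhere) on a set $D_d\subset\mathbb{R}^d$ of positive Lebesgue measure; $G_d:=L_2(D_d,\varrho_d)$ is the space of functions on $D_d$ that are square-integrable with respect to a probability density $\varrho_d$; and $H_d$ is continuously embedded in $G_d$, $\mathrm{APP}_d$ being the embedding operator. Let $W_d:=\mathrm{APP}_d^*\circ\mathrm{APP}_d\colon H_d\to H_d$ with eigenvalues $\lambda_{d,1}\ge\lambda_{d,2}\ge\dots\ge0$ (with multiplicity), and $\mathrm{trace}(W_d):=\sum_{j=1}^{\dim H_d}\lambda_{d,j}$. Put $\mathrm{CRI}_d:=1$ if $\mathrm{crit}=\mathrm{abs}$ and $\mathrm{CRI}_d:=\lambda_{d,1}$ if $\mathrm{crit}=\mathrm{norm}$. $\lceil x\rceil$ is the smallest natural number larger than or equal to $x>0$. Information complexity. $\Lambda^{\mathrm{all}}$ is the class of all continuous linear functionals on $H_d$, $\Lambda^{\mathrm{std}}$ the class of all function evaluations $f\mapsto f(x)$, $x\in D_d$. For $\Lambda\in\{\Lambda^{\mathrm{all}},\Lambda^{\mathrm{std}}\}$ and $n\in\mathbb{N}_0$, let $e(n,d;\Lambda):=\inf_A\sup_{\|f\|_{H_d}\le1}\|f-Af\|_{G_d}$, the infimum being over all (deterministic, linear, non-adaptive) algorithms $A$ using at most $n$ information operations from $\Lambda$. The initial error is $\epsilon_d^{\mathrm{init}}:=e(0,d;\Lambda)=\|\mathrm{APP}_d\|=\lambda_{d,1}^{1/2}$.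 Then $n^{\mathrm{abs}}(\epsilon,\mathrm{APP}_d;\Lambda):=\min\{n\in\mathbb{N}_0: e(n,d;\Lambda)\le\epsilon\}$ and $n^{\mathrm{norm}}(\epsilon,\mathrm{APP}_d;\Lambda):=\min\{n\in\mathbb{N}_0: e(n,d;\Lambda)\le\epsilon\cdot\epsilon_d^{\mathrm{init}}\}$. $(s,t)$-weak tractability. For fixed $s,t\ge0$, $\mathrm{APP}$ is $(s,t)$-weakly tractable for the class $\Lambda$ (and the given criterion) if $$\lim_{\epsilon^{-1}+d\to\infty}\frac{\ln n^{\mathrm{crit}}(\epsilon,\mathrm{APP}_d;\Lambda)}{\epsilon^{-s}+d^{t}}=0,$$ where the limit is taken along all sequences $((\epsilon_k,d_k))_{k\in\mathbb{N}}\subset(0,1]\times\mathbb{N}$ with $\epsilon_k^{-1}+d_k\to\infty$ and, for all $k$, $\epsilon_k<\epsilon_{d_k}^{\mathrm{init}}$ if $\mathrm{crit}=\mathrm{abs}$, respectively $\epsilon_k<1$ if $\mathrm{crit}=\mathrm{norm}$. *)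

theory Defs
  imports "HOL-Analysis.Analysis"
begin

text \<open>
  Points of \<open>d\<close>-dimensional space are functions \<open>nat \<Rightarrow> real\<close> in the space of the product measure
  over \<open>{..<d}\<close>. Completing that product gives Lebesgue measure.
\<close>

type_synonym point = "nat \<Rightarrow> real"
type_synonym fn = "point \<Rightarrow> real"

definition lebesgue_dim :: "nat \<Rightarrow> point measure" where
  "lebesgue_dim d = completion (PiM {..<d} (\<lambda>_. lborel))"

text \<open>
  The data for one \<open>d\<close>: domain \<open>D\<^sub>d\<close>, density \<open>\<rho>\<^sub>d\<close>, and the Hilbert space \<open>H\<^sub>d\<close> given by its set of
  functions and its inner product. A real-valued function on \<open>D\<^sub>d\<close> is represented by its extension
  by \<open>0\<close>, so that pointwise operations and equality are those of functions on \<open>D\<^sub>d\<close>.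
\<close>

record space_data =
  Dset :: "point set"
  dens :: "point \<Rightarrow> real"
  Hsp :: "fn set"
  ip :: "fn \<Rightarrow> fn \<Rightarrow> real"

definition hnorm :: "space_data \<Rightarrow> fn \<Rightarrow> real" where
  "hnorm P f = sqrt (ip P f f)"

text \<open>
  The value \<open>0\<close> outside \<open>Hsp P\<close> is only there because \<^locale>\<open>Metric_space\<close> asks for symmetry and
  nonnegativity on the whole type.
\<close>

definition hdist :: "space_data \<Rightarrow> fn \<Rightarrow> fn \<Rightarrow> real" where
  "hdist P f g = (if f \<in> Hsp P \<and> g \<in> Hsp P then hnorm P (\<lambda>x. f x - g x) else 0)"

definition pre_hilbert_fun_space :: "space_data \<Rightarrow> bool" where
  "pre_hilbert_fun_space P \<longleftrightarrow>
     (\<forall>f\<in>Hsp P. \<forall>x. x \<notin> Dset P \<longrightarrow> f x = 0) \<and>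
     (\<lambda>x. 0) \<in> Hsp P \<and>
     (\<forall>f\<in>Hsp P. \<forall>g\<in>Hsp P. (\<lambda>x. f x + g x) \<in> Hsp P) \<and>
     (\<forall>c. \<forall>f\<in>Hsp P. (\<lambda>x. c * f x) \<in> Hsp P) \<and>
     (\<forall>f\<in>Hsp P. \<forall>g\<in>Hsp P. ip P f g = ip P g f) \<and>
     (\<forall>f\<in>Hsp P. \<forall>g\<in>Hsp P. \<forall>h\<in>Hsp P. ip P (\<lambda>x. f x + g x) h = ip P f h + ip P g h) \<and>
     (\<forall>c. \<forall>f\<in>Hsp P. \<forall>g\<in>Hsp P. ip P (\<lambda>x. c * f x) g = c * ip P f g) \<and>
     (\<forall>f\<in>Hsp P. 0 \<le> ip P f f) \<and>
     (\<forall>f\<in>Hsp P. ip P f f = 0 \<longrightarrow> f = (\<lambda>x. 0))"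

definition separable_rkhs :: "space_data \<Rightarrow> bool" where
  "separable_rkhs P \<longleftrightarrow>
     pre_hilbert_fun_space P \<and>
     Metric_space.mcomplete (Hsp P) (hdist P) \<and>
     separable_space (Metric_space.mtopology (Hsp P) (hdist P)) \<and>
     (\<forall>x\<in>Dset P. \<exists>C. \<forall>f\<in>Hsp P. \<bar>f x\<bar> \<le> C * hnorm P f)"

definition G_measure :: "nat \<Rightarrow> space_data \<Rightarrow> point measure" where
  "G_measure d P = density (restrict_space (lebesgue_dim d) (Dset P)) (\<lambda>x. ennreal (dens P x))"

text \<open>
  \<open>G\<^sub>d = L\<^sub>2(D\<^sub>d, \<rho>\<^sub>d)\<close> through representatives. Almost everywhere equal functions are not identified;
  everything below depends on them only via integrals.
\<close>

definition Gsp :: "nat \<Rightarrow> space_data \<Rightarrow> fn set" where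
  "Gsp d P = {g. g \<in> borel_measurable (G_measure d P) \<and> integrable (G_measure d P) (\<lambda>x. (g x)\<^sup>2)}"

definition gip :: "nat \<Rightarrow> space_data \<Rightarrow> fn \<Rightarrow> fn \<Rightarrow> real" where
  "gip d P f g = (\<integral>x. f x * g x \<partial>G_measure d P)"

definition gnorm :: "nat \<Rightarrow> space_data \<Rightarrow> fn \<Rightarrow> real" where
  "gnorm d P f = sqrt (gip d P f f)"

definition approximation_setting :: "nat \<Rightarrow> space_data \<Rightarrow> bool" where
  "approximation_setting d P \<longleftrightarrow>
     Dset P \<in> sets (lebesgue_dim d) \<and> emeasure (lebesgue_dim d) (Dset P) > 0 \<and>
     dens P \<in> borel_measurable (restrict_space (lebesgue_dim d) (Dset P)) \<and>
     (\<forall>x\<in>Dset P. 0 \<le> dens P x) \<and>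
     (\<integral>\<^sup>+x. ennreal (dens P x) \<partial>restrict_space (lebesgue_dim d) (Dset P)) = 1 \<and>
     separable_rkhs P \<and> (\<exists>f\<in>Hsp P. f \<noteq> (\<lambda>x. 0)) \<and>
     Hsp P \<subseteq> Gsp d P \<and> (\<exists>C. \<forall>f\<in>Hsp P. gnorm d P f \<le> C * hnorm P f)"

definition APP :: "fn \<Rightarrow> fn" where
  "APP f = f"

definition APP_adj :: "nat \<Rightarrow> space_data \<Rightarrow> fn \<Rightarrow> fn" where
  "APP_adj d P g = (THE h. h \<in> Hsp P \<and> (\<forall>f\<in>Hsp P. ip P f h = gip d P (APP f) g))"

definition W :: "nat \<Rightarrow> space_data \<Rightarrow> fn \<Rightarrow> fn" where
  "W d P = APP_adj d P \<circ> APP"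

text \<open>
  \<open>l\<close> lists the eigenvalues of \<open>W\<close> in nonincreasing order and with multiplicity, where \<open>l j\<close> is
  \<open>\<lambda>\<^sub>d\<^sub>,\<^sub>j\<^sub>+\<^sub>1\<close>, extended by \<open>0\<close> beyond the dimension of \<open>H\<^sub>d\<close>: for each \<open>\<mu> > 0\<close> the \<open>e j\<close> with
  \<open>l j = \<mu>\<close> form a complete orthonormal system of the eigenspace of \<open>\<mu>\<close> (the empty one if \<open>\<mu>\<close> is not an
  eigenvalue). That \<open>W\<close> is diagonalised by the \<open>e j\<close>, or is compact, is not part of this.
\<close>

definition eigenvalue_list :: "nat \<Rightarrow> space_data \<Rightarrow> (nat \<Rightarrow> real) \<Rightarrow> bool" where
  "eigenvalue_list d P l \<longleftrightarrow>
     decseq l \<and> (\<forall>j. 0 \<le> l j) \<and>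
     (\<exists>e. (\<forall>j. 0 < l j \<longrightarrow> e j \<in> Hsp P \<and> W d P (e j) = (\<lambda>x. l j * e j x)) \<and>
          (\<forall>i j. 0 < l i \<and> 0 < l j \<longrightarrow> ip P (e i) (e j) = (if i = j then 1 else 0)) \<and>
          (\<forall>\<mu>>0. \<forall>f\<in>Hsp P. W d P f = (\<lambda>x. \<mu> * f x) \<and> (\<forall>j. l j = \<mu> \<longrightarrow> ip P f (e j) = 0)
             \<longrightarrow> f = (\<lambda>x. 0)))"

definition eigen_trace :: "(nat \<Rightarrow> real) \<Rightarrow> ennreal" where
  "eigen_trace l = (\<Sum>j. ennreal (l j))"

datatype criterion = Abs | Norm

definition CRI :: "criterion \<Rightarrow> (nat \<Rightarrow> real) \<Rightarrow> real" where
  "CRI crit l = (case crit of Abs \<Rightarrow> 1 | Norm \<Rightarrow> l 0)"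

text \<open>Only the values of a functional on \<open>Hsp P\<close> matter.\<close>

definition Lambda_all :: "space_data \<Rightarrow> (fn \<Rightarrow> real) set" where
  "Lambda_all P = {L.
     (\<forall>f\<in>Hsp P. \<forall>g\<in>Hsp P. L (\<lambda>x. f x + g x) = L f + L g) \<and>
     (\<forall>c. \<forall>f\<in>Hsp P. L (\<lambda>x. c * f x) = c * L f) \<and>
     (\<exists>C. \<forall>f\<in>Hsp P. \<bar>L f\<bar> \<le> C * hnorm P f)}"

definition Lambda_std :: "space_data \<Rightarrow> (fn \<Rightarrow> real) set" where
  "Lambda_std P = {L. \<exists>x\<in>Dset P. L = (\<lambda>f. f x)}"

definition algorithms :: "nat \<Rightarrow> nat \<Rightarrow> space_data \<Rightarrow> (fn \<Rightarrow> real) set \<Rightarrow> (fn \<Rightarrow> fn) set" where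
  "algorithms n d P \<Lambda> = {A. \<exists>m\<le>n. \<exists>L g. (\<forall>i<m. L i \<in> \<Lambda> \<and> g i \<in> Gsp d P) \<and>
     A = (\<lambda>f x. \<Sum>i<m. L i f * g i x)}"

text \<open>
  In the setting above the supremum is over a nonempty bounded set of reals, and the infimum over a
  nonempty set of nonnegative reals.
\<close>

definition worst_case_error :: "nat \<Rightarrow> space_data \<Rightarrow> (fn \<Rightarrow> fn) \<Rightarrow> real" where
  "worst_case_error d P A = (SUP f\<in>{f \<in> Hsp P. hnorm P f \<le> 1}. gnorm d P (\<lambda>x. APP f x - A f x))"

definition min_error :: "nat \<Rightarrow> nat \<Rightarrow> space_data \<Rightarrow> (fn \<Rightarrow> real) set \<Rightarrow> real" where
  "min_error n d P \<Lambda> = (INF A\<in>algorithms n d P \<Lambda>. worst_case_error d P A)"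

definition init_error :: "nat \<Rightarrow> space_data \<Rightarrow> (fn \<Rightarrow> real) set \<Rightarrow> real" where
  "init_error d P \<Lambda> = min_error 0 d P \<Lambda>"

text \<open>The complexity is \<open>\<infinity>\<close> (the infimum of the empty set) if no \<open>n\<close> achieves the required error.\<close>

definition info_complexity ::
    "criterion \<Rightarrow> real \<Rightarrow> nat \<Rightarrow> space_data \<Rightarrow> (fn \<Rightarrow> real) set \<Rightarrow> enat" where
  "info_complexity crit \<epsilon> d P \<Lambda> =
     (INF n\<in>{n. min_error n d P \<Lambda> \<le> \<epsilon> * (case crit of Abs \<Rightarrow> 1 | Norm \<Rightarrow> init_error d P \<Lambda>)}. enat n)"

definition ln_enat :: "enat \<Rightarrow> ereal" where
  "ln_enat n = (case n of enat k \<Rightarrow> ereal (ln (real k)) | \<infinity> \<Rightarrow> \<infinity>)"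

definition weakly_tractable ::
    "real \<Rightarrow> real \<Rightarrow> criterion \<Rightarrow> (nat \<Rightarrow> space_data) \<Rightarrow> (space_data \<Rightarrow> (fn \<Rightarrow> real) set) \<Rightarrow> bool" where
  "weakly_tractable s t crit P \<Lambda> \<longleftrightarrow>
     (\<forall>(\<epsilon> :: nat \<Rightarrow> real) (d :: nat \<Rightarrow> nat).
        (\<forall>k. 0 < \<epsilon> k \<and> \<epsilon> k \<le> 1 \<and> 1 \<le> d k \<and>
             \<epsilon> k < (case crit of Abs \<Rightarrow> init_error (d k) (P (d k)) (\<Lambda> (P (d k))) | Norm \<Rightarrow> 1)) \<and>
        filterlim (\<lambda>k. inverse (\<epsilon> k) + real (d k)) at_top sequentially
        \<longrightarrow> (\<lambda>k. ln_enat (info_complexity crit (\<epsilon> k) (d k) (P (d k)) (\<Lambda> (P (d k))))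
                 / ereal (\<epsilon> k powr (- s) + real (d k) powr t)) \<longlonglongrightarrow> 0)"

end

theory Submission
  imports Defs
begin

text \<open>
  A function evaluation is a continuous linear functional on \<open>H\<^sub>d\<close>, so tractability for \<open>\<Lambda>\<^sup>s\<^sup>t\<^sup>d\<close> implies
  tractability for \<open>\<Lambda>\<^sup>a\<^sup>l\<^sup>l\<close>. The content is the converse, which rests on a comparison of the two
  complexities for each fixed \<open>d\<close>.

  Suppose that \<open>k\<close> arbitrary functionals achieve the error \<open>\<epsilon>\<close>. Replacing the range of that algorithm by
  an orthonormal system \<open>\<eta>\<^sub>1, \<dots>, \<eta>\<^sub>k\<close> of \<open>G\<^sub>d\<close> (\<open>Gram_Schmidt\<close>), the orthogonal projection
  \<open>f \<mapsto> \<Sum>\<^sub>j \<langle>f, \<eta>\<^sub>j\<rangle> \<eta>\<^sub>j\<close> has error at most \<open>\<epsilon>\<close>, and its coefficients are integrals, which can be estimated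
  from values of \<open>f\<close>. Draw points with density proportional to \<open>u = 1 + \<Sum>\<^sub>j \<eta>\<^sub>j\<^sup>2\<close> and weight the values
  accordingly. The mean square error of the coefficients, summed over \<open>j\<close> and over an orthonormal
  eigenbasis of \<open>W\<^sub>d\<close>, is at most \<open>(k + 1) trace(W\<^sub>d) / n\<close>, and this sum dominates the worst case over the
  unit ball of \<open>H\<^sub>d\<close>. The points can be fixed one after the other: the cross terms have mean zero, so some
  next point raises the accumulated square error by at most its mean (\<open>greedy_sample\<close>). Hence \<open>n\<close>
  function values achieve the error \<open>\<epsilon> + sqrt ((k + 1) trace(W\<^sub>d) / n)\<close> (\<open>sampling_error\<close>).

  This argument expands \<open>f\<close> in the eigenvectors belonging to the given eigenvalue list. That list alone
  says nothing about the rest of the spectrum, but tractability for \<open>\<Lambda>\<^sup>a\<^sup>l\<^sup>l\<close> makes the embedding a limit of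
  finite-rank operators. If it did not vanish on the orthogonal complement of the eigenvectors, a
  maximising sequence for \<open>\<parallel>f\<parallel>\<^sub>G / \<parallel>f\<parallel>\<^sub>H\<close> there would have a subsequence converging to a further
  eigenvector; so it vanishes there (\<open>perp_gnorm_zero\<close>). By separability of \<open>H\<^sub>d\<close>, one null set serves all functions of
  the complement (\<open>perp_AE_zero\<close>), and sample points outside of it do not see them.

  Altogether \<open>n\<^sup>s\<^sup>t\<^sup>d(\<epsilon>) \<le> 16 (n\<^sup>a\<^sup>l\<^sup>l(\<epsilon>/2) + 1) \<lceil>trace(W\<^sub>d) / CRI\<^sub>d\<rceil> \<lceil>1/\<epsilon>\<^sup>2\<rceil>\<close> (\<open>std_complexity_le\<close>). After taking
  logarithms and dividing by \<open>\<epsilon>\<^sup>-\<^sup>s + d\<^sup>t\<close>, the first factor is controlled by tractability for \<open>\<Lambda>\<^sup>a\<^sup>l\<^sup>l\<close>, the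
  second by the hypothesis on the trace, and the third because \<open>ln (1/\<epsilon>)\<close> grows slower than \<open>\<epsilon>\<^sup>-\<^sup>s\<close>.
\<close>

section \<open>Semi-inner product spaces of functions\<close>

text \<open>
  The form may vanish on nonzero functions. One locale then covers the Hilbert space, the space
  \<open>L\<^sub>2\<close> of representatives (where functions that vanish almost everywhere have norm \<open>0\<close>), and the defect
  form \<open>s \<langle>f, g\<rangle>\<^sub>H - \<langle>f, g\<rangle>\<^sub>G\<close> whose null vectors are eigenvectors of \<open>W\<close>.
\<close>

locale semi_inner_space =
  fixes V :: "('a \<Rightarrow> real) set" and b :: "('a \<Rightarrow> real) \<Rightarrow> ('a \<Rightarrow> real) \<Rightarrow> real"
  assumes zero_in [simp]: "(\<lambda>x. 0) \<in> V"
    and add_in [simp]: "\<lbrakk>f \<in> V; g \<in> V\<rbrakk> \<Longrightarrow> (\<lambda>x. f x + g x) \<in> V"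
    and scale_in [simp]: "f \<in> V \<Longrightarrow> (\<lambda>x. c * f x) \<in> V"
    and sym: "\<lbrakk>f \<in> V; g \<in> V\<rbrakk> \<Longrightarrow> b f g = b g f"
    and add_left: "\<lbrakk>f \<in> V; g \<in> V; h \<in> V\<rbrakk> \<Longrightarrow> b (\<lambda>x. f x + g x) h = b f h + b g h"
    and scale_left: "\<lbrakk>f \<in> V; h \<in> V\<rbrakk> \<Longrightarrow> b (\<lambda>x. c * f x) h = c * b f h"
    and nonneg [simp]: "f \<in> V \<Longrightarrow> 0 \<le> b f f"
begin

definition nrm :: "('a \<Rightarrow> real) \<Rightarrow> real" where
  "nrm f = sqrt (b f f)"

lemma diff_in [simp]:
  assumes "f \<in> V" "g \<in> V" shows "(\<lambda>x. f x - g x) \<in> V"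
  using add_in[OF assms(1) scale_in[OF assms(2), of "-1"]] by simp

lemma sum_in [simp]:
  assumes "\<And>i. i \<in> I \<Longrightarrow> F i \<in> V" shows "(\<lambda>x. \<Sum>i\<in>I. F i x) \<in> V"
  using assms by (induction I rule: infinite_finite_induct) auto

lemma sum_lessThan_in [simp]:
  assumes "\<And>i. i < m \<Longrightarrow> F i \<in> V" shows "(\<lambda>x. \<Sum>i<m::nat. F i x) \<in> V"
  using assms by (intro sum_in) auto

lemma diff_left:
  assumes "f \<in> V" "g \<in> V" "h \<in> V" shows "b (\<lambda>x. f x - g x) h = b f h - b g h"
  using add_left[of f "\<lambda>x. (-1) * g x" h] scale_left[of g h "-1"] scale_in[of g "-1"] assms
  by simp

lemma add_right:
  assumes "f \<in> V" "g \<in> V" "h \<in> V" shows "b h (\<lambda>x. f x + g x) = b h f + b h g"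
  using assms by (simp add: sym[of h] add_left)

lemma scale_right:
  assumes "f \<in> V" "h \<in> V" shows "b h (\<lambda>x. c * f x) = c * b h f"
  using assms by (simp add: sym[of h] scale_left)

lemma diff_right:
  assumes "f \<in> V" "g \<in> V" "h \<in> V" shows "b h (\<lambda>x. f x - g x) = b h f - b h g"
  using assms by (simp add: sym[of h] diff_left)

lemma zero_left [simp]: "h \<in> V \<Longrightarrow> b (\<lambda>x. 0) h = 0"
  using scale_left[of "\<lambda>x. 0" h 0] by simp

lemma zero_right [simp]: "h \<in> V \<Longrightarrow> b h (\<lambda>x. 0) = 0"
  using scale_right[of "\<lambda>x. 0" h 0] by simp

lemma sum_left:
  assumes "\<And>i. i \<in> I \<Longrightarrow> F i \<in> V" "h \<in> V"
  shows "b (\<lambda>x. \<Sum>i\<in>I. F i x) h = (\<Sum>i\<in>I. b (F i) h)"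
  using assms by (induction I rule: infinite_finite_induct) (auto simp: add_left)

lemma sum_right:
  assumes "\<And>i. i \<in> I \<Longrightarrow> F i \<in> V" "h \<in> V"
  shows "b h (\<lambda>x. \<Sum>i\<in>I. F i x) = (\<Sum>i\<in>I. b h (F i))"
  using assms by (induction I rule: infinite_finite_induct) (auto simp: add_right)

lemma sum_lessThan_left:
  assumes "\<And>i. i < m \<Longrightarrow> F i \<in> V" "h \<in> V"
  shows "b (\<lambda>x. \<Sum>i<m::nat. F i x) h = (\<Sum>i<m. b (F i) h)"
  using assms by (intro sum_left) auto

lemma sum_lessThan_right:
  assumes "\<And>i. i < m \<Longrightarrow> F i \<in> V" "h \<in> V"
  shows "b h (\<lambda>x. \<Sum>i<m::nat. F i x) = (\<Sum>i<m. b h (F i))"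
  using assms by (intro sum_right) auto

lemmas linear_simps = add_left diff_left scale_left sum_lessThan_left
  add_right diff_right scale_right sum_lessThan_right

lemma diff_self:
  assumes "f \<in> V" "g \<in> V"
  shows "b (\<lambda>x. f x - g x) (\<lambda>x. f x - g x) = b f f - 2 * b f g + b g g"
  using assms sym[of f g] by (simp add: linear_simps)

lemma add_self:
  assumes "f \<in> V" "g \<in> V"
  shows "b (\<lambda>x. f x + g x) (\<lambda>x. f x + g x) = b f f + 2 * b f g + b g g"
  using assms sym[of f g] by (simp add: linear_simps)

text \<open>
  The usual quadratic in the multiplier \<open>c\<close> of \<open>g\<close>; if \<open>g\<close> is a null vector, it degenerates to an affine
  function, which is nonnegative for all \<open>c\<close> only if its slope \<open>b f g\<close> is \<open>0\<close>.
\<close>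

lemma Cauchy_Schwarz_sq:
  assumes f: "f \<in> V" and g: "g \<in> V"
  shows "(b f g)\<^sup>2 \<le> b f f * b g g"
proof (cases "b g g = 0")
  case True
  have "b f g = 0"
  proof (rule ccontr)
    assume ne: "b f g \<noteq> 0"
    define c where "c = (b f f + 1) / (2 * b f g)"
    have "0 \<le> b (\<lambda>x. f x - c * g x) (\<lambda>x. f x - c * g x)"
      using f g by (intro nonneg diff_in scale_in)
    also have "\<dots> = b f f - 2 * c * b f g"
      using f g True by (simp add: diff_self linear_simps)
    also have "\<dots> = -1"
      using ne by (simp add: c_def field_simps)
    finally show False by simp
  qed
  then show ?thesis using True by simp
next
  case False
  with g have pos: "0 < b g g" using nonneg[of g] by linarith
  define c where "c = b f g / b g g"
  have "0 \<le> b (\<lambda>x. f x - c * g x) (\<lambda>x. f x - c * g x)"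
    using f g by (intro nonneg diff_in scale_in)
  also have "\<dots> = b f f - 2 * c * b f g + c * c * b g g"
    using f g by (simp add: diff_self linear_simps)
  also have "\<dots> = b f f - (b f g)\<^sup>2 / b g g"
    using pos by (simp add: c_def field_simps power2_eq_square)
  finally show ?thesis using pos by (simp add: field_simps)
qed

lemma nrm_nonneg [simp]: "f \<in> V \<Longrightarrow> 0 \<le> nrm f"
  by (simp add: nrm_def)

lemma nrm_sq: "f \<in> V \<Longrightarrow> (nrm f)\<^sup>2 = b f f"
  by (simp add: nrm_def)

lemma nrm_zero [simp]: "nrm (\<lambda>x. 0) = 0"
  by (simp add: nrm_def)

lemma Cauchy_Schwarz:
  assumes "f \<in> V" "g \<in> V" shows "\<bar>b f g\<bar> \<le> nrm f * nrm g"
proof -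
  have "\<bar>b f g\<bar> = sqrt ((b f g)\<^sup>2)" by simp
  also have "\<dots> \<le> sqrt (b f f * b g g)"
    by (intro real_sqrt_le_mono Cauchy_Schwarz_sq assms)
  finally show ?thesis by (simp add: nrm_def real_sqrt_mult)
qed

lemma nrm_scale: "f \<in> V \<Longrightarrow> nrm (\<lambda>x. c * f x) = \<bar>c\<bar> * nrm f"
  by (simp add: nrm_def linear_simps real_sqrt_mult flip: mult.assoc)

lemma nrm_add:
  assumes "f \<in> V" "g \<in> V" shows "nrm (\<lambda>x. f x + g x) \<le> nrm f + nrm g"
proof -
  have "(nrm (\<lambda>x. f x + g x))\<^sup>2 \<le> (nrm f + nrm g)\<^sup>2"
    using Cauchy_Schwarz[OF assms] assms
    by (simp add: nrm_sq add_self power2_sum)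
  then show ?thesis using assms by (meson add_nonneg_nonneg nrm_nonneg power2_le_imp_le)
qed

lemma nrm_diff:
  assumes "f \<in> V" "g \<in> V" shows "nrm (\<lambda>x. f x - g x) \<le> nrm f + nrm g"
  using nrm_add[OF assms(1) scale_in[OF assms(2), of "-1"]] nrm_scale[OF assms(2), of "-1"] by simp

lemma nrm_triangle:
  assumes "f \<in> V" "g \<in> V" "h \<in> V"
  shows "nrm (\<lambda>x. f x - h x) \<le> nrm (\<lambda>x. f x - g x) + nrm (\<lambda>x. g x - h x)"
  using nrm_add[of "\<lambda>x. f x - g x" "\<lambda>x. g x - h x"] assms by simp

lemma nrm_minus_commute:
  assumes "f \<in> V" "g \<in> V"
  shows "nrm (\<lambda>x. f x - g x) = nrm (\<lambda>x. g x - f x)"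
  using assms sym[of f g] by (simp add: nrm_def diff_self)

lemma nrm_reverse_triangle:
  assumes "f \<in> V" "g \<in> V"
  shows "\<bar>nrm f - nrm g\<bar> \<le> nrm (\<lambda>x. f x - g x)"
  using nrm_triangle[of f g "\<lambda>x. 0"] nrm_triangle[of g f "\<lambda>x. 0"] nrm_minus_commute[of f g] assms by auto

lemma nrm_sum:
  assumes "\<And>i. i \<in> I \<Longrightarrow> F i \<in> V"
  shows "nrm (\<lambda>x. \<Sum>i\<in>I. F i x) \<le> (\<Sum>i\<in>I. nrm (F i))"
  using assms
proof (induction I rule: infinite_finite_induct)
  case (insert i I)
  then have "nrm (\<lambda>x. F i x + (\<Sum>i\<in>I. F i x)) \<le> nrm (F i) + nrm (\<lambda>x. \<Sum>i\<in>I. F i x)"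
    by (intro nrm_add sum_in) auto
  with insert show ?case by force
qed auto

lemma left_tendsto:
  assumes F: "\<And>n. F n \<in> V" and f: "f \<in> V" and h: "h \<in> V"
    and lim: "(\<lambda>n::nat. nrm (\<lambda>x. F n x - f x)) \<longlonglongrightarrow> 0"
  shows "(\<lambda>n. b (F n) h) \<longlonglongrightarrow> b f h"
proof (rule LIM_zero_cancel, rule Lim_null_comparison)
  show "\<forall>\<^sub>F n in sequentially. norm (b (F n) h - b f h) \<le> nrm (\<lambda>x. F n x - f x) * nrm h"
    using Cauchy_Schwarz[OF diff_in[OF F f] h] F f h by (simp add: diff_left)
  show "(\<lambda>n. nrm (\<lambda>x. F n x - f x) * nrm h) \<longlonglongrightarrow> 0"
    using tendsto_mult_left_zero[OF lim] .
qed

lemma nrm_tendsto: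
  assumes F: "\<And>n. F n \<in> V" and f: "f \<in> V"
    and lim: "(\<lambda>n::nat. nrm (\<lambda>x. F n x - f x)) \<longlonglongrightarrow> 0"
  shows "(\<lambda>n. nrm (F n)) \<longlonglongrightarrow> nrm f"
proof (rule LIM_zero_cancel, rule Lim_null_comparison)
  show "\<forall>\<^sub>F n in sequentially. norm (nrm (F n) - nrm f) \<le> nrm (\<lambda>x. F n x - f x)"
    using nrm_reverse_triangle[OF F f] by simp
qed (rule lim)

text \<open>
  Members of the system may be the zero function. Gram-Schmidt can then keep the number of vectors on
  linearly dependent input, and the eigenvectors can be indexed by all natural numbers even if there
  are finitely many.
\<close>

definition orthonormal_or_zero :: "nat \<Rightarrow> (nat \<Rightarrow> 'a \<Rightarrow> real) \<Rightarrow> bool" where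
  "orthonormal_or_zero m \<eta> \<longleftrightarrow> (\<forall>i<m. \<eta> i \<in> V \<and> (b (\<eta> i) (\<eta> i) = 1 \<or> \<eta> i = (\<lambda>x. 0))) \<and>
     (\<forall>i<m. \<forall>j<m. i \<noteq> j \<longrightarrow> b (\<eta> i) (\<eta> j) = 0)"

lemma orthoD:
  assumes "orthonormal_or_zero m \<eta>"
  shows "i < m \<Longrightarrow> \<eta> i \<in> V"
    and "i < m \<Longrightarrow> b (\<eta> i) (\<eta> i) = 1 \<or> \<eta> i = (\<lambda>x. 0)"
    and "i < m \<Longrightarrow> j < m \<Longrightarrow> i \<noteq> j \<Longrightarrow> b (\<eta> i) (\<eta> j) = 0"
  using assms unfolding orthonormal_or_zero_def by blast+

lemma ortho_self_le:
  assumes "orthonormal_or_zero m \<eta>" "i < m" shows "b (\<eta> i) (\<eta> i) \<le> 1"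
  using orthoD(2)[OF assms] by auto

lemma ortho_coeff:
  assumes o: "orthonormal_or_zero m \<eta>" and j: "j < m" and f: "f \<in> V"
  shows "b (\<lambda>x. f x - (\<Sum>i<m. b f (\<eta> i) * \<eta> i x)) (\<eta> j) = 0"
proof -
  note V = orthoD(1)[OF o]
  have "(\<Sum>i<m. b f (\<eta> i) * b (\<eta> i) (\<eta> j)) = (\<Sum>i<m. if i = j then b f (\<eta> j) * b (\<eta> j) (\<eta> j) else 0)"
    by (rule sum.cong) (auto simp: orthoD(3)[OF o] j)
  also have "\<dots> = b f (\<eta> j) * b (\<eta> j) (\<eta> j)" using j by simp
  also have "\<dots> = b f (\<eta> j)" using orthoD(2)[OF o j] f by auto
  finally show ?thesis using f V j by (simp add: linear_simps)
qed

lemma ortho_sum_sq: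
  assumes o: "orthonormal_or_zero m \<eta>"
  shows "(nrm (\<lambda>x. \<Sum>i<m. a i * \<eta> i x))\<^sup>2 \<le> (\<Sum>i<m. (a i)\<^sup>2)"
proof -
  note V = orthoD(1)[OF o]
  have "(nrm (\<lambda>x. \<Sum>i<m. a i * \<eta> i x))\<^sup>2 = (\<Sum>i<m. \<Sum>j<m. a i * (a j * b (\<eta> i) (\<eta> j)))"
    using V by (subst nrm_sq) (auto simp: linear_simps sum_distrib_left)
  also have "\<dots> = (\<Sum>i<m. \<Sum>j<m. if j = i then a i * a i * b (\<eta> i) (\<eta> i) else 0)"
    by (intro sum.cong refl) (auto simp: orthoD(3)[OF o])
  also have "\<dots> = (\<Sum>i<m. (a i)\<^sup>2 * b (\<eta> i) (\<eta> i))" by (simp add: power2_eq_square)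
  also have "\<dots> \<le> (\<Sum>i<m. (a i)\<^sup>2)"
    using ortho_self_le[OF o] by (intro sum_mono) (auto intro: mult_left_le)
  finally show ?thesis .
qed

text \<open>
  The residual is orthogonal to its own projection (Pythagoras); this is the source of Bessel's
  inequality.
\<close>

lemma ortho_residual:
  assumes o: "orthonormal_or_zero m \<eta>" and f: "f \<in> V"
  shows "(nrm (\<lambda>x. f x - (\<Sum>i<m. b f (\<eta> i) * \<eta> i x)))\<^sup>2 = b f f - (\<Sum>i<m. (b f (\<eta> i))\<^sup>2)"
proof -
  note V = orthoD(1)[OF o]
  define p where "p = (\<lambda>x. f x - (\<Sum>i<m. b f (\<eta> i) * \<eta> i x))"
  define q where "q = (\<lambda>x. \<Sum>i<m. b f (\<eta> i) * \<eta> i x)"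
  have pV: "p \<in> V" unfolding p_def using V f by (intro diff_in sum_in scale_in) auto
  have qV: "q \<in> V" unfolding q_def using V by (intro sum_in scale_in) auto
  have p: "p = (\<lambda>x. f x - q x)" by (simp add: p_def q_def)
  have "b p q = (\<Sum>i<m. b f (\<eta> i) * b p (\<eta> i))"
    unfolding q_def using V pV by (simp add: linear_simps)
  also have "\<dots> = 0"
    using ortho_coeff[OF o _ f] by (intro sum.neutral) (auto simp: p_def)
  finally have "b f q = b q q" using f qV unfolding p by (simp add: diff_left)
  moreover have "b f q = (\<Sum>i<m. (b f (\<eta> i))\<^sup>2)"
    unfolding q_def using V f by (simp add: linear_simps power2_eq_square)
  ultimately show ?thesis
    using nrm_sq[OF pV] diff_self[OF f qV] by (simp flip: p p_def)
qed

lemma ortho_best_approx: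
  assumes o: "orthonormal_or_zero m \<eta>" and f: "f \<in> V"
  shows "nrm (\<lambda>x. f x - (\<Sum>i<m. b f (\<eta> i) * \<eta> i x)) \<le> nrm (\<lambda>x. f x - (\<Sum>i<m. a i * \<eta> i x))"
proof -
  note V = orthoD(1)[OF o]
  define p where "p = (\<lambda>x. f x - (\<Sum>i<m. b f (\<eta> i) * \<eta> i x))"
  define q where "q = (\<lambda>x. (\<Sum>i<m. (b f (\<eta> i) - a i) * \<eta> i x))"
  have pV: "p \<in> V" unfolding p_def using V f by (intro diff_in sum_in scale_in) auto
  have qV: "q \<in> V" unfolding q_def using V by (intro sum_in scale_in) auto
  have "b p q = (\<Sum>i<m. (b f (\<eta> i) - a i) * b p (\<eta> i))"
    unfolding q_def using V pV by (simp add: linear_simps)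
  also have "\<dots> = 0"
    using ortho_coeff[OF o _ f] by (intro sum.neutral) (auto simp: p_def)
  finally have "b (\<lambda>x. p x + q x) (\<lambda>x. p x + q x) = b p p + b q q"
    using pV qV by (simp add: add_self)
  then have "nrm p \<le> nrm (\<lambda>x. p x + q x)"
    unfolding nrm_def using qV by simp
  moreover have "(\<lambda>x. p x + q x) = (\<lambda>x. f x - (\<Sum>i<m. a i * \<eta> i x))"
    by (auto simp: p_def q_def algebra_simps sum_subtractf)
  ultimately show ?thesis by (simp add: p_def)
qed

text \<open>
  In a degenerate space the span can only be recovered up to vectors of norm \<open>0\<close>, which is enough for
  comparing approximation errors. A vector whose residual has norm \<open>0\<close> is replaced by the zero function.
\<close>

lemma Gram_Schmidt:
  assumes "\<And>i. i < m \<Longrightarrow> g i \<in> V"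
  shows "\<exists>\<eta>. orthonormal_or_zero m \<eta> \<and>
    (\<forall>c. \<exists>a. nrm (\<lambda>x. (\<Sum>i<m. c i * g i x) - (\<Sum>i<m. a i * \<eta> i x)) = 0)"
  using assms
proof (induction m)
  case 0
  then show ?case by (auto simp: orthonormal_or_zero_def)
next
  case (Suc m)
  then obtain \<eta> where o: "orthonormal_or_zero m \<eta>" and
    spn: "\<And>c. \<exists>a. nrm (\<lambda>x. (\<Sum>i<m. c i * g i x) - (\<Sum>i<m. a i * \<eta> i x)) = 0"
    by auto
  note V = orthoD(1)[OF o]
  have gm: "g m \<in> V" using Suc.prems by simp
  define h where "h = (\<lambda>x. g m x - (\<Sum>i<m. b (g m) (\<eta> i) * \<eta> i x))"
  have hV: "h \<in> V" unfolding h_def using V gm by (intro diff_in sum_in scale_in) auto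
  have h0: "b h (\<eta> j) = 0" if "j < m" for j
    unfolding h_def by (rule ortho_coeff[OF o that gm])
  define r where "r = nrm h"
  have bhh: "b h h = r * r" using nrm_sq[OF hV] by (simp add: r_def power2_eq_square)
  define \<eta>' where "\<eta>' = \<eta>(m := if r = 0 then (\<lambda>x. 0) else (\<lambda>x. (1 / r) * h x))"
  have new: "\<eta>' m \<in> V" "b (\<eta>' m) (\<eta>' m) = 1 \<or> \<eta>' m = (\<lambda>x. 0)"
  proof -
    have "b (\<lambda>x. q * h x) (\<lambda>x. q * h x) = 1" if "q * r = 1" for q
    proof -
      have "b (\<lambda>x. q * h x) (\<lambda>x. q * h x) = (q * r) * (q * r)"
        using hV bhh by (simp add: linear_simps)
      then show ?thesis using that by simp
    qed
    from this[of "1 / r"] show "b (\<eta>' m) (\<eta>' m) = 1 \<or> \<eta>' m = (\<lambda>x. 0)"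
      by (auto simp: \<eta>'_def)
    show "\<eta>' m \<in> V"
      using scale_in[OF hV, of "1 / r"] by (auto simp: \<eta>'_def)
  qed
  have newo: "b (\<eta>' m) (\<eta> j) = 0" "b (\<eta> j) (\<eta>' m) = 0" if "j < m" for j
  proof -
    show "b (\<eta>' m) (\<eta> j) = 0"
      using h0[OF that] V[OF that] hV by (auto simp: \<eta>'_def scale_left simp del: times_divide_eq_left)
    then show "b (\<eta> j) (\<eta>' m) = 0" using sym[OF V[OF that] new(1)] by simp
  qed
  have old: "\<eta>' j = \<eta> j" if "j < m" for j using that by (simp add: \<eta>'_def)
  have "orthonormal_or_zero (Suc m) \<eta>'"
    unfolding orthonormal_or_zero_def
  proof (intro conjI allI impI)
    fix i assume i: "i < Suc m"
    show "\<eta>' i \<in> V" "b (\<eta>' i) (\<eta>' i) = 1 \<or> \<eta>' i = (\<lambda>x. 0)"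
      using new orthoD(1,2)[OF o, of i] i by (cases "i = m"; simp add: old)+
    fix j assume "j < Suc m" "i \<noteq> j"
    then show "b (\<eta>' i) (\<eta>' j) = 0"
      using newo orthoD(3)[OF o, of i j] i by (cases "i = m"; cases "j = m") (simp_all add: old)
  qed
  moreover have "\<exists>a. nrm (\<lambda>x. (\<Sum>i<Suc m. c i * g i x) - (\<Sum>i<Suc m. a i * \<eta>' i x)) = 0" for c
  proof -
    obtain a where a: "nrm (\<lambda>x. (\<Sum>i<m. c i * g i x) - (\<Sum>i<m. a i * \<eta> i x)) = 0" (is "nrm ?A = 0")
      using spn by blast
    define a' where "a' = (\<lambda>i. if i = m then c m * r else a i + c m * b (g m) (\<eta> i))"
    let ?B = "\<lambda>x. c m * (h x - r * \<eta>' m x)"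
    have B: "nrm ?B = 0"
    proof (cases "r = 0")
      case True
      then show ?thesis using hV by (simp add: nrm_scale) (simp add: r_def)
    next
      case False
      then have "?B = (\<lambda>x. 0)" by (auto simp: \<eta>'_def)
      then show ?thesis by simp
    qed
    have AV: "?A \<in> V" using V Suc.prems by (intro diff_in sum_in scale_in) auto
    have BV: "?B \<in> V" using hV new by (intro diff_in scale_in) auto
    have eq: "(\<lambda>x. (\<Sum>i<Suc m. c i * g i x) - (\<Sum>i<Suc m. a' i * \<eta>' i x)) = (\<lambda>x. ?A x + ?B x)"
    proof
      fix x
      have "(\<Sum>i<m. a' i * \<eta>' i x) = (\<Sum>i<m. a i * \<eta> i x) + c m * (\<Sum>i<m. b (g m) (\<eta> i) * \<eta> i x)"
        by (simp add: a'_def old sum.distrib sum_distrib_left algebra_simps)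
      then show "(\<Sum>i<Suc m. c i * g i x) - (\<Sum>i<Suc m. a' i * \<eta>' i x) = ?A x + ?B x"
        by (simp add: h_def a'_def algebra_simps)
    qed
    have "nrm (\<lambda>x. ?A x + ?B x) = 0"
      using nrm_add[OF AV BV] nrm_nonneg[OF add_in[OF AV BV]] a B by linarith
    then show ?thesis by (intro exI[of _ a']) (simp only: eq)
  qed
  ultimately show ?case by blast
qed

end

section \<open>The Hilbert space, its embedding into the weighted space, and the operator W\<close>

locale embedded_rkhs =
  fixes d :: nat and P :: space_data
  assumes setting: "approximation_setting d P"
begin

abbreviation M :: "point measure" where "M \<equiv> G_measure d P"

lemma space_M: "space M = Dset P"
  using setting sets.sets_into_space[of "Dset P" "lebesgue_dim d"]
  by (auto simp: approximation_setting_def G_measure_def space_restrict_space)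

text \<open>
  The density turns the domain into a probability space, so that sample points can be drawn from it.
\<close>

lemma emeasure_M: "emeasure M (space M) = 1"
proof -
  let ?R = "restrict_space (lebesgue_dim d) (Dset P)"
  have [measurable]: "dens P \<in> borel_measurable ?R"
    using setting by (simp add: approximation_setting_def)
  have "emeasure M (space M) = (\<integral>\<^sup>+x. ennreal (dens P x) * indicator (space ?R) x \<partial>?R)"
    unfolding G_measure_def by (subst emeasure_density) auto
  also have "\<dots> = (\<integral>\<^sup>+x. ennreal (dens P x) \<partial>?R)"
    by (intro nn_integral_cong) auto
  finally show ?thesis using setting by (simp add: approximation_setting_def)
qed

lemma finite_measure_M: "finite_measure M"
  using emeasure_M by (intro finite_measureI) simp

lemma H_subset_G: "f \<in> Hsp P \<Longrightarrow> f \<in> Gsp d P"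
  using setting by (auto simp: approximation_setting_def)

lemma G_measurable: "f \<in> Gsp d P \<Longrightarrow> f \<in> borel_measurable M"
  by (simp add: Gsp_def)

lemma G_sq_integrable: "f \<in> Gsp d P \<Longrightarrow> integrable M (\<lambda>x. (f x)\<^sup>2)"
  by (simp add: Gsp_def)

lemma G_mult_integrable:
  assumes f: "f \<in> Gsp d P" and g: "g \<in> Gsp d P"
  shows "integrable M (\<lambda>x. f x * g x)"
proof (rule Bochner_Integration.integrable_bound)
  show "integrable M (\<lambda>x. (f x)\<^sup>2 + (g x)\<^sup>2)"
    using G_sq_integrable f g by simp
  show "(\<lambda>x. f x * g x) \<in> borel_measurable M"
    using G_measurable[OF f] G_measurable[OF g] by measurable
  have "\<bar>f x * g x\<bar> \<le> (f x)\<^sup>2 + (g x)\<^sup>2" for x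
  proof -
    have "2 * \<bar>f x * g x\<bar> \<le> (f x)\<^sup>2 + (g x)\<^sup>2"
      using sum_squares_bound[of "\<bar>f x\<bar>" "\<bar>g x\<bar>"] by (simp add: abs_mult)
    then show ?thesis using abs_ge_zero[of "f x * g x"] by linarith
  qed
  then show "AE x in M. norm (f x * g x) \<le> norm ((f x)\<^sup>2 + (g x)\<^sup>2)"
    by simp
qed

sublocale H: semi_inner_space "Hsp P" "ip P"
  rewrites "semi_inner_space.nrm (ip P) = hnorm P"
proof -
  show "semi_inner_space (Hsp P) (ip P)"
    using setting unfolding approximation_setting_def separable_rkhs_def pre_hilbert_fun_space_def
    by unfold_locales blast+
  then interpret semi_inner_space "Hsp P" "ip P" .
  show "nrm = hnorm P" by (simp add: fun_eq_iff nrm_def hnorm_def)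
qed

sublocale G: semi_inner_space "Gsp d P" "gip d P"
  rewrites "semi_inner_space.nrm (gip d P) = gnorm d P"
proof -
  show "semi_inner_space (Gsp d P) (gip d P)"
  proof
    show "(\<lambda>x. 0) \<in> Gsp d P" by (simp add: Gsp_def)
    show "(\<lambda>x. f x + g x) \<in> Gsp d P" if "f \<in> Gsp d P" "g \<in> Gsp d P" for f g
    proof -
      have "integrable M (\<lambda>x. (f x)\<^sup>2 + (g x)\<^sup>2 + 2 * (f x * g x))"
        using that by (intro Bochner_Integration.integrable_add integrable_mult_right
            G_sq_integrable G_mult_integrable)
      then show ?thesis
        using that by (simp add: Gsp_def power2_sum mult.assoc borel_measurable_add)
    qed
    show "(\<lambda>x. c * f x) \<in> Gsp d P" if "f \<in> Gsp d P" for f c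
      using that by (auto simp: Gsp_def power_mult_distrib intro!: borel_measurable_times)
    show "gip d P f g = gip d P g f" for f g
      by (simp add: gip_def mult.commute)
    show "gip d P (\<lambda>x. f x + g x) h = gip d P f h + gip d P g h"
      if "f \<in> Gsp d P" "g \<in> Gsp d P" "h \<in> Gsp d P" for f g h
      using that by (simp add: gip_def distrib_right G_mult_integrable)
    show "gip d P (\<lambda>x. c * f x) h = c * gip d P f h" for f h c
      by (simp add: gip_def mult.assoc)
    show "0 \<le> gip d P f f" for f
      by (simp add: gip_def)
  qed
  then interpret semi_inner_space "Gsp d P" "gip d P" .
  show "nrm = gnorm d P" by (simp add: fun_eq_iff nrm_def gnorm_def)
qed

lemma ip_definite: "f \<in> Hsp P \<Longrightarrow> ip P f f = 0 \<Longrightarrow> f = (\<lambda>x. 0)"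
  using setting by (simp add: approximation_setting_def separable_rkhs_def pre_hilbert_fun_space_def)

lemma hnorm_definite: "f \<in> Hsp P \<Longrightarrow> hnorm P f = 0 \<Longrightarrow> f = (\<lambda>x. 0)"
  using ip_definite[of f] H.nrm_sq[of f] by simp

definition embedding_bound :: real where
  "embedding_bound = (SOME C. 0 \<le> C \<and> (\<forall>f\<in>Hsp P. gnorm d P f \<le> C * hnorm P f))"

lemma embedding_bound: "0 \<le> embedding_bound" "f \<in> Hsp P \<Longrightarrow> gnorm d P f \<le> embedding_bound * hnorm P f"
proof -
  obtain C where C: "\<forall>f\<in>Hsp P. gnorm d P f \<le> C * hnorm P f"
    using setting by (auto simp: approximation_setting_def)
  have "\<exists>C. 0 \<le> C \<and> (\<forall>f\<in>Hsp P. gnorm d P f \<le> C * hnorm P f)"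
  proof (intro exI[of _ "max C 0"] conjI ballI)
    fix f assume f: "f \<in> Hsp P"
    have "C * hnorm P f \<le> max C 0 * hnorm P f"
      using f by (intro mult_right_mono) auto
    then show "gnorm d P f \<le> max C 0 * hnorm P f" using C f by force
  qed simp
  from someI_ex[OF this]
  show "0 \<le> embedding_bound" "f \<in> Hsp P \<Longrightarrow> gnorm d P f \<le> embedding_bound * hnorm P f"
    unfolding embedding_bound_def by blast+
qed

lemma gnorm_tendsto_zero:
  assumes F: "\<And>n. F n \<in> Hsp P" and lim: "(\<lambda>n::nat. hnorm P (F n)) \<longlonglongrightarrow> 0"
  shows "(\<lambda>n. gnorm d P (F n)) \<longlonglongrightarrow> 0"
proof (rule Lim_null_comparison)
  show "\<forall>\<^sub>F n in sequentially. norm (gnorm d P (F n)) \<le> embedding_bound * hnorm P (F n)"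
    using embedding_bound(2)[OF F] G.nrm_nonneg[OF H_subset_G[OF F]] by (intro always_eventually allI) simp
  show "(\<lambda>n. embedding_bound * hnorm P (F n)) \<longlonglongrightarrow> 0"
    using tendsto_mult_right_zero[OF lim] .
qed

lemma point_evaluation_bounded:
  assumes "x \<in> Dset P"
  shows "\<exists>C. \<forall>f\<in>Hsp P. \<bar>f x\<bar> \<le> C * hnorm P f"
  using assms setting by (simp add: approximation_setting_def separable_rkhs_def)

sublocale Hmetric: Metric_space "Hsp P" "hdist P"
proof
  show "0 \<le> hdist P f g" for f g by (simp add: hdist_def)
  show "hdist P f g = hdist P g f" for f g
    using H.nrm_minus_commute[of f g] by (auto simp: hdist_def)
  show "hdist P f g = 0 \<longleftrightarrow> f = g" if "f \<in> Hsp P" "g \<in> Hsp P" for f g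
    using hnorm_definite[OF H.diff_in[OF that]] that
    by (auto simp: hdist_def fun_eq_iff)
  show "hdist P f h \<le> hdist P f g + hdist P g h"
    if "f \<in> Hsp P" "g \<in> Hsp P" "h \<in> Hsp P" for f g h
    using that by (simp add: hdist_def H.nrm_triangle)
qed

lemma H_complete:
  assumes F: "\<And>n. F n \<in> Hsp P"
    and cauchy: "\<And>e. 0 < e \<Longrightarrow> \<exists>N. \<forall>m\<ge>N. \<forall>n\<ge>N. hnorm P (\<lambda>x. F m x - F n x) < e"
  shows "\<exists>f\<in>Hsp P. (\<lambda>n. hnorm P (\<lambda>x. F n x - f x)) \<longlonglongrightarrow> 0"
proof -
  have "Hmetric.MCauchy F"
    unfolding Hmetric.MCauchy_def using F cauchy by (auto simp: hdist_def)
  moreover have "Hmetric.mcomplete"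
    using setting by (simp add: approximation_setting_def separable_rkhs_def)
  ultimately obtain f where "limitin Hmetric.mtopology F f sequentially"
    unfolding Hmetric.mcomplete_def by blast
  then have "f \<in> Hsp P" "(\<lambda>n. hdist P (F n) f) \<longlonglongrightarrow> 0"
    by (auto simp: Hmetric.limitin_metric_dist_null)
  then show ?thesis using F by (auto simp: hdist_def)
qed

lemma H_countable_dense:
  "\<exists>C. countable C \<and> C \<subseteq> Hsp P \<and> (\<forall>f\<in>Hsp P. \<forall>e>0. \<exists>c\<in>C. hnorm P (\<lambda>x. f x - c x) < e)"
proof -
  have "separable_space Hmetric.mtopology"
    using setting by (simp add: approximation_setting_def separable_rkhs_def)
  then obtain C where C: "countable C" "C \<subseteq> Hsp P" "Hmetric.mtopology closure_of C = Hsp P"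
    by (auto simp: separable_space_def)
  have "\<exists>c\<in>C. hnorm P (\<lambda>x. f x - c x) < e" if "f \<in> Hsp P" "0 < e" for f e
  proof -
    have "\<exists>c\<in>C. c \<in> Hmetric.mball f e"
      using C(3) that by (auto simp: Hmetric.metric_closure_of)
    then show ?thesis by (auto simp: hdist_def)
  qed
  with C(1,2) show ?thesis by (intro exI[of _ C] conjI ballI allI impI)
qed

text \<open>
  The representer minimises \<open>\<parallel>h\<parallel>\<^sup>2 - 2 L h\<close>. Completeness is needed here, and it ensures that the description
  of the adjoint by a definite description does denote something.
\<close>

lemma Riesz:
  assumes add: "\<And>f g. f \<in> Hsp P \<Longrightarrow> g \<in> Hsp P \<Longrightarrow> L (\<lambda>x. f x + g x) = L f + L g"
    and scale: "\<And>c f. f \<in> Hsp P \<Longrightarrow> L (\<lambda>x. c * f x) = c * L f"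
    and bdd: "\<And>f. f \<in> Hsp P \<Longrightarrow> \<bar>L f\<bar> \<le> C * hnorm P f"
  obtains h where "h \<in> Hsp P" "\<And>f. f \<in> Hsp P \<Longrightarrow> ip P f h = L f"
proof -
  define \<phi> where "\<phi> h = ip P h h - 2 * L h" for h
  have diff: "L (\<lambda>x. f x - g x) = L f - L g" if "f \<in> Hsp P" "g \<in> Hsp P" for f g
    using add[OF that(1) H.scale_in[OF that(2)], of "-1"] scale[OF that(2), of "-1"] by simp
  have lower: "- C\<^sup>2 \<le> \<phi> h" if "h \<in> Hsp P" for h
  proof -
    have "2 * L h \<le> 2 * (C * hnorm P h)" using bdd[OF that] by linarith
    also have "\<dots> \<le> (hnorm P h)\<^sup>2 + C\<^sup>2" using sum_squares_bound[of C "hnorm P h"] by (simp add: algebra_simps)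
    finally show ?thesis using that by (simp add: \<phi>_def H.nrm_sq)
  qed
  define I where "I = (INF h\<in>Hsp P. \<phi> h)"
  have bb: "bdd_below (\<phi> ` Hsp P)" using lower by (rule bdd_belowI2)
  have I: "I \<le> \<phi> h" if "h \<in> Hsp P" for h
    unfolding I_def by (rule cINF_lower[OF bb that])
  have "\<exists>h\<in>Hsp P. \<phi> h < I + inverse (real (Suc n))" for n
  proof -
    have "Hsp P \<noteq> {}" using H.zero_in by blast
    moreover have "I < I + inverse (real (Suc n))" by simp
    ultimately show ?thesis using cINF_less_iff[OF _ bb] unfolding I_def by blast
  qed
  then obtain F where F: "\<And>n. F n \<in> Hsp P" and FI: "\<And>n. \<phi> (F n) < I + inverse (real (Suc n))"
    by metis
  \<comment> \<open>Parallelogram law: near-minimisers are close to each other.\<close>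
  have close: "(hnorm P (\<lambda>x. f x - g x))\<^sup>2 \<le> 2 * (\<phi> f - I) + 2 * (\<phi> g - I)"
    if f: "f \<in> Hsp P" and g: "g \<in> Hsp P" for f g
  proof -
    let ?m = "\<lambda>x. (1/2) * (f x + g x)"
    have m: "?m \<in> Hsp P" using f g by (intro H.scale_in H.add_in)
    have "ip P ?m ?m = (1/4) * (ip P f f + 2 * ip P f g + ip P g g)"
      using f g H.add_in[OF f g] by (simp only: H.scale_left H.scale_right H.scale_in) (simp add: H.add_self)
    moreover have "L ?m = (1/2) * (L f + L g)"
      using f g H.add_in[OF f g] by (simp only: scale add)
    ultimately have "\<phi> ?m = (1/4) * (ip P f f + 2 * ip P f g + ip P g g) - (L f + L g)"
      unfolding \<phi>_def by (simp only:) (simp add: add_divide_distrib)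
    moreover have "(hnorm P (\<lambda>x. f x - g x))\<^sup>2 = ip P f f - 2 * ip P f g + ip P g g"
      using f g by (simp add: H.nrm_sq H.diff_self)
    ultimately show ?thesis
      using I[OF m] \<phi>_def[of f] \<phi>_def[of g] by argo
  qed
  have "\<exists>N. \<forall>m\<ge>N. \<forall>n\<ge>N. hnorm P (\<lambda>x. F m x - F n x) < e" if "0 < e" for e
  proof -
    have "0 < e\<^sup>2 / 4" using that by simp
    then obtain N where N: "inverse (real (Suc N)) < e\<^sup>2 / 4" using reals_Archimedean by blast
    have "hnorm P (\<lambda>x. F m x - F n x) < e" if "m \<ge> N" "n \<ge> N" for m n
    proof -
      have "inverse (real (Suc m)) \<le> inverse (real (Suc N))" "inverse (real (Suc n)) \<le> inverse (real (Suc N))"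
        using that by (auto intro!: le_imp_inverse_le)
      with N FI[of m] FI[of n] close[OF F F, of m n]
      have "(hnorm P (\<lambda>x. F m x - F n x))\<^sup>2 < e\<^sup>2" by argo
      then show ?thesis using \<open>0 < e\<close> by (simp add: power_less_imp_less_base)
    qed
    then show ?thesis by blast
  qed
  then obtain h where h: "h \<in> Hsp P" and lim: "(\<lambda>n. hnorm P (\<lambda>x. F n x - h x)) \<longlonglongrightarrow> 0"
    using H_complete[of F, OF F] by blast
  have "\<phi> h \<le> I"
  proof (rule LIMSEQ_le)
    have "(\<lambda>n. (hnorm P (F n))\<^sup>2) \<longlonglongrightarrow> (hnorm P h)\<^sup>2"
      using H.nrm_tendsto[OF F h lim] by (intro tendsto_power)
    moreover have "(\<lambda>n. L (F n)) \<longlonglongrightarrow> L h"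
    proof (rule LIM_zero_cancel, rule Lim_null_comparison)
      show "\<forall>\<^sub>F n in sequentially. norm (L (F n) - L h) \<le> C * hnorm P (\<lambda>x. F n x - h x)"
        using bdd[OF H.diff_in[OF F h]] F h by (simp add: diff)
      show "(\<lambda>n. C * hnorm P (\<lambda>x. F n x - h x)) \<longlonglongrightarrow> 0"
        using tendsto_mult_right_zero[OF lim] .
    qed
    ultimately have "(\<lambda>n. (hnorm P (F n))\<^sup>2 - 2 * L (F n)) \<longlonglongrightarrow> (hnorm P h)\<^sup>2 - 2 * L h"
      by (intro tendsto_diff tendsto_mult tendsto_const)
    then show "(\<lambda>n. \<phi> (F n)) \<longlonglongrightarrow> \<phi> h"
      using F h by (simp add: \<phi>_def H.nrm_sq)
    show "(\<lambda>n. I + inverse (real (Suc n))) \<longlonglongrightarrow> I"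
      using LIMSEQ_inverse_real_of_nat_add[of I] .
    show "\<exists>N. \<forall>n\<ge>N. \<phi> (F n) \<le> I + inverse (real (Suc n))"
      using FI by (meson less_imp_le)
  qed
  have "ip P f h = L f" if f: "f \<in> Hsp P" for f
  proof (rule ccontr)
    \<comment> \<open>Otherwise a small step from the minimiser in the direction of f decreases the functional.\<close>
    assume ne: "ip P f h \<noteq> L f"
    define D where "D = L f - ip P f h"
    define c where "c = D / (ip P f f + 1)"
    have pos: "ip P f f + 1 > 0" using H.nonneg[OF f] by linarith
    have cf: "(\<lambda>x. c * f x) \<in> Hsp P" using f by simp
    have "\<phi> (\<lambda>x. h x + c * f x) = \<phi> h + c * c * ip P f f - 2 * c * D"
      using f h cf H.sym[OF f h]
      by (simp add: \<phi>_def add scale H.add_self H.linear_simps D_def algebra_simps)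
    also have "c * c * ip P f f \<le> c * c * (ip P f f + 1)"
      by (intro mult_left_mono) auto
    also have "c * c * (ip P f f + 1) = c * D" using pos by (simp add: c_def)
    finally have "\<phi> (\<lambda>x. h x + c * f x) \<le> \<phi> h - c * D" by (simp add: algebra_simps)
    moreover have "I \<le> \<phi> (\<lambda>x. h x + c * f x)" using I[of "\<lambda>x. h x + c * f x"] h cf by simp
    moreover have "c * D > 0" using ne pos by (auto simp: c_def D_def zero_less_mult_iff intro!: divide_pos_pos)
    ultimately show False using \<open>\<phi> h \<le> I\<close> by linarith
  qed
  then show ?thesis using that h by blast
qed

lemma W_eqI:
  assumes h: "h \<in> Hsp P" and eq: "\<And>f. f \<in> Hsp P \<Longrightarrow> ip P f h = gip d P f e"
  shows "W d P e = h"
proof -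
  have uniq: "h' = h" if h': "h' \<in> Hsp P" and eq': "\<forall>f\<in>Hsp P. ip P f h' = gip d P f e" for h'
  proof -
    have hh: "(\<lambda>x. h' x - h x) \<in> Hsp P" using h h' by simp
    have "ip P (\<lambda>x. h' x - h x) (\<lambda>x. h' x - h x) = 0"
      using eq[OF hh] eq' hh h h' by (simp add: H.diff_right)
    from ip_definite[OF hh this] show ?thesis by (simp add: fun_eq_iff)
  qed
  have "h \<in> Hsp P \<and> (\<forall>f\<in>Hsp P. ip P f h = gip d P f e)"
    using h eq by blast
  then show ?thesis
    unfolding W_def APP_adj_def APP_def o_def
    by (rule the_equality[where P = "\<lambda>h. h \<in> Hsp P \<and> (\<forall>f\<in>Hsp P. ip P f h = gip d P f e)"])
      (blast intro: uniq)
qed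

text \<open>
  The defining property of \<open>W = APP\<^sup>* \<circ> APP\<close>, that is \<open>\<langle>f, W e\<rangle>\<^sub>H = \<langle>f, e\<rangle>\<^sub>G\<close>.
\<close>

lemma W_adjoint:
  assumes e: "e \<in> Hsp P" and f: "f \<in> Hsp P"
  shows "ip P f (W d P e) = gip d P f e"
proof -
  note G = H_subset_G
  obtain h where h: "h \<in> Hsp P" "\<And>f. f \<in> Hsp P \<Longrightarrow> ip P f h = gip d P f e"
  proof (rule Riesz[of "\<lambda>f. gip d P f e" "embedding_bound * gnorm d P e"])
    show "\<bar>gip d P f e\<bar> \<le> embedding_bound * gnorm d P e * hnorm P f" if "f \<in> Hsp P" for f
    proof -
      have "\<bar>gip d P f e\<bar> \<le> gnorm d P f * gnorm d P e"
        using that e by (intro G.Cauchy_Schwarz G)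
      also have "\<dots> \<le> (embedding_bound * hnorm P f) * gnorm d P e"
        using that e by (intro mult_right_mono embedding_bound G.nrm_nonneg G)
      finally show ?thesis by (simp add: mult_ac)
    qed
  qed (use e G in \<open>auto simp: G.linear_simps\<close>)
  then show ?thesis using W_eqI[OF h] f by simp
qed

end

section \<open>Spectral structure of W under finite-rank approximability\<close>

lemma simultaneous_convergent_subsequence:
  fixes X :: "nat \<Rightarrow> nat \<Rightarrow> real"
  assumes "\<And>i n. i < m \<Longrightarrow> \<bar>X i n\<bar> \<le> B i"
  shows "\<exists>r. strict_mono r \<and> (\<forall>i<m. convergent (\<lambda>n. X i (r n)))"
  using assms
proof (induction m)
  case 0
  show ?case by (auto intro!: exI[of _ id] simp: strict_mono_def)
next
  case (Suc m)
  then obtain r where r: "strict_mono r" "\<And>i. i < m \<Longrightarrow> convergent (\<lambda>n. X i (r n))"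
    by (metis less_Suc_eq)
  have "bounded (range (\<lambda>n. X m (r n)))"
    using Suc.prems[of m] by (intro boundedI[of _ "B m"]) auto
  from bounded_imp_convergent_subsequence[OF this]
  obtain a r' where r': "strict_mono r'" "((\<lambda>n. X m (r n)) \<circ> r') \<longlonglongrightarrow> a" by blast
  have "convergent (\<lambda>n. X i (r (r' n)))" if "i < Suc m" for i
  proof (cases "i = m")
    case True
    then show ?thesis using r'(2) by (auto simp: convergent_def o_def)
  next
    case False
    with that have "convergent (\<lambda>n. X i (r n))" using r by simp
    then show ?thesis using convergent_subseq_convergent[OF _ r'(1)] by (force simp: o_def)
  qed
  then show ?case
    using strict_mono_compose[OF r(1) r'(1)] by (intro exI[of _ "\<lambda>n. r (r' n)"]) auto
qed

context embedded_rkhs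
begin

lemma Lambda_allD:
  assumes "L \<in> Lambda_all P"
  shows "f \<in> Hsp P \<Longrightarrow> g \<in> Hsp P \<Longrightarrow> L (\<lambda>x. f x + g x) = L f + L g"
    and "f \<in> Hsp P \<Longrightarrow> L (\<lambda>x. c * f x) = c * L f"
    and "\<exists>C. \<forall>f\<in>Hsp P. \<bar>L f\<bar> \<le> C * hnorm P f"
  using assms by (auto simp: Lambda_all_def)

lemma Lambda_all_diff:
  assumes "L \<in> Lambda_all P" "f \<in> Hsp P" "g \<in> Hsp P"
  shows "L (\<lambda>x. f x - g x) = L f - L g"
  using Lambda_allD(1)[OF assms(1,2) H.scale_in[OF assms(3), of "-1"]]
    Lambda_allD(2)[OF assms(1,3), of "-1"] by simp

text \<open>
  An algorithm in the unit-ball formulation is homogeneous in \<open>f\<close>, so its error bound is stated for all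
  of \<open>H\<close>. Having such approximations for every \<open>\<delta> > 0\<close> is compactness of the embedding.
\<close>

definition finite_rank_approx :: "real \<Rightarrow> nat \<Rightarrow> (nat \<Rightarrow> fn \<Rightarrow> real) \<Rightarrow> (nat \<Rightarrow> fn) \<Rightarrow> bool" where
  "finite_rank_approx \<delta> m L g \<longleftrightarrow> (\<forall>i<m. L i \<in> Lambda_all P \<and> g i \<in> Gsp d P) \<and>
     (\<forall>f\<in>Hsp P. gnorm d P (\<lambda>x. f x - (\<Sum>i<m. L i f * g i x)) \<le> \<delta> * hnorm P f)"

end

text \<open>
  An eigenvalue list together with a system \<open>e\<close> of eigenvectors witnessing it, so that the vectors can be
  named.
\<close>

locale eigen_rkhs = embedded_rkhs +
  fixes l :: "nat \<Rightarrow> real" and e :: "nat \<Rightarrow> fn"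
  assumes l_nonneg: "0 \<le> l j"
    and e_eigen: "0 < l j \<Longrightarrow> e j \<in> Hsp P \<and> W d P (e j) = (\<lambda>x. l j * e j x)"
    and e_ortho: "0 < l i \<Longrightarrow> 0 < l j \<Longrightarrow> ip P (e i) (e j) = (if i = j then 1 else 0)"
    and e_complete: "0 < \<mu> \<Longrightarrow> f \<in> Hsp P \<Longrightarrow> W d P f = (\<lambda>x. \<mu> * f x) \<Longrightarrow>
          (\<And>j. l j = \<mu> \<Longrightarrow> ip P f (e j) = 0) \<Longrightarrow> f = (\<lambda>x. 0)"
begin

text \<open>
  The entries of \<open>e\<close> for the eigenvalue \<open>0\<close> are arbitrary. With \<open>0\<close> in their place, orthogonality, the
  eigenvector equation and \<open>\<parallel>e\<^sub>j\<parallel>\<^sub>G\<^sup>2 = l\<^sub>j\<close> hold for all indices.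
\<close>

definition eigvec :: "nat \<Rightarrow> fn" where
  "eigvec j = (if 0 < l j then e j else (\<lambda>x. 0))"

lemma eigvec_in [simp]: "eigvec j \<in> Hsp P"
  using e_eigen by (simp add: eigvec_def)

lemma eigvec_ip: "ip P (eigvec i) (eigvec j) = (if i = j \<and> 0 < l i then 1 else 0)"
  using e_ortho[of i j] e_eigen[of i] e_eigen[of j] by (auto simp: eigvec_def)

lemma ortho_eigvec: "H.orthonormal_or_zero n eigvec"
  unfolding H.orthonormal_or_zero_def by (auto simp: eigvec_ip) (auto simp: eigvec_def)

lemma gip_eigvec: "f \<in> Hsp P \<Longrightarrow> gip d P f (eigvec j) = l j * ip P f (eigvec j)"
  using W_adjoint[of "e j" f] e_eigen[of j] H.scale_right[of "e j" f "l j"] H_subset_G[of f]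
  by (auto simp: eigvec_def)

lemma gip_eigvec_self: "gip d P (eigvec j) (eigvec j) = l j"
  using l_nonneg[of j] by (auto simp: gip_eigvec eigvec_ip)

definition fourier :: "fn \<Rightarrow> nat \<Rightarrow> fn" where
  "fourier f n = (\<lambda>x. \<Sum>j<n. ip P f (eigvec j) * eigvec j x)"

lemma fourier_in [simp]: "fourier f n \<in> Hsp P"
  unfolding fourier_def by simp

lemma Bessel:
  assumes "f \<in> Hsp P" shows "(\<Sum>j<n. (ip P f (eigvec j))\<^sup>2) \<le> (hnorm P f)\<^sup>2"
proof -
  have "0 \<le> (hnorm P (\<lambda>x. f x - (\<Sum>i<n. ip P f (eigvec i) * eigvec i x)))\<^sup>2" by simp
  also have "\<dots> = ip P f f - (\<Sum>j<n. (ip P f (eigvec j))\<^sup>2)"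
    by (rule H.ortho_residual[OF ortho_eigvec assms])
  finally show ?thesis using assms by (simp add: H.nrm_sq)
qed

lemma fourier_Cauchy:
  assumes f: "f \<in> Hsp P" and e: "0 < \<epsilon>"
  shows "\<exists>N. \<forall>m\<ge>N. \<forall>n\<ge>N. hnorm P (\<lambda>x. fourier f m x - fourier f n x) < \<epsilon>"
proof -
  let ?Q = "\<lambda>n. \<Sum>j<n. (ip P f (eigvec j))\<^sup>2"
  have step: "(hnorm P (\<lambda>x. fourier f m x - fourier f n x))\<^sup>2 \<le> ?Q m - ?Q n" if "n \<le> m" for m n
  proof -
    let ?a = "\<lambda>i. if n \<le> i then ip P f (eigvec i) else 0"
    have split: "(\<Sum>i<m. F i) = (\<Sum>i<n. F i) + (\<Sum>i<m. if n \<le> i then F i else 0)" for F :: "nat \<Rightarrow> real"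
    proof -
      have "(\<Sum>i<m. if n \<le> i then F i else 0) = (\<Sum>i\<in>{n..<m}. F i)"
        by (subst sum.inter_filter[symmetric]) (auto intro: sum.cong)
      then show ?thesis
        using sum.atLeastLessThan_concat[of 0 n m F] that by (simp add: atLeast0LessThan)
    qed
    have "(\<lambda>x. fourier f m x - fourier f n x) = (\<lambda>x. \<Sum>i<m. ?a i * eigvec i x)"
      unfolding fourier_def
      by (subst split) (auto intro!: sum.cong simp: fun_eq_iff)
    then have "(hnorm P (\<lambda>x. fourier f m x - fourier f n x))\<^sup>2 \<le> (\<Sum>i<m. (?a i)\<^sup>2)"
      using H.ortho_sum_sq[OF ortho_eigvec] by simp
    also have "\<dots> = ?Q m - ?Q n"
      by (subst split[of "\<lambda>i. (ip P f (eigvec i))\<^sup>2"]) (auto intro!: sum.cong)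
    finally show ?thesis .
  qed
  have "summable (\<lambda>j. (ip P f (eigvec j))\<^sup>2)"
    by (rule summableI_nonneg_bounded[of _ "(hnorm P f)\<^sup>2"]) (use Bessel[OF f] in auto)
  then have "Cauchy ?Q" by (simp add: summable_iff_convergent convergent_Cauchy)
  then obtain N where N: "\<And>m n. m \<ge> N \<Longrightarrow> n \<ge> N \<Longrightarrow> dist (?Q m) (?Q n) < \<epsilon>\<^sup>2"
    using e unfolding Cauchy_def by (meson zero_less_power)
  have main: "hnorm P (\<lambda>x. fourier f m x - fourier f n x) < \<epsilon>" if "m \<ge> N" "n \<ge> N" "n \<le> m" for m n
  proof -
    have "(hnorm P (\<lambda>x. fourier f m x - fourier f n x))\<^sup>2 < \<epsilon>\<^sup>2"
      using step[OF that(3)] N[OF that(1,2)] by (simp add: dist_real_def)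
    then show ?thesis using e by (simp add: power_less_imp_less_base)
  qed
  have "hnorm P (\<lambda>x. fourier f m x - fourier f n x) < \<epsilon>" if "m \<ge> N" "n \<ge> N" for m n
    using main[OF that] main[OF that(2,1)] H.nrm_minus_commute[OF fourier_in fourier_in, of f m f n]
    by (cases "n \<le> m") auto
  then show ?thesis by blast
qed

definition perp :: "fn set" where
  "perp = {f \<in> Hsp P. \<forall>j. ip P f (eigvec j) = 0}"

lemma perp_in: "f \<in> perp \<Longrightarrow> f \<in> Hsp P"
  and perp_ip: "f \<in> perp \<Longrightarrow> ip P f (eigvec j) = 0"
  by (auto simp: perp_def)

text \<open>
  Orthogonal projection onto the closed span of the eigenvectors, obtained as the limit of the Fourier
  sums. Convergence in norm is what later allows point evaluations and integrals to be computed term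
  by term, as both are continuous on \<open>H\<close>.
\<close>

lemma fourier_decomposition:
  assumes f: "f \<in> Hsp P"
  shows "\<exists>p\<in>Hsp P. (\<lambda>n. hnorm P (\<lambda>x. fourier f n x - p x)) \<longlonglongrightarrow> 0 \<and>
    (\<lambda>x. f x - p x) \<in> perp \<and> (\<forall>g\<in>perp. ip P p g = 0)"
proof -
  obtain p where p: "p \<in> Hsp P" and lim: "(\<lambda>n. hnorm P (\<lambda>x. fourier f n x - p x)) \<longlonglongrightarrow> 0"
    using H_complete[of "fourier f", OF fourier_in fourier_Cauchy[OF f]] by blast
  show ?thesis
  proof (intro bexI[OF _ p] conjI lim ballI)
    have "ip P p (eigvec j) = ip P f (eigvec j)" for j
    proof (rule LIMSEQ_unique)
      show "(\<lambda>n. ip P (fourier f n) (eigvec j)) \<longlonglongrightarrow> ip P p (eigvec j)"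
        by (rule H.left_tendsto[OF fourier_in p eigvec_in lim])
      have "ip P (fourier f n) (eigvec j) = ip P f (eigvec j)" if "n \<ge> Suc j" for n
        using H.ortho_coeff[OF ortho_eigvec _ f, of j n] that f
        by (simp add: H.diff_left flip: fourier_def)
      then show "(\<lambda>n. ip P (fourier f n) (eigvec j)) \<longlonglongrightarrow> ip P f (eigvec j)"
        by (intro tendsto_eventually eventually_sequentiallyI) auto
    qed
    then show "(\<lambda>x. f x - p x) \<in> perp" using f p by (simp add: perp_def H.diff_left)
  next
    fix g assume g: "g \<in> perp"
    have "ip P (fourier f n) g = 0" for n
      unfolding fourier_def using perp_in[OF g] perp_ip[OF g] H.sym[OF eigvec_in perp_in[OF g]]
      by (simp add: H.linear_simps)
    moreover have "(\<lambda>n. ip P (fourier f n) g) \<longlonglongrightarrow> ip P p g"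
      by (rule H.left_tendsto[OF fourier_in p perp_in[OF g] lim])
    ultimately show "ip P p g = 0" by (simp add: LIMSEQ_const_iff)
  qed
qed

text \<open>
  If \<open>s\<close> bounds the Rayleigh quotient \<open>\<parallel>f\<parallel>\<^sub>G\<^sup>2 / \<parallel>f\<parallel>\<^sub>H\<^sup>2\<close> on the complement, the defect form is positive
  semidefinite there, and the Cauchy-Schwarz inequality applies to it.
\<close>

lemma perp_semi_inner:
  assumes "\<And>f. f \<in> perp \<Longrightarrow> gip d P f f \<le> s * ip P f f"
  shows "semi_inner_space perp (\<lambda>f g. s * ip P f g - gip d P f g)"
proof
  fix f g h :: fn and c :: real
  show "(\<lambda>x. 0) \<in> perp" by (simp add: perp_def)
  assume f: "f \<in> perp"
  note f' = perp_in[OF f] H_subset_G[OF perp_in[OF f]]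
  show "(\<lambda>x. c * f x) \<in> perp" using f by (simp add: perp_def H.linear_simps)
  show "0 \<le> s * ip P f f - gip d P f f" using assms[OF f] by simp
  { assume h: "h \<in> perp"
    note h' = perp_in[OF h] H_subset_G[OF perp_in[OF h]]
    show "s * ip P (\<lambda>x. c * f x) h - gip d P (\<lambda>x. c * f x) h = c * (s * ip P f h - gip d P f h)"
      using f' h' by (simp add: H.scale_left G.scale_left algebra_simps) }
  assume g: "g \<in> perp"
  note g' = perp_in[OF g] H_subset_G[OF perp_in[OF g]]
  show "(\<lambda>x. f x + g x) \<in> perp" using f g by (simp add: perp_def H.linear_simps)
  show "s * ip P f g - gip d P f g = s * ip P g f - gip d P g f"
    using H.sym[OF f'(1) g'(1)] G.sym[OF f'(2) g'(2)] by simp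
  assume h: "h \<in> perp"
  note h' = perp_in[OF h] H_subset_G[OF perp_in[OF h]]
  show "s * ip P (\<lambda>x. f x + g x) h - gip d P (\<lambda>x. f x + g x) h =
      s * ip P f h - gip d P f h + (s * ip P g h - gip d P g h)"
    using f' g' h' by (simp add: H.add_left G.add_left algebra_simps)
qed

text \<open>
  A null vector of the defect form satisfies \<open>\<langle>f, g\<rangle>\<^sub>G = s \<langle>f, g\<rangle>\<^sub>H\<close> for \<open>g\<close> in the complement; for \<open>g\<close> in the
  span of the eigenvectors both sides are \<open>0\<close>. Were it
  nonzero, it would be an eigenvector for \<open>s\<close> orthogonal to all listed ones, against completeness of the
  list.
\<close>

lemma perp_no_maximiser:
  assumes f: "f \<in> perp" and s: "0 < s" and B: "\<And>g. g \<in> perp \<Longrightarrow> s * ip P f g - gip d P f g = 0"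
  shows "f = (\<lambda>x. 0)"
proof (rule e_complete[OF s])
  show fH: "f \<in> Hsp P" using f by (rule perp_in)
  show "ip P f (e j) = 0" if "l j = s" for j
    using perp_ip[OF f, of j] that s by (simp add: eigvec_def)
  show "W d P f = (\<lambda>x. s * f x)"
  proof (rule W_eqI)
    show "(\<lambda>x. s * f x) \<in> Hsp P" using fH by simp
    fix g assume g: "g \<in> Hsp P"
    obtain p where p: "p \<in> Hsp P" and lim: "(\<lambda>n. hnorm P (\<lambda>x. fourier g n x - p x)) \<longlonglongrightarrow> 0"
      and q: "(\<lambda>x. g x - p x) \<in> perp" and pp: "\<And>g. g \<in> perp \<Longrightarrow> ip P p g = 0"
      using fourier_decomposition[OF g] by blast
    have glim: "(\<lambda>n. gnorm d P (\<lambda>x. fourier g n x - p x)) \<longlonglongrightarrow> 0"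
      by (rule gnorm_tendsto_zero[OF H.diff_in[OF fourier_in p] lim])
    have "gip d P (fourier g n) f = 0" for n
      unfolding fourier_def using H_subset_G fH gip_eigvec[OF fH] perp_ip[OF f] G.sym[of f "eigvec _"]
      by (simp add: G.linear_simps)
    moreover have "(\<lambda>n. gip d P (fourier g n) f) \<longlonglongrightarrow> gip d P p f"
      using H_subset_G fH p by (intro G.left_tendsto glim) auto
    ultimately have gp: "gip d P p f = 0" by (simp add: LIMSEQ_const_iff)
    have "s * ip P f (\<lambda>x. g x - p x) - gip d P f (\<lambda>x. g x - p x) = 0"
      by (rule B[OF q])
    then have "s * ip P g f = gip d P g f"
      using gp pp[OF f] fH p g H_subset_G H.sym[OF fH g] H.sym[OF fH p] G.sym[of f g] G.sym[of f p]
      by (simp add: H.diff_right G.diff_right)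
    then show "ip P g (\<lambda>x. s * f x) = gip d P g f"
      using fH g by (simp add: H.scale_right)
  qed
qed

text \<open>
  Let \<open>s\<close> be the supremum of the Rayleigh quotient on the complement. If \<open>s > 0\<close>, a single finite-rank
  operator of error \<open>sqrt s / 2\<close> makes a maximising sequence \<open>F\<close> converge: along a subsequence its finitely
  many functionals converge, so that \<open>\<parallel>F p - F q\<parallel>\<^sub>G\<close> is essentially at most \<open>sqrt s / 2\<close> times \<open>\<parallel>F p - F q\<parallel>\<^sub>H\<close>,
  whereas near-maximality makes the defect form of \<open>F p - F q\<close> small, so that \<open>\<parallel>F p - F q\<parallel>\<^sub>G\<close> is nearly
  \<open>sqrt s\<close> times \<open>\<parallel>F p - F q\<parallel>\<^sub>H\<close>. Both are possible only if \<open>F\<close> is Cauchy, and its limit is a maximiser.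
\<close>

lemma perp_gnorm_zero:
  assumes fr: "\<forall>\<delta>>0. \<exists>m L g. finite_rank_approx \<delta> m L g"
    and q: "q \<in> perp"
  shows "gnorm d P q = 0"
proof (rule ccontr)
  assume qne: "gnorm d P q \<noteq> 0"
  define K where "K = {f \<in> perp. hnorm P f = 1}"
  define s where "s = (SUP f\<in>K. gip d P f f)"
  have normalise: "\<exists>c. (\<lambda>x. c * f x) \<in> K \<and> gip d P (\<lambda>x. c * f x) (\<lambda>x. c * f x) * ip P f f = gip d P f f"
    if f: "f \<in> perp" and ne: "f \<noteq> (\<lambda>x. 0)" for f
  proof -
    note fH = perp_in[OF f]
    have n0: "hnorm P f > 0" using hnorm_definite[OF fH] ne H.nrm_nonneg[OF fH] by linarith
    define c where "c = 1 / hnorm P f"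
    have c: "c * hnorm P f = 1" "0 \<le> c" using n0 by (simp_all add: c_def)
    have "(\<lambda>x. c * f x) \<in> perp"
      using f by (simp add: perp_def H.scale_left)
    moreover have "hnorm P (\<lambda>x. c * f x) = 1"
      using H.nrm_scale[OF fH, of c] c by simp
    moreover have "gip d P (\<lambda>x. c * f x) (\<lambda>x. c * f x) * ip P f f = gip d P f f * (c * hnorm P f)\<^sup>2"
      using fH H_subset_G[OF fH]
      by (simp add: G.linear_simps power_mult_distrib H.nrm_sq power2_eq_square[of c])
    ultimately show ?thesis using c(1) by (intro exI[of _ c]) (simp add: K_def)
  qed
  have bdd: "bdd_above ((\<lambda>f. gip d P f f) ` K)"
  proof (rule bdd_aboveI2)
    fix f assume "f \<in> K"
    then have f: "f \<in> Hsp P" "hnorm P f = 1" by (auto simp: K_def perp_def)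
    have "(gnorm d P f)\<^sup>2 \<le> embedding_bound\<^sup>2"
      using embedding_bound(2)[OF f(1)] f G.nrm_nonneg[OF H_subset_G[OF f(1)]] by (intro power_mono) auto
    then show "gip d P f f \<le> embedding_bound\<^sup>2" using H_subset_G[OF f(1)] by (simp add: G.nrm_sq)
  qed
  have sK: "gip d P f f \<le> s" if "f \<in> K" for f
    unfolding s_def by (rule cSUP_upper[OF that bdd])
  have sperp: "gip d P f f \<le> s * ip P f f" if f: "f \<in> perp" for f
  proof (cases "f = (\<lambda>x. 0)")
    case False
    from normalise[OF f False] obtain c where c: "(\<lambda>x. c * f x) \<in> K"
      "gip d P (\<lambda>x. c * f x) (\<lambda>x. c * f x) * ip P f f = gip d P f f" by blast
    show ?thesis unfolding c(2)[symmetric]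
      using sK[OF c(1)] H.nonneg[OF perp_in[OF f]] by (intro mult_right_mono)
  qed simp
  have qG: "q \<in> Gsp d P" using q by (intro H_subset_G perp_in)
  have qn0: "q \<noteq> (\<lambda>x. 0)" using qne by auto
  from normalise[OF q qn0] have Kne: "K \<noteq> {}" by blast
  have spos: "0 < s"
  proof -
    have "gip d P q q \<noteq> 0" using qne by (simp flip: G.nrm_sq[OF qG])
    then have "0 < gip d P q q" using G.nonneg[OF qG] by linarith
    also have "\<dots> \<le> s * ip P q q" by (rule sperp[OF q])
    finally show ?thesis
      using H.nonneg[OF perp_in[OF q]] by (simp add: zero_less_mult_iff)
  qed
  define B where "B f g = s * ip P f g - gip d P f g" for f g
  interpret B: semi_inner_space perp B
    unfolding B_def by (rule perp_semi_inner[OF sperp])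
  have "\<exists>f\<in>K. s - inverse (real (Suc n)) < gip d P f f" for n
    using less_cSUP_iff[OF Kne bdd, of "s - inverse (real (Suc n))"] by (simp add: s_def)
  then obtain F0 where F0: "\<And>n. F0 n \<in> K" and F0s: "\<And>n. s - inverse (real (Suc n)) < gip d P (F0 n) (F0 n)"
    by metis
  have ip1: "ip P f f = 1" if "f \<in> K" for f
    using that H.nrm_sq[of f] by (simp add: K_def perp_def)
  \<comment> \<open>Any value below \<open>sqrt s / sqrt 2\<close> would do: \<open>2 \<delta>\<^sup>2 < s\<close> is what the estimate of \<open>close\<close> absorbs.\<close>
  define \<delta> where "\<delta> = sqrt s / 2"
  have \<delta>: "0 < \<delta>" "\<delta>\<^sup>2 = s / 4" using spos by (auto simp: \<delta>_def power_divide)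
  obtain m L g where fra: "finite_rank_approx \<delta> m L g" using fr \<delta>(1) by blast
  then have L: "\<And>i. i < m \<Longrightarrow> L i \<in> Lambda_all P" and g: "\<And>i. i < m \<Longrightarrow> g i \<in> Gsp d P"
    and err: "\<And>f. f \<in> Hsp P \<Longrightarrow> gnorm d P (\<lambda>x. f x - (\<Sum>i<m. L i f * g i x)) \<le> \<delta> * hnorm P f"
    by (auto simp: finite_rank_approx_def)
  have KH: "f \<in> Hsp P" "f \<in> perp" "hnorm P f = 1" if "f \<in> K" for f
    using that by (auto simp: K_def perp_def)
  have "\<exists>r. strict_mono r \<and> (\<forall>i<m. convergent (\<lambda>n. L i (F0 (r n))))"
  proof -
    have "\<forall>i. \<exists>C. i < m \<longrightarrow> (\<forall>n. \<bar>L i (F0 n)\<bar> \<le> C)"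
    proof (intro allI)
      fix i
      show "\<exists>C. i < m \<longrightarrow> (\<forall>n. \<bar>L i (F0 n)\<bar> \<le> C)"
      proof (cases "i < m")
        case True
        obtain C where C: "\<And>f. f \<in> Hsp P \<Longrightarrow> \<bar>L i f\<bar> \<le> C * hnorm P f"
          using Lambda_allD(3)[OF L[OF True]] by blast
        have "\<bar>L i (F0 n)\<bar> \<le> C" for n using C[OF KH(1)[OF F0], of n] KH(3)[OF F0, of n] by simp
        then show ?thesis by blast
      qed simp
    qed
    then obtain C where "\<And>i n. i < m \<Longrightarrow> \<bar>L i (F0 n)\<bar> \<le> C i" by metis
    then show ?thesis by (rule simultaneous_convergent_subsequence)
  qed
  then obtain r where r: "strict_mono r" and conv: "\<And>i. i < m \<Longrightarrow> convergent (\<lambda>n. L i (F0 (r n)))"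
    by blast
  define F where "F n = F0 (r n)" for n
  have FK: "F n \<in> K" for n using F0 by (simp add: F_def)
  note FH = KH(1)[OF FK] and Fp = KH(2)[OF FK]
  have BF: "B (F n) (F n) \<le> inverse (real (Suc n))" for n
  proof -
    have le: "inverse (real (Suc (r n))) \<le> inverse (real (Suc n))"
      using seq_suble[OF r, of n] by (intro le_imp_inverse_le) auto
    have "B (F n) (F n) = s - gip d P (F0 (r n)) (F0 (r n))"
      using ip1[OF FK[of n]] by (simp add: B_def F_def)
    then show ?thesis using F0s[of "r n"] le by argo
  qed
  define a where "a i = lim (\<lambda>n. L i (F n))" for i
  have a: "(\<lambda>n. L i (F n)) \<longlonglongrightarrow> a i" if "i < m" for i
    using conv[OF that] by (simp add: a_def F_def convergent_LIMSEQ_iff)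
  define \<tau> where "\<tau> n = (\<Sum>i<m. \<bar>L i (F n) - a i\<bar> * gnorm d P (g i))" for n
  have \<tau>: "\<tau> \<longlonglongrightarrow> 0"
    unfolding \<tau>_def
  proof (rule tendsto_null_sum)
    fix i assume "i \<in> {..<m}"
    then have "(\<lambda>n. L i (F n) - a i) \<longlonglongrightarrow> 0" using a[of i] by (simp add: LIM_zero)
    then show "(\<lambda>n. \<bar>L i (F n) - a i\<bar> * gnorm d P (g i)) \<longlonglongrightarrow> 0"
      by (intro tendsto_mult_left_zero tendsto_rabs_zero)
  qed
  define \<rho> where "\<rho> n = 2 * inverse (real (Suc n)) + 4 * (\<tau> n)\<^sup>2" for n
  have \<rho>: "\<rho> \<longlonglongrightarrow> 0"
  proof -
    have "(\<lambda>n. 2 * inverse (real (Suc n)) + 4 * (\<tau> n)\<^sup>2) \<longlonglongrightarrow> 2 * 0 + 4 * 0\<^sup>2"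
      using \<tau> LIMSEQ_inverse_real_of_nat by (intro tendsto_add tendsto_mult tendsto_const tendsto_power)
    then show ?thesis by (simp add: \<rho>_def [abs_def])
  qed
  \<comment> \<open>\<open>\<rho> n\<close> adds how far \<open>F n\<close> is from maximising and how far its information is from the limit \<open>a\<close>.\<close>
  have close: "s / 2 * (hnorm P (\<lambda>x. F p x - F q x))\<^sup>2 \<le> \<rho> p + \<rho> q" for p q
  proof -
    define h where "h = (\<lambda>x. F p x - F q x)"
    have hp: "h \<in> perp" unfolding h_def by (intro B.diff_in Fp)
    note hH = perp_in[OF hp] note hG = H_subset_G[OF hH]
    have gV: "(\<lambda>x. \<Sum>i<m. L i h * g i x) \<in> Gsp d P" using g by simp
    have "gnorm d P h \<le> gnorm d P (\<lambda>x. h x - (\<Sum>i<m. L i h * g i x)) + gnorm d P (\<lambda>x. \<Sum>i<m. L i h * g i x)"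
      using G.nrm_add[OF G.diff_in[OF hG gV] gV] by simp
    also have "gnorm d P (\<lambda>x. \<Sum>i<m. L i h * g i x) \<le> (\<Sum>i<m. gnorm d P (\<lambda>x. L i h * g i x))"
      using g by (intro G.nrm_sum) auto
    also have "\<dots> = (\<Sum>i<m. \<bar>L i h\<bar> * gnorm d P (g i))"
      using g by (intro sum.cong) (auto simp: G.nrm_scale)
    also have "\<dots> \<le> (\<Sum>i<m. \<bar>L i (F p) - a i\<bar> * gnorm d P (g i) + \<bar>L i (F q) - a i\<bar> * gnorm d P (g i))"
    proof (rule sum_mono)
      fix i assume i: "i \<in> {..<m}"
      have "L i h = L i (F p) - L i (F q)"
        unfolding h_def using i by (intro Lambda_all_diff L FH) auto
      then have "\<bar>L i h\<bar> \<le> \<bar>L i (F p) - a i\<bar> + \<bar>L i (F q) - a i\<bar>" by linarith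
      then show "\<bar>L i h\<bar> * gnorm d P (g i) \<le>
          \<bar>L i (F p) - a i\<bar> * gnorm d P (g i) + \<bar>L i (F q) - a i\<bar> * gnorm d P (g i)"
        using g i by (simp flip: distrib_right add: mult_right_mono)
    qed
    also have "\<dots> = \<tau> p + \<tau> q" by (simp add: \<tau>_def sum.distrib)
    finally have "gnorm d P h \<le> \<delta> * hnorm P h + (\<tau> p + \<tau> q)" using err[OF hH] by linarith
    then have "(gnorm d P h)\<^sup>2 \<le> (\<delta> * hnorm P h + (\<tau> p + \<tau> q))\<^sup>2"
      using hG by (intro power_mono) auto
    also have "\<dots> \<le> 2 * (\<delta> * hnorm P h)\<^sup>2 + 2 * (\<tau> p + \<tau> q)\<^sup>2"
      using sum_squares_bound[of "\<delta> * hnorm P h" "\<tau> p + \<tau> q"] by (simp add: power2_sum)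
    also have "(\<tau> p + \<tau> q)\<^sup>2 \<le> 2 * (\<tau> p)\<^sup>2 + 2 * (\<tau> q)\<^sup>2"
      using sum_squares_bound[of "\<tau> p" "\<tau> q"] by (simp add: power2_sum)
    finally have 1: "gip d P h h \<le> s / 2 * (hnorm P h)\<^sup>2 + 4 * (\<tau> p)\<^sup>2 + 4 * (\<tau> q)\<^sup>2"
      using hG by (simp add: G.nrm_sq power_mult_distrib \<delta>)
    have "0 \<le> B (\<lambda>x. F p x + F q x) (\<lambda>x. F p x + F q x)" by (intro B.nonneg B.add_in Fp)
    then have "B h h \<le> 2 * B (F p) (F p) + 2 * B (F q) (F q)"
      unfolding h_def using B.diff_self[OF Fp Fp, of p q] B.add_self[OF Fp Fp, of p q] by linarith
    then have 2: "B h h \<le> 2 * inverse (real (Suc p)) + 2 * inverse (real (Suc q))"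
      using BF[of p] BF[of q] by linarith
    have "s * (hnorm P h)\<^sup>2 = B h h + gip d P h h" using hH by (simp add: B_def H.nrm_sq)
    with 1 2 show ?thesis unfolding h_def[symmetric] \<rho>_def by linarith
  qed
  have "\<exists>N. \<forall>m\<ge>N. \<forall>n\<ge>N. hnorm P (\<lambda>x. F m x - F n x) < \<epsilon>" if "0 < \<epsilon>" for \<epsilon>
  proof -
    have "0 < s / 4 * \<epsilon>\<^sup>2" using spos that by simp
    then have "\<forall>\<^sub>F n in sequentially. \<rho> n < s / 4 * \<epsilon>\<^sup>2"
      using \<rho> by (rule order_tendstoD(2)[rotated])
    then obtain N where N: "\<And>n. n \<ge> N \<Longrightarrow> \<rho> n < s / 4 * \<epsilon>\<^sup>2"
      by (auto simp: eventually_sequentially)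
    have "hnorm P (\<lambda>x. F m x - F n x) < \<epsilon>" if "m \<ge> N" "n \<ge> N" for m n
    proof -
      have "s / 2 * (hnorm P (\<lambda>x. F m x - F n x))\<^sup>2 < s / 2 * \<epsilon>\<^sup>2"
        using close[of m n] N[OF that(1)] N[OF that(2)] by simp
      then have "(hnorm P (\<lambda>x. F m x - F n x))\<^sup>2 < \<epsilon>\<^sup>2" using spos by simp
      then show ?thesis using \<open>0 < \<epsilon>\<close> by (simp add: power_less_imp_less_base)
    qed
    then show ?thesis by blast
  qed
  then obtain f where fH: "f \<in> Hsp P" and lim: "(\<lambda>n. hnorm P (\<lambda>x. F n x - f x)) \<longlonglongrightarrow> 0"
    using H_complete[of F, OF FH] by blast
  have "ip P f (eigvec j) = 0" for j
    using H.left_tendsto[OF FH fH eigvec_in lim, of j] perp_ip[OF Fp] by (simp add: LIMSEQ_const_iff)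
  then have fp: "f \<in> perp" using fH by (simp add: perp_def)
  have "hnorm P f = 1"
    using H.nrm_tendsto[OF FH fH lim] KH(3)[OF FK] by (simp add: LIMSEQ_const_iff)
  then have fne: "f \<noteq> (\<lambda>x. 0)" by auto
  have Ble: "B.nrm h \<le> sqrt s * hnorm P h" if h: "h \<in> perp" for h
  proof -
    have "B h h \<le> s * ip P h h"
      using G.nonneg[OF H_subset_G[OF perp_in[OF h]]] by (simp add: B_def)
    then have "sqrt (B h h) \<le> sqrt (s * ip P h h)" by (rule real_sqrt_le_mono)
    then show ?thesis by (simp add: B.nrm_def real_sqrt_mult hnorm_def)
  qed
  have limB: "(\<lambda>n. B.nrm (\<lambda>x. F n x - f x)) \<longlonglongrightarrow> 0"
  proof (rule Lim_null_comparison)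
    show "\<forall>\<^sub>F n in sequentially. norm (B.nrm (\<lambda>x. F n x - f x)) \<le> sqrt s * hnorm P (\<lambda>x. F n x - f x)"
      using Ble[OF B.diff_in[OF Fp fp]] B.nrm_nonneg[OF B.diff_in[OF Fp fp]]
      by (intro always_eventually allI) simp
    show "(\<lambda>n. sqrt s * hnorm P (\<lambda>x. F n x - f x)) \<longlonglongrightarrow> 0"
      using tendsto_mult_right_zero[OF lim] .
  qed
  have "(\<lambda>n. B.nrm (F n)) \<longlonglongrightarrow> 0"
  proof (rule Lim_null_comparison)
    show "\<forall>\<^sub>F n in sequentially. norm (B.nrm (F n)) \<le> sqrt (inverse (real (Suc n)))"
      using BF Fp by (intro always_eventually allI) (simp add: B.nrm_def)
    show "(\<lambda>n. sqrt (inverse (real (Suc n)))) \<longlonglongrightarrow> 0"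
      using tendsto_real_sqrt[OF LIMSEQ_inverse_real_of_nat] by simp
  qed
  then have "B.nrm f = 0"
    using LIMSEQ_unique[OF B.nrm_tendsto[OF Fp fp limB]] by blast
  then have "B f g = 0" if "g \<in> perp" for g
    using B.Cauchy_Schwarz[OF fp that] by simp
  then have "f = (\<lambda>x. 0)"
    by (intro perp_no_maximiser[OF fp spos]) (simp add: B_def)
  with fne show False by simp
qed

text \<open>
  Each function of the complement vanishes outside a null set depending on it. The projections of a
  countable dense set onto the complement are dense in it, and convergence in \<open>H\<close> implies pointwise
  convergence, so the union of countably many null sets suffices.
\<close>

lemma perp_AE_zero:
  assumes zero: "\<forall>q\<in>perp. gnorm d P q = 0"
  shows "AE x in M. \<forall>q\<in>perp. q x = 0"
proof -
  obtain C where C: "countable C" "C \<subseteq> Hsp P"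
    and dense: "\<And>f e. f \<in> Hsp P \<Longrightarrow> 0 < e \<Longrightarrow> \<exists>c\<in>C. hnorm P (\<lambda>x. f x - c x) < e"
    using H_countable_dense by blast
  have "\<exists>p. p \<in> Hsp P \<and> (\<lambda>x. c x - p x) \<in> perp \<and> (\<forall>g\<in>perp. ip P p g = 0)" if "c \<in> C" for c
  proof -
    have "c \<in> Hsp P" using that C(2) by (rule subsetD[rotated])
    from fourier_decomposition[OF this] show ?thesis by (elim bexE conjE) (intro exI conjI)
  qed
  then have "\<forall>c\<in>C. \<exists>p. p \<in> Hsp P \<and> (\<lambda>x. c x - p x) \<in> perp \<and> (\<forall>g\<in>perp. ip P p g = 0)"
    by (rule ballI)
  then obtain p where p': "\<forall>c\<in>C. p c \<in> Hsp P \<and> (\<lambda>x. c x - p c x) \<in> perp \<and> (\<forall>g\<in>perp. ip P (p c) g = 0)"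
    by (rule bchoice[THEN exE])
  have p: "p c \<in> Hsp P" "(\<lambda>x. c x - p c x) \<in> perp" "\<And>g. g \<in> perp \<Longrightarrow> ip P (p c) g = 0"
    if "c \<in> C" for c
    using bspec[OF p' that] by simp_all
  have AE0: "AE x in M. q x = 0" if q: "q \<in> perp" for q
  proof -
    have qG: "q \<in> Gsp d P" using q by (intro H_subset_G perp_in)
    have "(\<integral>x. (q x)\<^sup>2 \<partial>M) = 0"
      using bspec[OF zero q] G.nrm_sq[OF qG] by (simp add: gip_def power2_eq_square)
    then have "AE x in M. (q x)\<^sup>2 = 0"
      using integral_nonneg_eq_0_iff_AE[OF G_sq_integrable[OF qG]] by simp
    then show ?thesis by simp
  qed
  have "AE x in M. \<forall>c\<in>C. c x - p c x = 0"
    using AE0[OF p(2)] C(1) by (simp add: AE_ball_countable)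
  then show ?thesis
  proof (rule AE_mp, intro AE_I2 impI ballI)
    fix x q assume x: "x \<in> space M" and c0: "\<forall>c\<in>C. c x - p c x = 0" and q: "q \<in> perp"
    note qH = perp_in[OF q]
    obtain K where K: "\<And>f. f \<in> Hsp P \<Longrightarrow> \<bar>f x\<bar> \<le> K * hnorm P f"
      using point_evaluation_bounded[of x] x space_M by blast
    have small: "\<bar>q x\<bar> \<le> \<bar>K\<bar> * \<epsilon>" if \<epsilon>: "0 < \<epsilon>" for \<epsilon>
    proof -
      obtain c where c: "c \<in> C" "hnorm P (\<lambda>x. q x - c x) < \<epsilon>" using dense[OF qH \<epsilon>] by blast
      have cH: "c \<in> Hsp P" using c C by blast
      \<comment> \<open>Projecting \<open>c\<close> onto the complement does not increase its distance from \<open>q\<close>.\<close>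
      define u where "u = (\<lambda>x. q x - (c x - p c x))"
      note qc = p(2)[OF c(1)]
      have uperp: "u \<in> perp"
        using q qc p(1)[OF c(1)] cH by (auto simp: u_def perp_def H.diff_left)
      have "(\<lambda>x. q x - c x) = (\<lambda>x. u x - p c x)" by (auto simp: u_def)
      then have "(hnorm P (\<lambda>x. q x - c x))\<^sup>2 = (hnorm P u)\<^sup>2 + (hnorm P (p c))\<^sup>2"
        using H.diff_self[OF perp_in[OF uperp] p(1)[OF c(1)]] p(3)[OF c(1) uperp]
          H.sym[OF perp_in[OF uperp] p(1)[OF c(1)]] perp_in[OF uperp] p(1)[OF c(1)]
        by (simp add: H.nrm_sq)
      then have "(hnorm P u)\<^sup>2 \<le> (hnorm P (\<lambda>x. q x - c x))\<^sup>2" by simp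
      then have "hnorm P u \<le> hnorm P (\<lambda>x. q x - c x)"
        using H.nrm_nonneg[OF H.diff_in[OF qH cH]] by (rule power2_le_imp_le)
      then have u: "hnorm P u \<le> \<epsilon>" using c(2) by simp
      have "q x = u x" using c0 c(1) by (simp add: u_def)
      then have "\<bar>q x\<bar> \<le> K * hnorm P u" using K[OF perp_in[OF uperp]] by simp
      also have "\<dots> \<le> \<bar>K\<bar> * \<epsilon>"
        using u H.nrm_nonneg[OF perp_in[OF uperp]] by (intro mult_mono) auto
      finally show ?thesis .
    qed
    show "q x = 0"
    proof (rule ccontr)
      assume "q x \<noteq> 0"
      then have "\<bar>q x\<bar> \<le> \<bar>K\<bar> * (\<bar>q x\<bar> / (\<bar>K\<bar> + 1))" using small[of "\<bar>q x\<bar> / (\<bar>K\<bar> + 1)"] by simp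
      also have "\<dots> < \<bar>q x\<bar>" using \<open>q x \<noteq> 0\<close> by (simp add: field_simps)
      finally show False by simp
    qed
  qed
qed

end

section \<open>Greedy choice of sample points\<close>

lemma exists_le_mean:
  fixes \<phi> :: "'a \<Rightarrow> ennreal"
  assumes prob: "emeasure N (space N) = 1" and meas: "\<phi> \<in> borel_measurable N"
    and le: "(\<integral>\<^sup>+x. \<phi> x \<partial>N) \<le> c" and fin: "c < \<infinity>" and Q: "AE x in N. Q x"
  shows "\<exists>x\<in>space N. Q x \<and> \<phi> x \<le> c"
proof (rule ccontr)
  assume "\<not> ?thesis"
  then have gt: "AE x in N. c < \<phi> x" using Q by (auto simp: not_le elim!: AE_mp)
  have "(\<integral>\<^sup>+x. c \<partial>N) < (\<integral>\<^sup>+x. \<phi> x \<partial>N)"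
  proof (rule nn_integral_less)
    show "(\<integral>\<^sup>+x. c \<partial>N) \<noteq> \<infinity>" using fin prob by simp
    show "AE x in N. c \<le> \<phi> x" using gt by (auto elim!: AE_mp)
    show "\<not> (AE x in N. \<phi> x \<le> c)"
    proof
      assume "AE x in N. \<phi> x \<le> c"
      then have "AE x in N. \<not> True" using gt by eventually_elim (simp add: leD)
      then have "emeasure N {x \<in> space N. True} = 0" by (rule emeasure_eq_0_AE)
      then show False using prob by simp
    qed
  qed (use meas in auto)
  then show False using le prob by simp
qed

text \<open>
  The centred variable is orthogonal to the constant \<open>a\<close>, and its variance is at most the second moment.
\<close>

lemma shifted_second_moment:
  fixes Y :: "'a \<Rightarrow> real"
  assumes prob: "emeasure N (space N) = 1"
    and Y: "integrable N Y" and Y2: "integrable N (\<lambda>x. (Y x)\<^sup>2)"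
  shows "(\<integral>\<^sup>+x. ennreal ((a + (Y x - (\<integral>x. Y x \<partial>N)))\<^sup>2) \<partial>N) \<le> ennreal (a\<^sup>2) + ennreal (\<integral>x. (Y x)\<^sup>2 \<partial>N)"
proof -
  define \<mu> where "\<mu> = (\<integral>x. Y x \<partial>N)"
  interpret finite_measure N using prob by (intro finite_measureI) simp
  have one: "measure N (space N) = 1" using prob by (simp add: measure_def)
  have eq: "(a + (Y x - \<mu>))\<^sup>2 = (a - \<mu>)\<^sup>2 + (2 * (a - \<mu>)) * Y x + (Y x)\<^sup>2" for x
    by (simp add: power2_eq_square algebra_simps)
  have int: "integrable N (\<lambda>x. (a - \<mu>)\<^sup>2 + (2 * (a - \<mu>)) * Y x + (Y x)\<^sup>2)"
    using Y Y2 by (intro Bochner_Integration.integrable_add integrable_mult_right) auto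
  have "(\<integral>\<^sup>+x. ennreal ((a + (Y x - \<mu>))\<^sup>2) \<partial>N) = ennreal (\<integral>x. (a + (Y x - \<mu>))\<^sup>2 \<partial>N)"
    using int by (intro nn_integral_eq_integral) (simp_all only: eq[symmetric], simp)
  also have "(\<integral>x. (a + (Y x - \<mu>))\<^sup>2 \<partial>N) = (a - \<mu>)\<^sup>2 + 2 * (a - \<mu>) * \<mu> + (\<integral>x. (Y x)\<^sup>2 \<partial>N)"
    unfolding eq using Y Y2 one by (simp add: \<mu>_def)
  also have "\<dots> \<le> a\<^sup>2 + (\<integral>x. (Y x)\<^sup>2 \<partial>N)"
    by (simp add: power2_eq_square algebra_simps)
  finally show ?thesis by (simp add: \<mu>_def ennreal_leI ennreal_plus)
qed

text \<open>
  Independent sampling would give the bound in the mean; choosing the points one at a time needs only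
  integrals over \<open>N\<close> itself, and no product space. Having chosen \<open>n\<close> points with accumulated error
  vector \<open>a\<close>, the mean of \<open>\<parallel>a + Z\<parallel>\<^sup>2\<close> over the next centred contribution \<open>Z\<close> is \<open>\<parallel>a\<parallel>\<^sup>2\<close> plus the variance of
  \<open>Z\<close>, so some point keeps the square norm below that. The indices \<open>m\<close> and \<open>j\<close> stand for the eigenvectors
  and for the coefficients to be estimated.
\<close>

lemma greedy_sample:
  fixes Y :: "nat \<Rightarrow> nat \<Rightarrow> 'a \<Rightarrow> real"
  assumes prob: "emeasure N (space N) = 1"
    and Y: "\<And>m j. j < k \<Longrightarrow> integrable N (Y m j)"
    and Y2: "\<And>m j. j < k \<Longrightarrow> integrable N (\<lambda>x. (Y m j x)\<^sup>2)"
    and V: "(\<Sum>m. \<Sum>j<k. ennreal (\<integral>x. (Y m j x)\<^sup>2 \<partial>N)) \<le> ennreal v" and v: "0 \<le> v"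
    and Q: "AE x in N. Q x"
  shows "\<exists>x. (\<forall>i<n. x i \<in> space N \<and> Q (x i)) \<and>
    (\<Sum>m. \<Sum>j<k. ennreal ((\<Sum>i<n. Y m j (x i) - (\<integral>x. Y m j x \<partial>N))\<^sup>2)) \<le> ennreal (real n * v)"
proof (induction n)
  case 0
  show ?case by simp
next
  case (Suc n)
  define \<mu> where "\<mu> m j = (\<integral>x. Y m j x \<partial>N)" for m j
  obtain x where x: "\<And>i. i < n \<Longrightarrow> x i \<in> space N \<and> Q (x i)"
    and bound: "(\<Sum>m. \<Sum>j<k. ennreal ((\<Sum>i<n. Y m j (x i) - \<mu> m j)\<^sup>2)) \<le> ennreal (real n * v)"
    using Suc.IH unfolding \<mu>_def by blast
  define a where "a m j = (\<Sum>i<n. Y m j (x i) - \<mu> m j)" for m j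
  define \<phi> where "\<phi> y = (\<Sum>m. \<Sum>j<k. ennreal ((a m j + (Y m j y - \<mu> m j))\<^sup>2))" for y
  have Ym: "Y m j \<in> borel_measurable N" if "j < k" for m j
    using Y[OF that] by (rule borel_measurable_integrable)
  have m1: "(\<lambda>y. ennreal ((a m j + (Y m j y - \<mu> m j))\<^sup>2)) \<in> borel_measurable N" if "j < k" for m j
    using Ym[OF that, of m] by measurable
  have m2: "(\<lambda>y. \<Sum>j<k. ennreal ((a m j + (Y m j y - \<mu> m j))\<^sup>2)) \<in> borel_measurable N" for m
    using m1 by (intro borel_measurable_sum) auto
  have "(\<integral>\<^sup>+y. \<phi> y \<partial>N) = (\<Sum>m. \<integral>\<^sup>+y. (\<Sum>j<k. ennreal ((a m j + (Y m j y - \<mu> m j))\<^sup>2)) \<partial>N)"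
    unfolding \<phi>_def by (rule nn_integral_suminf[OF m2])
  also have "\<dots> = (\<Sum>m. \<Sum>j<k. \<integral>\<^sup>+y. ennreal ((a m j + (Y m j y - \<mu> m j))\<^sup>2) \<partial>N)"
    using m1 by (intro suminf_cong nn_integral_sum) auto
  also have "\<dots> \<le> (\<Sum>m. \<Sum>j<k. ennreal ((a m j)\<^sup>2) + ennreal (\<integral>x. (Y m j x)\<^sup>2 \<partial>N))"
    unfolding \<mu>_def using Y Y2
    by (intro suminf_le sum_mono shifted_second_moment prob) auto
  also have "\<dots> = (\<Sum>m. \<Sum>j<k. ennreal ((a m j)\<^sup>2)) + (\<Sum>m. \<Sum>j<k. ennreal (\<integral>x. (Y m j x)\<^sup>2 \<partial>N))"
    by (simp add: sum.distrib suminf_add)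
  also have "\<dots> \<le> ennreal (real n * v) + ennreal v"
    using bound V by (intro add_mono) (simp_all add: a_def)
  also have "\<dots> = ennreal (real (Suc n) * v)"
    using v by (simp add: distrib_right flip: ennreal_plus)
  finally have "(\<integral>\<^sup>+y. \<phi> y \<partial>N) \<le> ennreal (real (Suc n) * v)" .
  moreover have "\<phi> \<in> borel_measurable N"
    unfolding \<phi>_def using m2 by measurable
  ultimately obtain y where y: "y \<in> space N" "Q y" "\<phi> y \<le> ennreal (real (Suc n) * v)"
    using exists_le_mean[OF prob _ _ _ Q] by (metis ennreal_less_top infinity_ennreal_def)
  let ?x = "x(n := y)"
  have "(\<Sum>i<Suc n. Y m j (?x i) - \<mu> m j) = a m j + (Y m j y - \<mu> m j)" for m j
    by (simp add: a_def)
  with x y show ?case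
    by (intro exI[of _ ?x]) (auto simp: \<phi>_def less_Suc_eq simp flip: \<mu>_def simp del: sum.lessThan_Suc)
qed

context eigen_rkhs
begin

text \<open>
  Importance sampling of the coefficients \<open>\<langle>f, \<eta>\<^sub>j\<rangle>\<^sub>G\<close>. With sampling density \<open>u / U\<close>, the variable
  \<open>U f \<eta>\<^sub>j / u\<close> has mean \<open>\<langle>f, \<eta>\<^sub>j\<rangle>\<^sub>G\<close>; as \<open>\<Sum>\<^sub>j \<eta>\<^sub>j\<^sup>2 \<le> u\<close>, its second moments sum to at most \<open>U \<parallel>f\<parallel>\<^sub>G\<^sup>2\<close> over \<open>j\<close>,
  which is \<open>U l\<^sub>m\<close> for the eigenvector with index \<open>m\<close>. So the squared coefficient errors, summed over
  all \<open>j\<close> and \<open>m\<close>, are at most \<open>U trace(W) / n\<close>: a bound for the Hilbert-Schmidt norm of the error operator,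
  and thereby for its operator norm. Here \<open>U \<le> k + 1\<close>.
\<close>

lemma sampled_projection:
  assumes o: "G.orthonormal_or_zero k \<eta>" and suml: "summable l"
    and zero: "\<forall>q\<in>perp. gnorm d P q = 0" and n: "0 < n"
  shows "\<exists>x g. (\<forall>i<n. x i \<in> Dset P \<and> g i \<in> Gsp d P) \<and>
    (\<forall>f\<in>Hsp P. gnorm d P (\<lambda>z. (\<Sum>j<k. gip d P f (\<eta> j) * \<eta> j z) - (\<Sum>i<n. f (x i) * g i z))
       \<le> sqrt (real (k + 1) * suminf l / real n) * hnorm P f)"
proof -
  note \<eta> = G.orthoD(1)[OF o]
  define T where "T = suminf l"
  have T0: "0 \<le> T" unfolding T_def using suml l_nonneg by (intro suminf_nonneg) auto
  \<comment> \<open>The summand \<open>1\<close> keeps the weights \<open>1 / u\<close> finite where all \<open>\<eta> j\<close> vanish, at the price of \<open>k + 1\<close> instead of \<open>k\<close>.\<close>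
  define u where "u x = 1 + (\<Sum>j<k. (\<eta> j x)\<^sup>2)" for x
  have u1: "1 \<le> u x" for x by (simp add: u_def sum_nonneg)
  have u0: "0 < u x" "u x \<noteq> 0" for x using u1[of x] by auto
  interpret finite_measure M by (rule finite_measure_M)
  have one: "measure M (space M) = 1" using emeasure_M by (simp add: measure_def)
  have [measurable]: "\<eta> j \<in> borel_measurable M" if "j < k" for j
    using G_measurable[OF \<eta>[OF that]] .
  have [measurable]: "eigvec m \<in> borel_measurable M" for m
    by (intro G_measurable H_subset_G eigvec_in)
  have um [measurable]: "u \<in> borel_measurable M"
    unfolding u_def by (intro borel_measurable_add borel_measurable_sum borel_measurable_power) auto
  have uint: "integrable M u"
    unfolding u_def using G_sq_integrable[OF \<eta>] by (intro Bochner_Integration.integrable_add integrable_sum) auto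
  define U where "U = (\<integral>x. u x \<partial>M)"
  have "U = 1 + (\<Sum>j<k. gip d P (\<eta> j) (\<eta> j))"
  proof -
    have "U = (\<integral>x. 1 \<partial>M) + (\<integral>x. (\<Sum>j<k. (\<eta> j x)\<^sup>2) \<partial>M)"
      unfolding U_def u_def using G_sq_integrable[OF \<eta>]
      by (intro Bochner_Integration.integral_add) auto
    also have "(\<integral>x. (\<Sum>j<k. (\<eta> j x)\<^sup>2) \<partial>M) = (\<Sum>j<k. \<integral>x. (\<eta> j x)\<^sup>2 \<partial>M)"
      using G_sq_integrable[OF \<eta>] by (intro Bochner_Integration.integral_sum) auto
    finally show ?thesis using one by (simp add: gip_def power2_eq_square)
  qed
  moreover have "(\<Sum>j<k. gip d P (\<eta> j) (\<eta> j)) \<le> (\<Sum>j<k. 1)"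
    using G.ortho_self_le[OF o] by (intro sum_mono) auto
  moreover have "0 \<le> (\<Sum>j<k. gip d P (\<eta> j) (\<eta> j))"
    using \<eta> by (intro sum_nonneg) auto
  ultimately have U: "U \<le> real (k + 1)" "1 \<le> U" by auto
  then have U0: "0 < U" "U \<noteq> 0" by auto
  define N where "N = density M (\<lambda>x. ennreal (u x / U))"
  have spaceN: "space N = Dset P" by (simp add: N_def space_M)
  have prob: "emeasure N (space N) = 1"
  proof -
    have "emeasure N (space N) = (\<integral>\<^sup>+x. ennreal (u x / U) * indicator (space M) x \<partial>M)"
      unfolding N_def by (subst emeasure_density) auto
    also have "\<dots> = (\<integral>\<^sup>+x. ennreal (u x / U) \<partial>M)" by (intro nn_integral_cong) auto
    also have "\<dots> = ennreal (\<integral>x. u x / U \<partial>M)"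
      using uint u0 U0 by (intro nn_integral_eq_integral) (auto intro: divide_nonneg_nonneg less_imp_le)
    also have "\<dots> = 1" using U0 by (simp flip: U_def)
    finally show ?thesis .
  qed
  define Y where "Y m j x = U * eigvec m x * \<eta> j x / u x" for m j x
  have Ym [measurable]: "Y m j \<in> borel_measurable M" if "j < k" for m j
    unfolding Y_def using that by measurable
  have AEpos: "AE x in M. 0 \<le> u x / U" using u0 U0 by (auto intro: divide_nonneg_nonneg less_imp_le)
  have uY: "u x / U * Y m j x = eigvec m x * \<eta> j x" for m j x
    using u0[of x] U0 by (simp add: Y_def)
  have uY2: "u x / U * (Y m j x)\<^sup>2 = U * ((eigvec m x)\<^sup>2 * (\<eta> j x)\<^sup>2 / u x)" for m j x
    using u0[of x] U0 by (simp add: Y_def power2_eq_square)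
  have Yint: "integrable N (Y m j)" if "j < k" for m j
    unfolding N_def using that G_mult_integrable[OF H_subset_G[OF eigvec_in[of m]] \<eta>[OF that]]
    by (subst integrable_density) (auto simp: uY AEpos simp del: times_divide_eq_left)
  have Ymean: "(\<integral>x. Y m j x \<partial>N) = gip d P (eigvec m) (\<eta> j)" if "j < k" for m j
    unfolding N_def using that
    by (subst integral_density) (auto simp: uY AEpos gip_def simp del: times_divide_eq_left)
  have eta_le: "(\<eta> j x)\<^sup>2 \<le> u x" if "j < k" for j x
    unfolding u_def using that member_le_sum[of j "{..<k}" "\<lambda>j. (\<eta> j x)\<^sup>2"] by simp
  have Zint: "integrable M (\<lambda>x. (eigvec m x)\<^sup>2 * (\<eta> j x)\<^sup>2 / u x)" if "j < k" for m j
  proof (rule Bochner_Integration.integrable_bound[OF G_sq_integrable[OF H_subset_G[OF eigvec_in[of m]]]])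
    show "(\<lambda>x. (eigvec m x)\<^sup>2 * (\<eta> j x)\<^sup>2 / u x) \<in> borel_measurable M" using that by measurable
    have "(eigvec m x)\<^sup>2 * (\<eta> j x)\<^sup>2 / u x \<le> (eigvec m x)\<^sup>2" for x
      using mult_left_mono[OF eta_le[OF that, of x], of "(eigvec m x)\<^sup>2"] u0[of x]
      by (simp add: divide_le_eq)
    then show "AE x in M. norm ((eigvec m x)\<^sup>2 * (\<eta> j x)\<^sup>2 / u x) \<le> norm ((eigvec m x)\<^sup>2)"
      using u0 by (intro AE_I2) (simp add: abs_of_pos)
  qed
  have Y2int: "integrable N (\<lambda>x. (Y m j x)\<^sup>2)" if "j < k" for m j
    unfolding N_def using that Zint[OF that, of m]
    by (subst integrable_density) (auto simp: uY2 AEpos simp del: times_divide_eq_left times_divide_eq_right)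
  have Y2: "(\<integral>x. (Y m j x)\<^sup>2 \<partial>N) = U * (\<integral>x. (eigvec m x)\<^sup>2 * (\<eta> j x)\<^sup>2 / u x \<partial>M)" if "j < k" for m j
    unfolding N_def using that
    by (subst integral_density) (auto simp: uY2 AEpos simp del: times_divide_eq_left times_divide_eq_right)
  have Vm: "(\<Sum>j<k. ennreal (\<integral>x. (Y m j x)\<^sup>2 \<partial>N)) \<le> ennreal (U * l m)" for m
  proof -
    have "(\<Sum>j<k. \<integral>x. (Y m j x)\<^sup>2 \<partial>N) = (\<Sum>j<k. U * (\<integral>x. (eigvec m x)\<^sup>2 * (\<eta> j x)\<^sup>2 / u x \<partial>M))"
      using Y2 by (intro sum.cong) auto
    also have "\<dots> = U * (\<integral>x. (\<Sum>j<k. (eigvec m x)\<^sup>2 * (\<eta> j x)\<^sup>2 / u x) \<partial>M)"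
      using Zint by (simp add: sum_distrib_left)
    also have "\<dots> \<le> U * (\<integral>x. (eigvec m x)\<^sup>2 \<partial>M)"
    proof (intro mult_left_mono integral_mono)
      show "integrable M (\<lambda>x. \<Sum>j<k. (eigvec m x)\<^sup>2 * (\<eta> j x)\<^sup>2 / u x)" using Zint by auto
      show "integrable M (\<lambda>x. (eigvec m x)\<^sup>2)" by (intro G_sq_integrable H_subset_G eigvec_in)
      fix x
      have "(\<Sum>j<k. (eigvec m x)\<^sup>2 * (\<eta> j x)\<^sup>2 / u x) = (eigvec m x)\<^sup>2 * ((u x - 1) / u x)"
        by (simp add: u_def sum_distrib_left sum_divide_distrib)
      also have "\<dots> \<le> (eigvec m x)\<^sup>2" using u0[of x] by (intro mult_left_le) (auto simp: divide_le_eq)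
      finally show "(\<Sum>j<k. (eigvec m x)\<^sup>2 * (\<eta> j x)\<^sup>2 / u x) \<le> (eigvec m x)\<^sup>2" .
    qed (use U0 in simp)
    also have "\<dots> = U * l m" using gip_eigvec_self[of m] by (simp add: gip_def power2_eq_square)
    finally have "ennreal (\<Sum>j<k. \<integral>x. (Y m j x)\<^sup>2 \<partial>N) \<le> ennreal (U * l m)" by (rule ennreal_leI)
    then show ?thesis by (subst sum_ennreal) auto
  qed
  have V: "(\<Sum>m. \<Sum>j<k. ennreal (\<integral>x. (Y m j x)\<^sup>2 \<partial>N)) \<le> ennreal (U * T)"
  proof -
    have "(\<Sum>m. \<Sum>j<k. ennreal (\<integral>x. (Y m j x)\<^sup>2 \<partial>N)) \<le> (\<Sum>m. ennreal (U * l m))"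
      using Vm by (intro suminf_le) auto
    also have "\<dots> = ennreal (\<Sum>m. U * l m)"
      using suml l_nonneg U0 by (intro suminf_ennreal2) (auto intro!: summable_mult)
    also have "(\<Sum>m. U * l m) = U * T" unfolding T_def using suml by (rule suminf_mult)
    finally show ?thesis .
  qed
  have AEN: "AE x in N. \<forall>q\<in>perp. q x = 0"
    unfolding N_def using perp_AE_zero[OF zero] by (subst AE_density) auto
  obtain x where x: "\<And>i. i < n \<Longrightarrow> x i \<in> Dset P \<and> (\<forall>q\<in>perp. q (x i) = 0)"
    and sm: "(\<Sum>m. \<Sum>j<k. ennreal ((\<Sum>i<n. Y m j (x i) - (\<integral>x. Y m j x \<partial>N))\<^sup>2)) \<le> ennreal (real n * (U * T))"
    using greedy_sample[OF prob Yint Y2int V _ AEN, of n] U0 T0 spaceN by auto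
  define w where "w i j = U * \<eta> j (x i) / (real n * u (x i))" for i j
  define g where "g i = (\<lambda>z. \<Sum>j<k. w i j * \<eta> j z)" for i
  \<comment> \<open>The error functional of the estimate for the \<open>j\<close>-th coefficient.\<close>
  define E where "E j f = gip d P f (\<eta> j) - (\<Sum>i<n. f (x i) * w i j)" for j f
  have gG: "g i \<in> Gsp d P" for i unfolding g_def using \<eta> by simp
  have n0: "real n > 0" "real n \<noteq> 0" using n by auto
  have Eeb: "(E j (eigvec m))\<^sup>2 = (\<Sum>i<n. Y m j (x i) - (\<integral>x. Y m j x \<partial>N))\<^sup>2 / (real n)\<^sup>2" if "j < k" for j m
  proof -
    have "(\<Sum>i<n. Y m j (x i) - (\<integral>x. Y m j x \<partial>N)) = (\<Sum>i<n. Y m j (x i)) - real n * gip d P (eigvec m) (\<eta> j)"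
      using Ymean[OF that] by (simp add: sum_subtractf)
    also have "(\<Sum>i<n. Y m j (x i)) = real n * (\<Sum>i<n. eigvec m (x i) * w i j)"
      unfolding sum_distrib_left Y_def w_def using n0 by (intro sum.cong) auto
    finally have "(\<Sum>i<n. Y m j (x i) - (\<integral>x. Y m j x \<partial>N)) = - real n * E j (eigvec m)"
      by (simp add: E_def algebra_simps)
    then show ?thesis using n0 by (simp add: power_mult_distrib)
  qed
  have Esum: "(\<Sum>j<k. \<Sum>m<p. (E j (eigvec m))\<^sup>2) \<le> U * T / real n" for p
  proof -
    let ?S = "\<lambda>m. \<Sum>j<k. (\<Sum>i<n. Y m j (x i) - (\<integral>x. Y m j x \<partial>N))\<^sup>2"
    have "ennreal (\<Sum>m<p. ?S m) = (\<Sum>m<p. \<Sum>j<k. ennreal ((\<Sum>i<n. Y m j (x i) - (\<integral>x. Y m j x \<partial>N))\<^sup>2))"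
      by (simp add: sum_nonneg flip: sum_ennreal)
    also have "\<dots> \<le> (\<Sum>m. \<Sum>j<k. ennreal ((\<Sum>i<n. Y m j (x i) - (\<integral>x. Y m j x \<partial>N))\<^sup>2))"
      by (intro sum_le_suminf) auto
    finally have "ennreal (\<Sum>m<p. ?S m) \<le> ennreal (real n * (U * T))" using sm by (rule order_trans)
    then have "(\<Sum>m<p. ?S m) \<le> real n * (U * T)"
      using U0 T0 by (subst (asm) ennreal_le_iff) auto
    then have "(\<Sum>m<p. ?S m) / (real n)\<^sup>2 \<le> real n * (U * T) / (real n)\<^sup>2"
      by (intro divide_right_mono) auto
    also have "\<dots> = U * T / real n" using n0 by (simp add: power2_eq_square)
    also have "(\<Sum>m<p. ?S m) / (real n)\<^sup>2 = (\<Sum>m<p. \<Sum>j<k. (E j (eigvec m))\<^sup>2)"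
      unfolding sum_divide_distrib using Eeb by (intro sum.cong) auto
    finally show ?thesis by (subst sum.swap)
  qed
  have lin: "E j (fourier f p) = (\<Sum>m<p. ip P f (eigvec m) * E j (eigvec m))" if "j < k" for j f p
  proof -
    have "gip d P (fourier f p) (\<eta> j) = (\<Sum>m<p. ip P f (eigvec m) * gip d P (eigvec m) (\<eta> j))"
      unfolding fourier_def using \<eta>[OF that] H_subset_G by (simp add: G.linear_simps)
    moreover have "(\<Sum>i<n. fourier f p (x i) * w i j) = (\<Sum>m<p. ip P f (eigvec m) * (\<Sum>i<n. eigvec m (x i) * w i j))"
      unfolding fourier_def sum_distrib_left sum_distrib_right by (subst sum.swap) (simp add: mult.assoc)
    ultimately show ?thesis by (simp add: E_def algebra_simps sum_subtractf)
  qed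
  have bound: "(\<Sum>j<k. (E j f)\<^sup>2) \<le> U * T / real n * (hnorm P f)\<^sup>2" if f: "f \<in> Hsp P" for f
  proof -
    obtain p where p: "p \<in> Hsp P" and lim: "(\<lambda>n. hnorm P (\<lambda>x. fourier f n x - p x)) \<longlonglongrightarrow> 0"
      and q: "(\<lambda>x. f x - p x) \<in> perp"
      using fourier_decomposition[OF f] by (elim bexE conjE)
    \<comment> \<open>The part of \<open>f\<close> in the complement is seen neither by the integrals nor by the sample points.\<close>
    have Ef: "E j f = E j p" if j: "j < k" for j
    proof -
      have "\<bar>gip d P (\<lambda>x. f x - p x) (\<eta> j)\<bar> \<le> gnorm d P (\<lambda>x. f x - p x) * gnorm d P (\<eta> j)"
        using q j by (intro G.Cauchy_Schwarz \<eta> H_subset_G perp_in)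
      then have "gip d P f (\<eta> j) = gip d P p (\<eta> j)"
        using bspec[OF zero q] H_subset_G f p \<eta>[OF j] by (simp add: G.diff_left)
      moreover have "f (x i) = p (x i)" if "i < n" for i using x[OF that] q by force
      ultimately show ?thesis by (simp add: E_def)
    qed
    have glim: "(\<lambda>n. gnorm d P (\<lambda>x. fourier f n x - p x)) \<longlonglongrightarrow> 0"
      by (rule gnorm_tendsto_zero[OF H.diff_in[OF fourier_in p] lim])
    have plim: "(\<lambda>n. fourier f n y) \<longlonglongrightarrow> p y" if y: "y \<in> Dset P" for y
    proof -
      obtain C where C: "\<forall>f\<in>Hsp P. \<bar>f y\<bar> \<le> C * hnorm P f"
        using point_evaluation_bounded[OF y] by blast
      show ?thesis
      proof (rule LIM_zero_cancel, rule Lim_null_comparison)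
        show "\<forall>\<^sub>F n in sequentially. norm (fourier f n y - p y) \<le> C * hnorm P (\<lambda>x. fourier f n x - p x)"
          using bspec[OF C H.diff_in[OF fourier_in p]] by (intro always_eventually allI) simp
        show "(\<lambda>n. C * hnorm P (\<lambda>x. fourier f n x - p x)) \<longlonglongrightarrow> 0"
          using tendsto_mult_right_zero[OF lim] .
      qed
    qed
    have Elim: "(\<lambda>n. E j (fourier f n)) \<longlonglongrightarrow> E j p" if j: "j < k" for j
      unfolding E_def using x p j
      by (intro tendsto_diff G.left_tendsto glim H_subset_G fourier_in \<eta> tendsto_sum tendsto_mult plim tendsto_const) auto
    have "(\<Sum>j<k. (E j p)\<^sup>2) \<le> U * T / real n * (hnorm P f)\<^sup>2"
    proof (rule LIMSEQ_le_const2)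
      show "(\<lambda>n. \<Sum>j<k. (E j (fourier f n))\<^sup>2) \<longlonglongrightarrow> (\<Sum>j<k. (E j p)\<^sup>2)"
        using Elim by (intro tendsto_sum tendsto_power) auto
      have "(\<Sum>j<k. (E j (fourier f N))\<^sup>2) \<le> U * T / real n * (hnorm P f)\<^sup>2" for N
      proof -
        have "(\<Sum>j<k. (E j (fourier f N))\<^sup>2) \<le> (\<Sum>j<k. (hnorm P f)\<^sup>2 * (\<Sum>m<N. (E j (eigvec m))\<^sup>2))"
        proof (rule sum_mono)
          fix j assume "j \<in> {..<k}"
          then have "(E j (fourier f N))\<^sup>2 \<le> (\<Sum>m<N. (ip P f (eigvec m))\<^sup>2) * (\<Sum>m<N. (E j (eigvec m))\<^sup>2)"
            by (simp add: lin Cauchy_Schwarz_ineq_sum)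
          also have "\<dots> \<le> (hnorm P f)\<^sup>2 * (\<Sum>m<N. (E j (eigvec m))\<^sup>2)"
            using Bessel[OF f] by (intro mult_right_mono sum_nonneg) auto
          finally show "(E j (fourier f N))\<^sup>2 \<le> (hnorm P f)\<^sup>2 * (\<Sum>m<N. (E j (eigvec m))\<^sup>2)" .
        qed
        also have "\<dots> = (hnorm P f)\<^sup>2 * (\<Sum>j<k. \<Sum>m<N. (E j (eigvec m))\<^sup>2)" by (simp add: sum_distrib_left)
        also have "\<dots> \<le> (hnorm P f)\<^sup>2 * (U * T / real n)"
          using Esum by (intro mult_left_mono) auto
        finally show ?thesis by (simp add: mult.commute)
      qed
      then show "\<exists>N. \<forall>n'\<ge>N. (\<Sum>j<k. (E j (fourier f n'))\<^sup>2) \<le> U * T / real n * (hnorm P f)\<^sup>2" by blast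
    qed
    then show ?thesis using Ef by simp
  qed
  show ?thesis
  proof (intro exI[of _ x] exI[of _ g] conjI ballI allI impI)
    show "x i \<in> Dset P" if "i < n" for i using x[OF that] by simp
    show "g i \<in> Gsp d P" for i by (rule gG)
    fix f assume f: "f \<in> Hsp P"
    let ?r = "\<lambda>z. (\<Sum>j<k. gip d P f (\<eta> j) * \<eta> j z) - (\<Sum>i<n. f (x i) * g i z)"
    have eq: "?r = (\<lambda>z. \<Sum>j<k. E j f * \<eta> j z)"
    proof
      fix z
      have "(\<Sum>i<n. f (x i) * g i z) = (\<Sum>j<k. (\<Sum>i<n. f (x i) * w i j) * \<eta> j z)"
        unfolding g_def sum_distrib_left sum_distrib_right by (subst sum.swap) (simp add: mult.assoc)
      then show "?r z = (\<Sum>j<k. E j f * \<eta> j z)"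
        by (simp add: E_def left_diff_distrib sum_subtractf)
    qed
    have "(gnorm d P ?r)\<^sup>2 \<le> (\<Sum>j<k. (E j f)\<^sup>2)"
      unfolding eq by (rule G.ortho_sum_sq[OF o])
    also have "\<dots> \<le> U * T / real n * (hnorm P f)\<^sup>2" by (rule bound[OF f])
    also have "\<dots> \<le> real (k + 1) * T / real n * (hnorm P f)\<^sup>2"
      using U T0 by (intro mult_right_mono divide_right_mono) auto
    also have "\<dots> = (sqrt (real (k + 1) * T / real n) * hnorm P f)\<^sup>2"
      using T0 by (simp add: power_mult_distrib)
    finally show "gnorm d P ?r \<le> sqrt (real (k + 1) * suminf l / real n) * hnorm P f"
      unfolding T_def[symmetric]
      by (rule power2_le_imp_le) (use T0 f in auto)
  qed
qed

text \<open>
  The projection onto the span of the \<open>g i\<close> is at least as good as the given rank-\<open>k\<close> approximation; the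
  triangle inequality adds the error of the sampled coefficients.
\<close>

lemma sampling_error:
  assumes fr: "\<forall>\<delta>>0. \<exists>m L g. finite_rank_approx \<delta> m L g"
    and app: "finite_rank_approx \<epsilon> k L g" and suml: "summable l" and n: "0 < n"
  shows "\<exists>x g. (\<forall>i<n. x i \<in> Dset P \<and> g i \<in> Gsp d P) \<and>
    (\<forall>f\<in>Hsp P. gnorm d P (\<lambda>z. f z - (\<Sum>i<n. f (x i) * g i z))
       \<le> (\<epsilon> + sqrt (real (k + 1) * suminf l / real n)) * hnorm P f)"
proof -
  have g: "\<And>i. i < k \<Longrightarrow> g i \<in> Gsp d P"
    and err: "\<And>f. f \<in> Hsp P \<Longrightarrow> gnorm d P (\<lambda>x. f x - (\<Sum>i<k. L i f * g i x)) \<le> \<epsilon> * hnorm P f"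
    using app by (auto simp: finite_rank_approx_def)
  have "\<exists>\<eta>. G.orthonormal_or_zero k \<eta> \<and>
      (\<forall>c. \<exists>a. gnorm d P (\<lambda>x. (\<Sum>i<k. c i * g i x) - (\<Sum>i<k. a i * \<eta> i x)) = 0)"
    by (rule G.Gram_Schmidt) (rule g)
  then obtain \<eta> where o: "G.orthonormal_or_zero k \<eta>" and
    spn: "\<forall>c. \<exists>a. gnorm d P (\<lambda>x. (\<Sum>i<k. c i * g i x) - (\<Sum>i<k. a i * \<eta> i x)) = 0"
    by (elim exE conjE)
  note \<eta> = G.orthoD(1)[OF o]
  have "\<forall>q\<in>perp. gnorm d P q = 0"
    using perp_gnorm_zero[OF fr] by blast
  from sampled_projection[OF o suml this n] obtain x h where xh: "\<forall>i<n. x i \<in> Dset P \<and> h i \<in> Gsp d P"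
    and samp: "\<forall>f\<in>Hsp P. gnorm d P (\<lambda>z. (\<Sum>j<k. gip d P f (\<eta> j) * \<eta> j z) - (\<Sum>i<n. f (x i) * h i z))
       \<le> sqrt (real (k + 1) * suminf l / real n) * hnorm P f"
    by (elim exE conjE)
  have "gnorm d P (\<lambda>z. f z - (\<Sum>i<n. f (x i) * h i z))
       \<le> (\<epsilon> + sqrt (real (k + 1) * suminf l / real n)) * hnorm P f" if f: "f \<in> Hsp P" for f
  proof -
    note fG = H_subset_G[OF f]
    define p where "p = (\<lambda>z. \<Sum>j<k. gip d P f (\<eta> j) * \<eta> j z)"
    define s where "s = (\<lambda>z. \<Sum>i<n. f (x i) * h i z)"
    define A where "A = (\<lambda>z. \<Sum>i<k. L i f * g i z)"
    obtain a where a: "gnorm d P (\<lambda>x. (\<Sum>i<k. L i f * g i x) - (\<Sum>i<k. a i * \<eta> i x)) = 0"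
      using spn[rule_format, of "\<lambda>i. L i f"] by (elim exE)
    define B where "B = (\<lambda>z. \<Sum>i<k. a i * \<eta> i z)"
    have pG: "p \<in> Gsp d P" unfolding p_def using \<eta> by simp
    have sG: "s \<in> Gsp d P" unfolding s_def using xh by simp
    have AG: "A \<in> Gsp d P" unfolding A_def using g by simp
    have BG: "B \<in> Gsp d P" unfolding B_def using \<eta> by simp
    have "gnorm d P (\<lambda>z. f z - p z) \<le> gnorm d P (\<lambda>z. f z - B z)"
      unfolding p_def B_def by (rule G.ortho_best_approx[OF o fG])
    also have "\<dots> \<le> gnorm d P (\<lambda>z. f z - A z) + gnorm d P (\<lambda>z. A z - B z)"
      by (rule G.nrm_triangle[OF fG AG BG])
    also have "\<dots> \<le> \<epsilon> * hnorm P f"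
      using a err[OF f] by (simp add: A_def B_def)
    finally have "gnorm d P (\<lambda>z. f z - p z) \<le> \<epsilon> * hnorm P f" .
    moreover have "gnorm d P (\<lambda>z. p z - s z) \<le> sqrt (real (k + 1) * suminf l / real n) * hnorm P f"
      unfolding p_def s_def by (rule bspec[OF samp f])
    moreover have "gnorm d P (\<lambda>z. f z - s z) \<le> gnorm d P (\<lambda>z. f z - p z) + gnorm d P (\<lambda>z. p z - s z)"
      by (rule G.nrm_triangle[OF fG pG sG])
    ultimately show ?thesis by (simp add: distrib_right s_def)
  qed
  with xh show ?thesis by (intro exI[of _ x] exI[of _ h] conjI ballI)
qed

end

section \<open>Worst-case errors and information complexity\<close>

context embedded_rkhs
begin

lemma Lambda_std_subset: "Lambda_std P \<subseteq> Lambda_all P"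
  using point_evaluation_bounded by (auto simp: Lambda_std_def Lambda_all_def)

lemma linear_algorithm_bounded:
  fixes m :: nat
  assumes L: "\<And>i. i < m \<Longrightarrow> L i \<in> Lambda_all P" and g: "\<And>i. i < m \<Longrightarrow> g i \<in> Gsp d P"
  shows "\<exists>C. \<forall>f\<in>Hsp P. gnorm d P (\<lambda>x. f x - (\<Sum>i<m. L i f * g i x)) \<le> C * hnorm P f"
proof -
  have "\<forall>i. \<exists>C. i < m \<longrightarrow> (\<forall>f\<in>Hsp P. \<bar>L i f\<bar> \<le> C * hnorm P f)"
    using Lambda_allD(3)[OF L] by meson
  then obtain C where C: "\<forall>i. i < m \<longrightarrow> (\<forall>f\<in>Hsp P. \<bar>L i f\<bar> \<le> C i * hnorm P f)"
    by (rule choice[THEN exE])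
  have "gnorm d P (\<lambda>x. f x - (\<Sum>i<m. L i f * g i x)) \<le> (embedding_bound + (\<Sum>i<m. C i * gnorm d P (g i))) * hnorm P f"
    if f: "f \<in> Hsp P" for f
  proof -
    have "gnorm d P (\<lambda>x. \<Sum>i<m. L i f * g i x) \<le> (\<Sum>i<m. gnorm d P (\<lambda>x. L i f * g i x))"
      using g by (intro G.nrm_sum) auto
    also have "\<dots> \<le> (\<Sum>i<m. C i * gnorm d P (g i) * hnorm P f)"
    proof (rule sum_mono)
      fix i assume i: "i \<in> {..<m}"
      then have "\<bar>L i f\<bar> \<le> C i * hnorm P f" using C f by simp
      then have "\<bar>L i f\<bar> * gnorm d P (g i) \<le> C i * hnorm P f * gnorm d P (g i)"
        using g i by (intro mult_right_mono) auto
      then show "gnorm d P (\<lambda>x. L i f * g i x) \<le> C i * gnorm d P (g i) * hnorm P f"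
        using g i by (simp add: G.nrm_scale mult_ac)
    qed
    finally have "gnorm d P (\<lambda>x. \<Sum>i<m. L i f * g i x) \<le> (\<Sum>i<m. C i * gnorm d P (g i)) * hnorm P f"
      by (simp add: sum_distrib_right)
    moreover have "gnorm d P (\<lambda>x. f x - (\<Sum>i<m. L i f * g i x))
        \<le> gnorm d P f + gnorm d P (\<lambda>x. \<Sum>i<m. L i f * g i x)"
      using g H_subset_G[OF f] by (intro G.nrm_diff G.sum_lessThan_in G.scale_in) auto
    ultimately show ?thesis using embedding_bound(2)[OF f] by (simp add: distrib_right)
  qed
  then show ?thesis by (intro exI ballI)
qed

lemma algorithms_mono:
  assumes "\<Lambda> \<subseteq> \<Lambda>'" shows "algorithms n d P \<Lambda> \<subseteq> algorithms n d P \<Lambda>'"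
  using assms unfolding algorithms_def by fast

lemma algorithm_bounded:
  assumes "A \<in> algorithms n d P (Lambda_all P)"
  shows "\<exists>C. \<forall>f\<in>Hsp P. gnorm d P (\<lambda>x. f x - A f x) \<le> C * hnorm P f"
proof -
  obtain m L g where "m \<le> n" and "\<forall>i<m. L i \<in> Lambda_all P \<and> g i \<in> Gsp d P"
    and "A = (\<lambda>f x. \<Sum>i<m. L i f * g i x)"
    using assms unfolding algorithms_def mem_Collect_eq by (elim exE conjE)
  then show ?thesis using linear_algorithm_bounded[of m L g] by simp
qed

lemma unit_ball_ne: "{f \<in> Hsp P. hnorm P f \<le> 1} \<noteq> {}"
  using H.zero_in H.nrm_zero by (auto intro!: exI[of _ "\<lambda>x. 0"])

lemma worst_case_error_upper:
  assumes A: "A \<in> algorithms n d P (Lambda_all P)" and f: "f \<in> Hsp P" "hnorm P f \<le> 1"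
  shows "gnorm d P (\<lambda>x. f x - A f x) \<le> worst_case_error d P A"
proof -
  obtain C where C: "\<forall>f\<in>Hsp P. gnorm d P (\<lambda>x. f x - A f x) \<le> C * hnorm P f"
    using algorithm_bounded[OF A] by blast
  have "gnorm d P (\<lambda>x. f x - A f x) \<le> \<bar>C\<bar>" if "f \<in> Hsp P" "hnorm P f \<le> 1" for f
  proof -
    have "gnorm d P (\<lambda>x. f x - A f x) \<le> C * hnorm P f" using C that(1) by (rule bspec)
    also have "\<dots> \<le> \<bar>C\<bar> * 1" using that H.nrm_nonneg[OF that(1)] by (intro mult_mono) auto
    finally show ?thesis by simp
  qed
  then have "bdd_above ((\<lambda>f. gnorm d P (\<lambda>x. f x - A f x)) ` {f \<in> Hsp P. hnorm P f \<le> 1})"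
    by (intro bdd_aboveI2[of _ _ "\<bar>C\<bar>"]) auto
  then show ?thesis
    unfolding worst_case_error_def APP_def using f by (intro cSUP_upper) auto
qed

lemma worst_case_error_le:
  assumes "\<And>f. f \<in> Hsp P \<Longrightarrow> gnorm d P (\<lambda>x. f x - A f x) \<le> c * hnorm P f" and "0 \<le> c"
  shows "worst_case_error d P A \<le> c"
  unfolding worst_case_error_def APP_def
proof (rule cSUP_least[OF unit_ball_ne])
  fix f assume "f \<in> {f \<in> Hsp P. hnorm P f \<le> 1}"
  then show "gnorm d P (\<lambda>x. f x - A f x) \<le> c"
    using assms(1)[of f] mult_left_mono[OF _ \<open>0 \<le> c\<close>, of "hnorm P f" 1] by simp
qed

text \<open>
  Algorithms built from linear functionals are homogeneous, so a bound on the unit ball scales.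
\<close>

lemma finite_rank_approx_of_algorithm:
  assumes A: "A \<in> algorithms n d P (Lambda_all P)" and w: "worst_case_error d P A \<le> c"
  shows "\<exists>m\<le>n. \<exists>L g. finite_rank_approx c m L g"
proof -
  obtain m L g where m: "m \<le> n" and Lg: "\<forall>i<m. L i \<in> Lambda_all P \<and> g i \<in> Gsp d P"
    and Aeq: "A = (\<lambda>f x. \<Sum>i<m. L i f * g i x)"
    using A unfolding algorithms_def mem_Collect_eq by (elim exE conjE)
  have "gnorm d P (\<lambda>x. f x - A f x) \<le> c * hnorm P f" if f: "f \<in> Hsp P" for f
  proof (cases "hnorm P f = 0")
    case True
    obtain C where "\<forall>f\<in>Hsp P. gnorm d P (\<lambda>x. f x - A f x) \<le> C * hnorm P f"
      using algorithm_bounded[OF A] by blast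
    from bspec[OF this f] True show ?thesis by simp
  next
    case False
    then have pos: "0 < hnorm P f" using H.nrm_nonneg[OF f] by linarith
    define a where "a = 1 / hnorm P f"
    have a: "a * hnorm P f = 1" "0 < a" using pos by (auto simp: a_def)
    define h where "h = (\<lambda>x. a * f x)"
    have hH: "h \<in> Hsp P" unfolding h_def using f by simp
    have "hnorm P h = 1" unfolding h_def using f a by (simp add: H.nrm_scale)
    then have "gnorm d P (\<lambda>x. h x - A h x) \<le> c"
      using worst_case_error_upper[OF A hH] w by simp
    moreover have "(\<lambda>x. h x - A h x) = (\<lambda>x. a * (f x - A f x))"
    proof -
      have "L i h = a * L i f" if "i < m" for i
        unfolding h_def using Lambda_allD(2) Lg that f by blast
      then show ?thesis by (simp add: Aeq h_def right_diff_distrib sum_distrib_left mult_ac)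
    qed
    moreover have "(\<lambda>x. f x - A f x) \<in> Gsp d P"
      unfolding Aeq using Lg H_subset_G[OF f] by simp
    ultimately have "a * gnorm d P (\<lambda>x. f x - A f x) \<le> c"
      using a by (simp add: G.nrm_scale)
    then have "a * gnorm d P (\<lambda>x. f x - A f x) * hnorm P f \<le> c * hnorm P f"
      using pos by (intro mult_right_mono) auto
    moreover have "a * gnorm d P (\<lambda>x. f x - A f x) * hnorm P f
        = gnorm d P (\<lambda>x. f x - A f x) * (a * hnorm P f)"
      by (simp only: mult_ac)
    ultimately show ?thesis using a(1) by simp
  qed
  then have "finite_rank_approx c m L g"
    using Lg by (simp add: finite_rank_approx_def Aeq)
  with m show ?thesis by blast
qed

lemma worst_case_error_nonneg:
  assumes A: "A \<in> algorithms n d P (Lambda_all P)" shows "0 \<le> worst_case_error d P A"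
proof -
  obtain m L g where "m \<le> n" and Lg: "\<forall>i<m. L i \<in> Lambda_all P \<and> g i \<in> Gsp d P"
    and Aeq: "A = (\<lambda>f x. \<Sum>i<m. L i f * g i x)"
    using A unfolding algorithms_def mem_Collect_eq by (elim exE conjE)
  have "0 \<le> gnorm d P (\<lambda>x. (\<lambda>x. 0) x - A (\<lambda>x. 0) x)"
    unfolding Aeq using Lg by (intro G.nrm_nonneg G.diff_in) auto
  also have "\<dots> \<le> worst_case_error d P A"
    by (rule worst_case_error_upper[OF A]) auto
  finally show ?thesis .
qed

lemma algorithms_ne: "(\<lambda>f x. 0) \<in> algorithms n d P \<Lambda>"
  unfolding algorithms_def by (auto intro!: exI[of _ 0])

lemma algorithms_0: "algorithms 0 d P \<Lambda> = {\<lambda>f x. 0}"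
  unfolding algorithms_def by auto

lemma init_error_eq: "init_error d P \<Lambda> = worst_case_error d P (\<lambda>f x. 0)"
  by (simp add: init_error_def min_error_def algorithms_0)

lemma bdd_below_errors:
  assumes "\<Lambda> \<subseteq> Lambda_all P"
  shows "bdd_below (worst_case_error d P ` algorithms n d P \<Lambda>)"
  using algorithms_mono[OF assms, of n] worst_case_error_nonneg by (intro bdd_belowI2[of _ 0]) blast

lemma min_error_le:
  assumes "\<Lambda> \<subseteq> Lambda_all P" "A \<in> algorithms n d P \<Lambda>"
  shows "min_error n d P \<Lambda> \<le> worst_case_error d P A"
  unfolding min_error_def by (rule cINF_lower[OF bdd_below_errors[OF assms(1)] assms(2)])

lemma min_error_lessD:
  assumes "\<Lambda> \<subseteq> Lambda_all P" "min_error n d P \<Lambda> < c"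
  shows "\<exists>A\<in>algorithms n d P \<Lambda>. worst_case_error d P A < c"
proof -
  have "algorithms n d P \<Lambda> \<noteq> {}" using algorithms_ne by blast
  then show ?thesis
    using assms(2) cINF_less_iff[OF _ bdd_below_errors[OF assms(1)]] unfolding min_error_def by blast
qed

lemma min_error_all_le_std: "min_error n d P (Lambda_all P) \<le> min_error n d P (Lambda_std P)"
  unfolding min_error_def
proof (rule cINF_superset_mono)
  show "algorithms n d P (Lambda_std P) \<noteq> {}" using algorithms_ne by blast
qed (use bdd_below_errors[OF order_refl] algorithms_mono[OF Lambda_std_subset] in auto)

text \<open>
  The factor of \<open>\<epsilon>\<close> in the error demand. The initial error is the same for both classes of information
  (\<open>init_error_eq\<close>), hence so is this factor.
\<close>

definition threshold :: "criterion \<Rightarrow> real" where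
  "threshold crit = (case crit of Abs \<Rightarrow> 1 | Norm \<Rightarrow> init_error d P (Lambda_all P))"

lemma info_complexity_eq:
  "info_complexity crit \<epsilon> d P \<Lambda> = (INF n\<in>{n. min_error n d P \<Lambda> \<le> \<epsilon> * threshold crit}. enat n)"
  by (cases crit) (simp_all add: info_complexity_def threshold_def init_error_eq)

lemma info_complexity_le:
  assumes "min_error n d P \<Lambda> \<le> \<epsilon> * threshold crit" shows "info_complexity crit \<epsilon> d P \<Lambda> \<le> enat n"
  unfolding info_complexity_eq using assms by (intro INF_lower) simp

lemma info_complexity_attained:
  assumes "info_complexity crit \<epsilon> d P \<Lambda> = enat n" shows "min_error n d P \<Lambda> \<le> \<epsilon> * threshold crit"
proof -
  let ?S = "enat ` {n. min_error n d P \<Lambda> \<le> \<epsilon> * threshold crit}"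
  have "?S \<noteq> {}" using assms unfolding info_complexity_eq by (auto simp: Inf_enat_def split: if_splits)
  then have "Inf ?S \<in> ?S" unfolding Inf_enat_def by (auto intro: LeastI)
  then show ?thesis using assms unfolding info_complexity_eq by auto
qed

lemma info_complexity_all_le_std:
  "info_complexity crit \<epsilon> d P (Lambda_all P) \<le> info_complexity crit \<epsilon> d P (Lambda_std P)"
  unfolding info_complexity_eq using min_error_all_le_std
  by (intro INF_superset_mono) (auto intro: order_trans)

end

context eigen_rkhs
begin

lemma sqrt_le_init_error:
  assumes "0 < l j" shows "sqrt (l j) \<le> init_error d P \<Lambda>"
proof -
  have "hnorm P (eigvec j) = 1" using assms eigvec_ip[of j j] by (simp add: hnorm_def)
  then have "gnorm d P (\<lambda>x. eigvec j x - 0) \<le> worst_case_error d P (\<lambda>f x. 0)"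
    by (intro worst_case_error_upper[OF algorithms_ne]) auto
  then show ?thesis using gip_eigvec_self[of j] by (simp add: init_error_eq gnorm_def)
qed

text \<open>
  Half of the demand is left to the \<open>k\<close> functionals; as the infimum over algorithms need not be attained,
  an algorithm with three quarters of it is taken. The remaining quarter goes to sampling: with
  the stated \<open>n\<close>, the sampling error is at most \<open>\<epsilon> sqrt CRI / 4\<close>, and \<open>sqrt CRI\<close> is at most the threshold
  since \<open>sqrt (l 0)\<close> is at most the initial error.
\<close>

lemma std_complexity_le:
  assumes fr: "\<forall>\<delta>>0. \<exists>m L g. finite_rank_approx \<delta> m L g"
    and suml: "summable l" and l0: "0 < l 0" and \<epsilon>: "0 < \<epsilon>"
    and all: "info_complexity crit (\<epsilon> / 2) d P (Lambda_all P) = enat k"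
  shows "info_complexity crit \<epsilon> d P (Lambda_std P)
    \<le> enat (16 * (k + 1) * nat \<lceil>suminf l / CRI crit l\<rceil> * nat \<lceil>1 / \<epsilon>\<^sup>2\<rceil>)"
proof -
  define R where "R = threshold crit"
  define T where "T = suminf l"
  define c where "c = CRI crit l"
  define K where "K = nat \<lceil>T / c\<rceil>"
  define E where "E = nat \<lceil>1 / \<epsilon>\<^sup>2\<rceil>"
  define n where "n = 16 * (k + 1) * K * E"
  have T: "0 < T" unfolding T_def by (rule suminf_pos2[OF suml l_nonneg l0])
  have c: "0 < c" using l0 by (cases crit) (auto simp: c_def CRI_def)
  have init: "sqrt (l 0) \<le> init_error d P (Lambda_all P)" by (rule sqrt_le_init_error[OF l0])
  have R: "sqrt c \<le> R" using init by (cases crit) (auto simp: c_def CRI_def R_def threshold_def)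
  have R0: "0 < R" using R c by (meson less_le_trans real_sqrt_gt_zero)
  have K: "T / c \<le> real K" "0 < K" using T c by (auto simp: K_def intro: real_nat_ceiling_ge)
  have E: "1 / \<epsilon>\<^sup>2 \<le> real E" "0 < E" using \<epsilon> by (auto simp: E_def intro: real_nat_ceiling_ge)
  have n: "0 < n" using K E by (simp add: n_def)
  have "min_error k d P (Lambda_all P) \<le> \<epsilon> / 2 * R"
    unfolding R_def by (rule info_complexity_attained[OF all])
  also have "\<dots> < 3 / 4 * \<epsilon> * R" using \<epsilon> R0 by simp
  finally obtain A where A: "A \<in> algorithms k d P (Lambda_all P)" "worst_case_error d P A < 3 / 4 * \<epsilon> * R"
    using min_error_lessD[OF order_refl] by blast
  obtain m L g where m: "m \<le> k" and app: "finite_rank_approx (3 / 4 * \<epsilon> * R) m L g"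
    using finite_rank_approx_of_algorithm[OF A(1) less_imp_le[OF A(2)]] by blast
  have "real (m + 1) * T / real n \<le> real (k + 1) * T / real n"
    using m T by (intro divide_right_mono mult_right_mono) auto
  also have "\<dots> = T / (16 * real K * real E)"
  proof -
    have "real n = real (k + 1) * (16 * real K * real E)"
      unfolding n_def of_nat_mult by simp
    then show ?thesis using mult_divide_mult_cancel_left[of "real (k + 1)" T "16 * real K * real E"] by simp
  qed
  also have "\<dots> \<le> (\<epsilon> * R / 4)\<^sup>2"
  proof -
    have "T \<le> c * real K" using K(1) c by (simp add: field_simps)
    also have "\<dots> \<le> c * real K * (\<epsilon>\<^sup>2 * real E)"
    proof -
      have "1 \<le> \<epsilon>\<^sup>2 * real E" using E(1) \<epsilon> by (simp add: field_simps)
      then show ?thesis using mult_left_mono[of 1 "\<epsilon>\<^sup>2 * real E" "c * real K"] c by simp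
    qed
    also have "\<dots> = c * (\<epsilon>\<^sup>2 * real K * real E)" by simp
    also have "\<dots> \<le> R\<^sup>2 * (\<epsilon>\<^sup>2 * real K * real E)"
      using power_mono[OF R, of 2] c by (intro mult_right_mono) auto
    finally show ?thesis using K(2) E(2) by (simp add: field_simps power2_eq_square)
  qed
  finally have "sqrt (real (m + 1) * T / real n) \<le> \<epsilon> * R / 4"
    using \<epsilon> R0 by (intro real_le_lsqrt) auto
  then have sq: "3 / 4 * \<epsilon> * R + sqrt (real (m + 1) * suminf l / real n) \<le> \<epsilon> * R"
    by (simp add: T_def)
  obtain x h where xh: "\<forall>i<n. x i \<in> Dset P \<and> h i \<in> Gsp d P"
    and err: "\<forall>f\<in>Hsp P. gnorm d P (\<lambda>z. f z - (\<Sum>i<n. f (x i) * h i z))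
       \<le> (3 / 4 * \<epsilon> * R + sqrt (real (m + 1) * suminf l / real n)) * hnorm P f"
    using sampling_error[OF fr app suml n] by (elim exE conjE)
  define B where "B = (\<lambda>f z. \<Sum>i<n. (\<lambda>f. f (x i)) f * h i z)"
  have "B \<in> algorithms n d P (Lambda_std P)"
    unfolding algorithms_def B_def mem_Collect_eq using xh
    by (intro exI[of _ n] exI[of _ "\<lambda>i f. f (x i)"] exI[of _ h] conjI) (auto simp: Lambda_std_def)
  then have "min_error n d P (Lambda_std P) \<le> worst_case_error d P B"
    by (rule min_error_le[OF Lambda_std_subset])
  also have "\<dots> \<le> \<epsilon> * R"
  proof (rule worst_case_error_le)
    fix f assume f: "f \<in> Hsp P"
    show "gnorm d P (\<lambda>z. f z - B f z) \<le> \<epsilon> * R * hnorm P f"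
      using order_trans[OF bspec[OF err f] mult_right_mono[OF sq H.nrm_nonneg[OF f]]]
      by (simp add: B_def)
  qed (use \<epsilon> R0 in simp)
  finally show ?thesis
    unfolding n_def[unfolded K_def E_def T_def c_def, symmetric]
    by (intro info_complexity_le) (simp add: R_def)
qed

end

lemma eigen_rkhs_exists:
  assumes "approximation_setting d P" "eigenvalue_list d P l"
  shows "\<exists>e. eigen_rkhs d P l e"
proof -
  obtain e where "decseq l" and nn: "\<forall>j. 0 \<le> l j"
    and e1: "\<forall>j. 0 < l j \<longrightarrow> e j \<in> Hsp P \<and> W d P (e j) = (\<lambda>x. l j * e j x)"
    and e2: "\<forall>i j. 0 < l i \<and> 0 < l j \<longrightarrow> ip P (e i) (e j) = (if i = j then 1 else 0)"
    and e3: "\<forall>\<mu>>0. \<forall>f\<in>Hsp P. W d P f = (\<lambda>x. \<mu> * f x) \<and> (\<forall>j. l j = \<mu> \<longrightarrow> ip P f (e j) = 0)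
             \<longrightarrow> f = (\<lambda>x. 0)"
    using assms(2) unfolding eigenvalue_list_def by (elim conjE exE)
  have "eigen_rkhs d P l e"
  proof
    show "approximation_setting d P" by (rule assms(1))
    show "0 \<le> l j" for j using nn by simp
    show "e j \<in> Hsp P \<and> W d P (e j) = (\<lambda>x. l j * e j x)" if "0 < l j" for j
      using e1 that by simp
    show "ip P (e i) (e j) = (if i = j then 1 else 0)" if "0 < l i" "0 < l j" for i j
      using e2 that by simp
    show "f = (\<lambda>x. 0)" if "0 < \<mu>" "f \<in> Hsp P" "W d P f = (\<lambda>x. \<mu> * f x)"
      "\<And>j. l j = \<mu> \<Longrightarrow> ip P f (e j) = 0" for \<mu> f
      using e3[rule_format, of \<mu> f] that by simp
  qed
  then show ?thesis by (intro exI[of _ e])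
qed

section \<open>Asymptotics and tractability\<close>

lemma ln_enat_mono: "m \<le> n \<Longrightarrow> ln_enat m \<le> ln_enat n"
proof (cases m; cases n)
  fix a b assume "m \<le> n" "m = enat a" "n = enat b"
  then show ?thesis by (cases "a = 0"; cases "b = 0") (auto simp: ln_enat_def)
qed (auto simp: ln_enat_def)

lemma ln_enat_nonneg: "0 \<le> ln_enat n"
proof (cases n)
  case (enat k)
  then show ?thesis by (cases "k = 0") (auto simp: ln_enat_def)
qed (simp add: ln_enat_def)

lemma powr_uminus_inverse: "0 < (x::real) \<Longrightarrow> x powr (- s) = (1 / x) powr s"
  by (simp add: powr_minus_divide powr_divide)

text \<open>
  One of \<open>1/\<epsilon>\<close> and \<open>d\<close> is at least half of their sum; this is where both exponents must be positive.
\<close>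

lemma denominator_at_top:
  fixes \<epsilon> :: "nat \<Rightarrow> real" and d :: "nat \<Rightarrow> nat"
  assumes s: "0 < s" and t: "0 < t" and pos: "\<And>k. 0 < \<epsilon> k"
    and lim: "filterlim (\<lambda>k. inverse (\<epsilon> k) + real (d k)) at_top sequentially"
  shows "filterlim (\<lambda>k. \<epsilon> k powr (- s) + real (d k) powr t) at_top sequentially"
  unfolding filterlim_at_top
proof
  fix Z0 :: real
  define Z where "Z = max 1 Z0"
  define Y where "Y = max (Z powr (1 / s)) (Z powr (1 / t))"
  have Z: "0 < Z" "Z0 \<le> Z" by (auto simp: Z_def)
  have raise: "Z \<le> x powr a" if "0 < a" "Z powr (1 / a) \<le> x" for x a
    using powr_mono2[OF _ _ that(2), of a] that(1) Z(1) by (simp add: powr_powr)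
  have "\<forall>\<^sub>F k in sequentially. 2 * Y \<le> inverse (\<epsilon> k) + real (d k)"
    using lim unfolding filterlim_at_top by blast
  then show "\<forall>\<^sub>F k in sequentially. Z0 \<le> \<epsilon> k powr (- s) + real (d k) powr t"
  proof eventually_elim
    case (elim k)
    then have "Y \<le> inverse (\<epsilon> k) \<or> Y \<le> real (d k)" by linarith
    then show ?case
    proof
      assume "Y \<le> inverse (\<epsilon> k)"
      then have "Z \<le> \<epsilon> k powr (- s)"
        using raise[OF s, of "inverse (\<epsilon> k)"] pos[of k]
        by (simp add: powr_uminus_inverse Y_def inverse_eq_divide)
      then show ?thesis using Z by (smt (verit) powr_ge_zero)
    next
      assume "Y \<le> real (d k)"
      then have "Z \<le> real (d k) powr t" using raise[OF t, of "real (d k)"] by (simp add: Y_def)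
      then show ?thesis using Z by (smt (verit) powr_ge_zero)
    qed
  qed
qed

text \<open>
  This criterion treats sequences along which \<open>\<epsilon>\<close> and \<open>d\<close> vary jointly: the bound with \<open>\<eta> D\<close> can be
  verified for each summand by looking at \<open>\<epsilon>\<close> or at \<open>d\<close> alone.
\<close>

lemma quotient_tendsto_zero:
  fixes x D :: "nat \<Rightarrow> real"
  assumes D: "filterlim D at_top sequentially"
    and x: "\<And>\<eta>. 0 < \<eta> \<Longrightarrow> \<exists>B. \<forall>k. \<bar>x k\<bar> \<le> B + \<eta> * D k"
  shows "(\<lambda>k. x k / D k) \<longlonglongrightarrow> 0"
proof (rule LIMSEQ_I)
  fix r :: real assume r: "0 < r"
  obtain B where B: "\<And>k. \<bar>x k\<bar> \<le> B + r / 2 * D k" using x[of "r / 2"] r by auto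
  have "\<forall>\<^sub>F k in sequentially. max 1 (2 * \<bar>B\<bar> / r + 1) \<le> D k"
    using D unfolding filterlim_at_top by blast
  then have "\<forall>\<^sub>F k in sequentially. norm (x k / D k - 0) < r"
  proof eventually_elim
    case (elim k)
    then have Dk: "0 < D k" "2 * \<bar>B\<bar> / r < D k" by auto
    then have "\<bar>B\<bar> < r / 2 * D k" using r by (simp add: field_simps)
    then have "\<bar>x k\<bar> < r * D k" using B[of k] by linarith
    then show ?case using Dk by (simp add: divide_less_eq)
  qed
  then show "\<exists>no. \<forall>k\<ge>no. norm (x k / D k - 0) < r" by (simp add: eventually_sequentially)
qed

text \<open>
  Apply \<open>ln y \<le> y\<close> to \<open>y = \<eta> s x\<^sup>s\<close>.
\<close>

lemma ln_le_powr_plus_const: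
  fixes s \<eta> :: real
  assumes "0 < s" "0 < \<eta>"
  shows "\<exists>B. \<forall>x>0. ln x \<le> B + \<eta> * x powr s"
proof (intro exI allI impI)
  fix x :: real assume x: "0 < x"
  have "ln (\<eta> * s * x powr s) \<le> \<eta> * s * x powr s"
    using assms x by (intro ln_bound) simp
  moreover have "ln (\<eta> * s * x powr s) = ln (\<eta> * s) + s * ln x"
    using assms x by (simp add: ln_mult ln_powr)
  ultimately have "s * ln x \<le> s * (- ln (\<eta> * s) / s + \<eta> * x powr s)"
    using assms by (simp add: algebra_simps)
  then show "ln x \<le> - ln (\<eta> * s) / s + \<eta> * x powr s" using assms by simp
qed

lemma null_quotient_le_powr_plus_const:
  fixes a :: "nat \<Rightarrow> real"
  assumes lim: "(\<lambda>d. a d / real d powr t) \<longlonglongrightarrow> 0" and \<eta>: "0 < \<eta>"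
  shows "\<exists>B. \<forall>d\<ge>1. \<bar>a d\<bar> \<le> B + \<eta> * real d powr t"
proof -
  have "\<forall>\<^sub>F d in sequentially. \<bar>a d / real d powr t\<bar> < \<eta>"
    using order_tendstoD(2)[OF tendsto_rabs_zero[OF lim] \<eta>] .
  then obtain D where D: "\<And>d. d \<ge> D \<Longrightarrow> \<bar>a d / real d powr t\<bar> < \<eta>"
    by (auto simp: eventually_sequentially)
  have "\<bar>a d\<bar> \<le> (\<Sum>i<D. \<bar>a i\<bar>) + \<eta> * real d powr t" if "d \<ge> 1" for d
  proof (cases "d < D")
    case True
    then have "\<bar>a d\<bar> \<le> (\<Sum>i<D. \<bar>a i\<bar>)" by (intro member_le_sum) auto
    then show ?thesis using \<eta> by (simp add: add_increasing2)
  next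
    case False
    have "0 < real d powr t" using that by simp
    then have "\<bar>a d\<bar> < \<eta> * real d powr t"
      using D[of d] False by (simp add: abs_divide divide_less_eq)
    moreover have "0 \<le> (\<Sum>i<D. \<bar>a i\<bar>)" by (simp add: sum_nonneg)
    ultimately show ?thesis by linarith
  qed
  then show ?thesis by blast
qed

lemma ln_sample_size_le:
  assumes \<epsilon>: "0 < \<epsilon>" "\<epsilon> \<le> 1" and x: "0 < x"
  shows "ln (real (16 * (m + 1) * nat \<lceil>x\<rceil> * nat \<lceil>1 / \<epsilon>\<^sup>2\<rceil>))
    \<le> ln 64 + ln (real m) + ln (real_of_int \<lceil>x\<rceil>) + 2 * ln (1 / \<epsilon>)"
proof -
  have x1: "0 < \<lceil>x\<rceil>" using x by simp
  have inv: "1 \<le> 1 / \<epsilon>\<^sup>2" using \<epsilon> by (simp add: power_le_one)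
  then have E1: "0 < \<lceil>1 / \<epsilon>\<^sup>2\<rceil>" by linarith
  have "real_of_int \<lceil>1 / \<epsilon>\<^sup>2\<rceil> \<le> 1 / \<epsilon>\<^sup>2 + 1" by linarith
  also have "\<dots> \<le> 2 * (1 / \<epsilon>)\<^sup>2" using inv by (simp add: power_divide)
  finally have E2: "real_of_int \<lceil>1 / \<epsilon>\<^sup>2\<rceil> \<le> 2 * (1 / \<epsilon>)\<^sup>2" .
  have "ln (real_of_int \<lceil>1 / \<epsilon>\<^sup>2\<rceil>) \<le> ln (2 * (1 / \<epsilon>)\<^sup>2)"
    using E1 E2 \<epsilon> by (subst ln_le_cancel_iff) auto
  also have "\<dots> = ln 2 + 2 * ln (1 / \<epsilon>)"
    using \<epsilon> by (subst ln_mult) (auto simp: ln_realpow simp del: power_divide)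
  finally have lnE: "ln (real_of_int \<lceil>1 / \<epsilon>\<^sup>2\<rceil>) \<le> ln 2 + 2 * ln (1 / \<epsilon>)" .
  have lnm: "ln (real (m + 1)) \<le> ln 2 + ln (real m)"
  proof (cases "m = 0")
    case False
    then have "ln (real (m + 1)) \<le> ln (2 * real m)" by (subst ln_le_cancel_iff) auto
    then show ?thesis using False by (simp add: ln_mult)
  qed simp
  have "real (16 * (m + 1) * nat \<lceil>x\<rceil> * nat \<lceil>1 / \<epsilon>\<^sup>2\<rceil>)
      = 16 * real (m + 1) * real_of_int \<lceil>x\<rceil> * real_of_int \<lceil>1 / \<epsilon>\<^sup>2\<rceil>"
    using x1 E1 unfolding of_nat_mult by (simp add: of_nat_nat less_imp_le)
  also have "ln \<dots> = ln 16 + ln (real (m + 1)) + ln (real_of_int \<lceil>x\<rceil>) + ln (real_of_int \<lceil>1 / \<epsilon>\<^sup>2\<rceil>)"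
  proof -
    have "ln (16 * A * X * Y) = ln 16 + ln A + ln X + ln Y"
      if "0 < A" "0 < X" "0 < Y" for A X Y :: real
      using that by (simp add: ln_mult)
    from this[of "real (m + 1)"] show ?thesis using x1 E1 by simp
  qed
  also have "ln (64::real) = ln 16 + ln 2 + ln 2"
    using ln_mult[of 16 "4::real"] ln_mult[of 2 "2::real"] by simp
  with lnE lnm have "ln 16 + ln (real (m + 1)) + ln (real_of_int \<lceil>x\<rceil>) + ln (real_of_int \<lceil>1 / \<epsilon>\<^sup>2\<rceil>)
      \<le> ln 64 + ln (real m) + ln (real_of_int \<lceil>x\<rceil>) + 2 * ln (1 / \<epsilon>)"
    by linarith
  finally show ?thesis .
qed

lemma summable_of_trace:
  assumes "decseq l" "\<And>j. 0 \<le> l j" "0 < eigen_trace l" "eigen_trace l < \<infinity>"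
  shows "summable l" "0 < l 0" "enn2real (eigen_trace l) = suminf l" "0 < suminf l"
proof -
  show suml: "summable l"
    using assms(2,4) by (intro summable_suminf_not_top) (auto simp: eigen_trace_def)
  have tr: "eigen_trace l = ennreal (suminf l)"
    unfolding eigen_trace_def using assms(2) suml by (rule suminf_ennreal2)
  then show "enn2real (eigen_trace l) = suminf l"
    using suminf_nonneg[OF suml assms(2)] by simp
  show "0 < suminf l" using assms(3) tr by (simp add: ennreal_less_zero_iff)
  show "0 < l 0"
  proof (rule ccontr)
    assume "\<not> 0 < l 0"
    then have "l j = 0" for j
      using decseqD[OF assms(1), of 0 j] assms(2)[of j] by simp
    then have "l = (\<lambda>j. 0)" by (intro ext)
    then show False using \<open>0 < suminf l\<close> by simp
  qed
qed

text \<open>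
  For fixed \<open>d\<close> and \<open>\<epsilon> \<rightarrow> 0\<close>, tractability makes the complexity eventually finite, so the minimal errors tend
  to \<open>0\<close>. The sequence stays below the initial error, as admissible sequences must.
\<close>

lemma finite_rank_of_tractable:
  assumes wt: "weakly_tractable s t crit P Lambda_all" and d: "1 \<le> d"
    and eig: "eigen_rkhs d (P d) l e" and l0: "0 < l 0"
  shows "\<forall>\<delta>>0. \<exists>m L g. embedded_rkhs.finite_rank_approx d (P d) \<delta> m L g"
proof (intro allI impI)
  fix \<delta> :: real assume \<delta>: "0 < \<delta>"
  interpret eigen_rkhs d "P d" l e by (rule eig)
  define i where "i = init_error d (P d) (Lambda_all (P d))"
  have "sqrt (l 0) \<le> i" unfolding i_def by (rule sqrt_le_init_error[OF l0])
  moreover have "0 < sqrt (l 0)" using l0 by simp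
  ultimately have i: "0 < i" by linarith
  define R where "R = threshold crit"
  have R: "0 < R" using i by (cases crit) (auto simp: R_def threshold_def i_def)
  define c where "c = min 1 i"
  have c: "0 < c" "c \<le> 1" "c \<le> i" using i by (auto simp: c_def)
  define \<epsilon> where "\<epsilon> k = c * inverse (real (Suc (Suc k)))" for k
  have \<epsilon>: "0 < \<epsilon> k" "\<epsilon> k < c" for k
    using c by (auto simp: \<epsilon>_def divide_simps)
  have valid: "\<forall>k. 0 < \<epsilon> k \<and> \<epsilon> k \<le> 1 \<and> 1 \<le> d \<and>
      \<epsilon> k < (case crit of Abs \<Rightarrow> init_error d (P d) (Lambda_all (P d)) | Norm \<Rightarrow> 1)"
    using \<epsilon> c d by (cases crit) (auto simp flip: i_def intro: less_le_trans less_imp_le)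
  have \<epsilon>0: "\<epsilon> \<longlonglongrightarrow> 0"
    unfolding \<epsilon>_def using tendsto_mult_right_zero[OF LIMSEQ_Suc[OF LIMSEQ_inverse_real_of_nat], of c] .
  have "filterlim (\<lambda>k. inverse (\<epsilon> k)) at_top sequentially"
    using \<epsilon>0 \<epsilon>(1) by (intro filterlim_inverse_at_top) auto
  then have "filterlim (\<lambda>k. inverse (\<epsilon> k) + real d) at_top sequentially"
    by (rule filterlim_at_top_mono) simp
  with valid have lim: "(\<lambda>k. ln_enat (info_complexity crit (\<epsilon> k) d (P d) (Lambda_all (P d)))
      / ereal (\<epsilon> k powr (- s) + real d powr t)) \<longlonglongrightarrow> 0"
    using wt unfolding weakly_tractable_def by (elim allE[of _ \<epsilon>] allE[of _ "\<lambda>_. d"]) auto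
  have "\<forall>\<^sub>F k in sequentially. \<epsilon> k * R < \<delta>"
    using order_tendstoD(2)[OF tendsto_mult_left_zero[OF \<epsilon>0] \<delta>] .
  moreover have "\<forall>\<^sub>F k in sequentially. ln_enat (info_complexity crit (\<epsilon> k) d (P d) (Lambda_all (P d)))
      / ereal (\<epsilon> k powr (- s) + real d powr t) < 1"
    by (rule order_tendstoD(2)[OF lim]) simp
  ultimately have "\<exists>k. \<epsilon> k * R < \<delta> \<and> ln_enat (info_complexity crit (\<epsilon> k) d (P d) (Lambda_all (P d)))
      / ereal (\<epsilon> k powr (- s) + real d powr t) < 1"
    using eventually_happens'[OF sequentially_bot eventually_conj] by fast
  then obtain k where k: "\<epsilon> k * R < \<delta>" "ln_enat (info_complexity crit (\<epsilon> k) d (P d) (Lambda_all (P d)))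
      / ereal (\<epsilon> k powr (- s) + real d powr t) < 1" by blast
  have den: "0 < \<epsilon> k powr (- s) + real d powr t" using \<epsilon>(1)[of k] by (simp add: add_pos_nonneg)
  obtain n where n: "info_complexity crit (\<epsilon> k) d (P d) (Lambda_all (P d)) = enat n"
  proof (cases "info_complexity crit (\<epsilon> k) d (P d) (Lambda_all (P d))")
    case infinity
    then show ?thesis using k(2) den by (simp add: ln_enat_def)
  qed (rule that)
  have "min_error n d (P d) (Lambda_all (P d)) < \<delta>"
    using info_complexity_attained[OF n] k(1) by (simp add: R_def)
  then obtain A where "A \<in> algorithms n d (P d) (Lambda_all (P d))" "worst_case_error d (P d) A < \<delta>"
    using min_error_lessD[OF order_refl] by blast
  then show "\<exists>m L g. finite_rank_approx \<delta> m L g"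
    using finite_rank_approx_of_algorithm[of A n \<delta>] by auto
qed

theorem theorem3p13:
  fixes P :: "nat \<Rightarrow> space_data"
    and l :: "nat \<Rightarrow> nat \<Rightarrow> real"
    and crit :: criterion
    and s t :: real
  assumes "\<And>d. 1 \<le> d \<Longrightarrow> approximation_setting d (P d)"
    and "\<And>d. 1 \<le> d \<Longrightarrow> eigenvalue_list d (P d) (l d)"
    and "0 < s" and "0 < t"
    and "\<And>d. 1 \<le> d \<Longrightarrow> 0 < eigen_trace (l d) \<and> eigen_trace (l d) < \<infinity>"
    and "(\<lambda>d. ln (real_of_int \<lceil>enn2real (eigen_trace (l d)) / CRI crit (l d)\<rceil>) / real d powr t) \<longlonglongrightarrow> 0"
  shows "weakly_tractable s t crit P Lambda_all \<longleftrightarrow> weakly_tractable s t crit P Lambda_std"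
proof
  have rkhs: "embedded_rkhs d (P d)" if "1 \<le> d" for d
    by (rule embedded_rkhs.intro[OF assms(1)[OF that]])
  have init: "init_error d (P d) \<Lambda> = init_error d (P d) \<Lambda>'" if "1 \<le> d" for d \<Lambda> \<Lambda>'
    using embedded_rkhs.init_error_eq[OF rkhs[OF that]] by simp
  define den where "den \<epsilon> d = \<epsilon> powr (- s) + real d powr t" for \<epsilon> :: real and d :: nat
  have den_pos: "0 < den \<epsilon> d" if "0 < \<epsilon>" for \<epsilon> d
    using that by (simp add: den_def add_pos_nonneg)
  {
    assume wt: "weakly_tractable s t crit P Lambda_std"
    show "weakly_tractable s t crit P Lambda_all"
      unfolding weakly_tractable_def
    proof (intro allI impI, elim conjE)
      fix \<epsilon> :: "nat \<Rightarrow> real" and d :: "nat \<Rightarrow> nat"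
      assume valid: "\<forall>k. 0 < \<epsilon> k \<and> \<epsilon> k \<le> 1 \<and> 1 \<le> d k \<and>
          \<epsilon> k < (case crit of Abs \<Rightarrow> init_error (d k) (P (d k)) (Lambda_all (P (d k))) | Norm \<Rightarrow> 1)"
        and lim: "filterlim (\<lambda>k. inverse (\<epsilon> k) + real (d k)) at_top sequentially"
      have "\<forall>k. 0 < \<epsilon> k \<and> \<epsilon> k \<le> 1 \<and> 1 \<le> d k \<and>
          \<epsilon> k < (case crit of Abs \<Rightarrow> init_error (d k) (P (d k)) (Lambda_std (P (d k))) | Norm \<Rightarrow> 1)"
        using valid init by (cases crit) (simp_all, metis)
      with lim wt have std: "(\<lambda>k. ln_enat (info_complexity crit (\<epsilon> k) (d k) (P (d k)) (Lambda_std (P (d k))))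
          / ereal (den (\<epsilon> k) (d k))) \<longlonglongrightarrow> 0"
        unfolding weakly_tractable_def den_def by (elim allE[of _ \<epsilon>] allE[of _ d]) auto
      have pos: "0 < ereal (den (\<epsilon> k) (d k))" for k using den_pos valid by simp
      have "(\<lambda>k. ln_enat (info_complexity crit (\<epsilon> k) (d k) (P (d k)) (Lambda_all (P (d k))))
          / ereal (den (\<epsilon> k) (d k))) \<longlonglongrightarrow> 0"
      proof (rule tendsto_sandwich[OF _ _ tendsto_const std]; intro always_eventually allI)
        fix k
        show "0 \<le> ln_enat (info_complexity crit (\<epsilon> k) (d k) (P (d k)) (Lambda_all (P (d k))))
          / ereal (den (\<epsilon> k) (d k))"
          using ln_enat_nonneg pos by (simp add: ereal_le_divide_pos)
        show "ln_enat (info_complexity crit (\<epsilon> k) (d k) (P (d k)) (Lambda_all (P (d k)))) / ereal (den (\<epsilon> k) (d k))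
          \<le> ln_enat (info_complexity crit (\<epsilon> k) (d k) (P (d k)) (Lambda_std (P (d k)))) / ereal (den (\<epsilon> k) (d k))"
          using valid pos
          by (intro ereal_divide_right_mono ln_enat_mono embedded_rkhs.info_complexity_all_le_std rkhs) auto
      qed
      then show "(\<lambda>k. ln_enat (info_complexity crit (\<epsilon> k) (d k) (P (d k)) (Lambda_all (P (d k))))
          / ereal (\<epsilon> k powr (- s) + real (d k) powr t)) \<longlonglongrightarrow> 0"
        by (simp add: den_def)
    qed
  }
  assume wt: "weakly_tractable s t crit P Lambda_all"
  show "weakly_tractable s t crit P Lambda_std"
    unfolding weakly_tractable_def
  proof (intro allI impI, elim conjE)
    fix \<epsilon> :: "nat \<Rightarrow> real" and d :: "nat \<Rightarrow> nat"
    assume valid: "\<forall>k. 0 < \<epsilon> k \<and> \<epsilon> k \<le> 1 \<and> 1 \<le> d k \<and>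
        \<epsilon> k < (case crit of Abs \<Rightarrow> init_error (d k) (P (d k)) (Lambda_std (P (d k))) | Norm \<Rightarrow> 1)"
      and lim: "filterlim (\<lambda>k. inverse (\<epsilon> k) + real (d k)) at_top sequentially"
    have \<epsilon>: "0 < \<epsilon> k" "\<epsilon> k \<le> 1" and d: "1 \<le> d k" for k using valid by auto
    \<comment> \<open>Tractability for \<open>Lambda_all\<close> is used at \<open>\<epsilon> / 2\<close>, which changes the denominator by a bounded factor.\<close>
    define D where "D k = den (\<epsilon> k) (d k)" for k
    define D' where "D' k = den (\<epsilon> k / 2) (d k)" for k
    have Dpos: "0 < D k" and D'pos: "0 < D' k" for k using den_pos \<epsilon> by (simp_all add: D_def D'_def)
    have D'le: "D' k \<le> 2 powr s * D k" for k
    proof -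
      have "(\<epsilon> k / 2) powr (- s) = 2 powr s * \<epsilon> k powr (- s)"
        using \<epsilon>(1)[of k] by (simp add: powr_divide powr_minus field_simps)
      moreover have "real (d k) powr t \<le> 2 powr s * real (d k) powr t"
        using assms(3) by (simp add: ge_one_powr_ge_zero mult_le_cancel_right1)
      ultimately show ?thesis by (simp add: D_def D'_def den_def distrib_left)
    qed
    define I where "I k = info_complexity crit (\<epsilon> k / 2) (d k) (P (d k)) (Lambda_all (P (d k)))" for k
    define J where "J k = info_complexity crit (\<epsilon> k) (d k) (P (d k)) (Lambda_std (P (d k)))" for k
    have Ilim: "(\<lambda>k. ln_enat (I k) / ereal (D' k)) \<longlonglongrightarrow> 0"
    proof -
      have "\<forall>k. 0 < \<epsilon> k / 2 \<and> \<epsilon> k / 2 \<le> 1 \<and> 1 \<le> d k \<and>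
        \<epsilon> k / 2 < (case crit of Abs \<Rightarrow> init_error (d k) (P (d k)) (Lambda_all (P (d k))) | Norm \<Rightarrow> 1)"
      proof (intro allI conjI)
        fix k
        have "\<epsilon> k / 2 < \<epsilon> k" using \<epsilon>(1)[of k] by simp
        also have "\<dots> < (case crit of Abs \<Rightarrow> init_error (d k) (P (d k)) (Lambda_std (P (d k))) | Norm \<Rightarrow> 1)"
          using valid by blast
        also have "\<dots> = (case crit of Abs \<Rightarrow> init_error (d k) (P (d k)) (Lambda_all (P (d k))) | Norm \<Rightarrow> 1)"
          using init[OF d[of k]] by (cases crit) auto
        finally show "\<epsilon> k / 2 < (case crit of Abs \<Rightarrow> init_error (d k) (P (d k)) (Lambda_all (P (d k))) | Norm \<Rightarrow> 1)" .
        show "0 < \<epsilon> k / 2" "\<epsilon> k / 2 \<le> 1" "1 \<le> d k" using \<epsilon>[of k] d[of k] by auto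
      qed
      moreover have "filterlim (\<lambda>k. inverse (\<epsilon> k / 2) + real (d k)) at_top sequentially"
        using lim
      proof (rule filterlim_at_top_mono, intro always_eventually allI)
        fix k
        have "inverse (\<epsilon> k) \<le> inverse (\<epsilon> k / 2)"
          using \<epsilon>(1)[of k] by (intro le_imp_inverse_le) auto
        then show "inverse (\<epsilon> k) + real (d k) \<le> inverse (\<epsilon> k / 2) + real (d k)" by simp
      qed
      ultimately show ?thesis
        using wt unfolding weakly_tractable_def I_def D'_def den_def
        by (elim allE[of _ "\<lambda>k. \<epsilon> k / 2"] allE[of _ d]) auto
    qed
    define y where "y k = real_of_ereal (ln_enat (I k) / ereal (D' k))" for k
    have ylim: "y \<longlonglongrightarrow> 0"
      unfolding y_def using Ilim by (intro lim_real_of_ereal) (simp add: zero_ereal_def)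
    have Ifin: "\<forall>\<^sub>F k in sequentially. I k \<noteq> \<infinity>"
    proof -
      have "\<forall>\<^sub>F k in sequentially. ln_enat (I k) / ereal (D' k) < 1"
        by (rule order_tendstoD(2)[OF Ilim]) simp
      then show ?thesis
      proof (rule eventually_mono)
        fix k assume "ln_enat (I k) / ereal (D' k) < 1"
        then show "I k \<noteq> \<infinity>" using D'pos[of k] by (cases "I k") (auto simp: ln_enat_def)
      qed
    qed
    define x where "x k = enn2real (eigen_trace (l (d k))) / CRI crit (l (d k))" for k
    define a where "a k = ln (real_of_int \<lceil>x k\<rceil>)" for k
    \<comment> \<open>Bounds the logarithm of the expression in \<open>std_complexity_le\<close>, divided by the denominator; \<open>y\<close> is the quotient for \<open>Lambda_all\<close>.\<close>
    define z where "z k = (ln 64 + a k + 2 * ln (1 / \<epsilon> k)) / D k + 2 powr s * y k" for k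
    have "(\<lambda>k. (ln 64 + a k + 2 * ln (1 / \<epsilon> k)) / D k) \<longlonglongrightarrow> 0"
    proof (rule quotient_tendsto_zero)
      show "filterlim D at_top sequentially"
        unfolding D_def den_def by (rule denominator_at_top[OF assms(3,4) \<epsilon>(1) lim])
      fix \<eta> :: real assume \<eta>: "0 < \<eta>"
      obtain B1 where B1: "\<And>d. d \<ge> 1 \<Longrightarrow>
          \<bar>ln (real_of_int \<lceil>enn2real (eigen_trace (l d)) / CRI crit (l d)\<rceil>)\<bar> \<le> B1 + \<eta> * real d powr t"
        using null_quotient_le_powr_plus_const[OF assms(6) \<eta>] by blast
      obtain B2 where B2: "\<And>x. 0 < x \<Longrightarrow> ln x \<le> B2 + \<eta> / 2 * x powr s"
        using ln_le_powr_plus_const[OF assms(3), of "\<eta> / 2"] \<eta> by auto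
      have "\<bar>ln 64 + a k + 2 * ln (1 / \<epsilon> k)\<bar> \<le> (ln 64 + B1 + 2 * B2) + \<eta> * D k" for k
      proof -
        have 1: "\<bar>a k\<bar> \<le> B1 + \<eta> * real (d k) powr t"
          unfolding a_def x_def by (rule B1[OF d])
        have 2: "ln (1 / \<epsilon> k) \<le> B2 + \<eta> / 2 * \<epsilon> k powr (- s)"
          using B2[of "1 / \<epsilon> k"] \<epsilon>(1)[of k] by (simp add: powr_uminus_inverse)
        have 3: "0 \<le> ln (1 / \<epsilon> k)" using \<epsilon>[of k] by (intro ln_ge_zero) auto
        have 4: "\<eta> * D k = \<eta> * \<epsilon> k powr (- s) + \<eta> * real (d k) powr t"
          by (simp add: D_def den_def distrib_left)
        have "0 \<le> ln (64::real)" by simp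
        with 1 2 3 4 show ?thesis by linarith
      qed
      then show "\<exists>B. \<forall>k. \<bar>ln 64 + a k + 2 * ln (1 / \<epsilon> k)\<bar> \<le> B + \<eta> * D k" by blast
    qed
    then have zlim: "z \<longlonglongrightarrow> 0"
      unfolding z_def using tendsto_add[OF _ tendsto_mult_right_zero[OF ylim, of "2 powr s"]] by fastforce
    have bound: "ln_enat (J k) / ereal (D k) \<le> ereal (z k)" if fin: "I k \<noteq> \<infinity>" for k
    proof -
      obtain m where m: "I k = enat m" using fin by auto
      obtain e where eig: "eigen_rkhs (d k) (P (d k)) (l (d k)) e"
        using eigen_rkhs_exists[OF assms(1,2)[OF d]] by blast
      interpret E: eigen_rkhs "d k" "P (d k)" "l (d k)" e by (rule eig)
      have "decseq (l (d k))" using assms(2)[OF d[of k]] by (simp add: eigenvalue_list_def)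
      note tr = summable_of_trace[OF this E.l_nonneg] assms(5)[OF d[of k]]
      have suml: "summable (l (d k))" and l0: "0 < l (d k) 0"
        and T: "enn2real (eigen_trace (l (d k))) = suminf (l (d k))" "0 < suminf (l (d k))"
        using tr by auto
      have cpos: "0 < CRI crit (l (d k))" using l0 by (cases crit) (auto simp: CRI_def)
      have xpos: "0 < x k" using T cpos by (simp add: x_def)
      have "J k \<le> enat (16 * (m + 1) * nat \<lceil>suminf (l (d k)) / CRI crit (l (d k))\<rceil> * nat \<lceil>1 / (\<epsilon> k)\<^sup>2\<rceil>)"
        unfolding J_def
        by (rule E.std_complexity_le[OF finite_rank_of_tractable[where P = P, OF wt d eig l0]
              suml l0 \<epsilon>(1) m[unfolded I_def]])
      then have "ln_enat (J k) \<le> ln_enat (enat (16 * (m + 1) * nat \<lceil>x k\<rceil> * nat \<lceil>1 / (\<epsilon> k)\<^sup>2\<rceil>))"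
        unfolding x_def T by (rule ln_enat_mono)
      also have "\<dots> \<le> ereal (ln 64 + ln (real m) + a k + 2 * ln (1 / \<epsilon> k))"
        unfolding a_def ln_enat_def using ln_sample_size_le[OF \<epsilon> xpos] by simp
      also have "\<dots> \<le> ereal (z k * D k)"
      proof -
        have yk: "y k = ln (real m) / D' k" by (simp add: y_def m ln_enat_def)
        have ym: "ln (real m) = y k * D' k" using D'pos[of k] by (simp add: yk)
        have "0 \<le> ln (real m)" by (cases "m = 0") auto
        then have "0 \<le> y k" using D'pos[of k] by (simp add: yk)
        then have "ln (real m) \<le> y k * (2 powr s * D k)"
          unfolding ym using D'le by (intro mult_left_mono)
        moreover have "z k * D k = (ln 64 + a k + 2 * ln (1 / \<epsilon> k)) + y k * (2 powr s * D k)"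
          unfolding z_def distrib_right[of "_ / D k"] using Dpos[of k] by simp
        ultimately show ?thesis by simp
      qed
      finally have "ln_enat (J k) / ereal (D k) \<le> ereal (z k * D k) / ereal (D k)"
        using Dpos by (intro ereal_divide_right_mono) auto
      then show ?thesis using Dpos[of k] by simp
    qed
    have "(\<lambda>k. ln_enat (J k) / ereal (D k)) \<longlonglongrightarrow> 0"
    proof (rule tendsto_sandwich[OF _ _ tendsto_const])
      show "\<forall>\<^sub>F k in sequentially. 0 \<le> ln_enat (J k) / ereal (D k)"
        using ln_enat_nonneg Dpos by (intro always_eventually allI) (simp add: ereal_le_divide_pos)
      show "\<forall>\<^sub>F k in sequentially. ln_enat (J k) / ereal (D k) \<le> ereal (z k)"
        using Ifin by (rule eventually_mono) (rule bound)
      show "(\<lambda>k. ereal (z k)) \<longlonglongrightarrow> 0"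
        using zlim by (simp add: zero_ereal_def)
    qed
    then show "(\<lambda>k. ln_enat (info_complexity crit (\<epsilon> k) (d k) (P (d k)) (Lambda_std (P (d k))))
        / ereal (\<epsilon> k powr (- s) + real (d k) powr t)) \<longlonglongrightarrow> 0"
      by (simp add: J_def D_def den_def)
  qed
qed

end
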